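(* Let $(\mathbb U,\mathcal Q,\xi)$ be as in the context, let $J$ be a class of $(\mathbb U,\mathcal Q)$-distributors as in the context, let $X$ be a $J$-cocomplete $(\mathbb U,\mathcal Q)$-category, and let $v$ be a $(\mathbb U,\mathcal Q)$-distributor from $X$ to $X$ with $v\in J$. The following are equivalent: (i) $\ulcorner v\urcorner$ is of type $X\to JX$ and $\ulcorner v\urcorner\dashv\mathcal S$; (ii) $v$ is approximating and $v$ is the lifting of $\mathsf y_*$ along $\mathcal S^*$, i.e. $v=\Downarrow$; (iii) $v$ is approximating and $J$-cocontinuous; (iv) $v$ is approximating at $x$ for every $x\in X$, and $v$ is $J$-cocontinuous; (v) $v$ is approximating at $x$ for every $x\in X$, and $\ulcorner v\urcorner\colon X\to JX$ is a $J$-cocontinuous $(\mathbb U,\mathcal Q)$-functor; (vi) for all $\sigma\in UX$ and $\psi\in JX$, $\widehat X(U\ulcorner v\urcorner(\sigma),\psi)=X(\sigma,\mathcal S(\psi))$.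
   Context: Quantale. $\mathcal{Q}=(Q,\leqslant,\otimes,\mathbf{1})$ is a completely distributive complete lattice with a commutative monoid structure $(\otimes,\mathbf 1)$, $\otimes$ preserving arbitrary suprema in each variable, $\mathbf 1$ the greatest element, $\bot\neq\mathbf 1$; $Q(a,b)=\bigvee\{c\mid a\otimes c\leqslant b\}$. $\mathbb U=(U,e,m)$ is the ultrafilter monad on sets: $UX$ is the set of ultrafilters on $X$, $Uf(\sigma)=\{B\mid f^{-1}[B]\in\sigma\}$, $e_X(x)=\dot x$ the principal ultrafilter, $m_X(\Upsilon)=\{A\subseteq X\mid\{\sigma\in UX\mid A\in\sigma\}\in\Upsilon\}$. Let $\xi\colon UQ\to Q$, $\xi(\sigma)=\bigwedge_{A\in\sigma}\bigvee A$ (convergence of the Lawson topology). Standing assumptions: $\xi(U(\otimes)(\omega))=\xi(U\pi_1(\omega))\otimes\xi(U\pi_2(\omega))$ for $\omega\in U(Q\times Q)$ and $\xi(\dot{\mathbf 1})=\mathbf 1$; and whenever $f\colon X\to Y$, $\varphi\colon X\to Q$, $\psi\colon Y\to Q$ satisfy $\psi(y)\leqslant\bigvee_{f x=y}\varphi(x)$ for all $y$, then $\xi(U\psi(\sigma))\leqslant\bigvee_{Uf(\nu)=\sigma}\xi(U\varphi(\nu))$ for all $\sigma\in UY$. Relations. A $\mathcal Q$-relation from $X$ to $Y$ is a map $r\colon X\times Y\to Q$; $(s\cdot r)(x,z)=\bigvee_y r(x,y)\otimes s(y,z)$; $r^{op}$ is the transpose; functions are regarded as $\mathcal Q$-relations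 with values $\mathbf 1,\bot$; order is pointwise. $U$ is extended by $Ur(\sigma,\nu)=\bigwedge_{A\in\sigma,B\in\nu}\bigvee_{x\in A,y\in B}r(x,y)$. A $(\mathbb U,\mathcal Q)$-relation from $X$ to $Y$ is a $\mathcal Q$-relation $\alpha$ from $UX$ to $Y$; Kleisli convolution of $\alpha$ (from $X$ to $Y$) and $\beta$ (from $Y$ to $Z$) is $\beta\circ\alpha=\beta\cdot U\alpha\cdot m_X^{op}$. For $\alpha$ from $X$ to $Y$ and $\gamma$ from $X$ to $Z$, $\gamma\mathbin{\circ\!-}\alpha$ is the $(\mathbb U,\mathcal Q)$-relation from $Y$ to $Z$ given by $(\gamma\mathbin{\circ\!-}\alpha)(\upsilon,z)=\bigwedge_{\nu\in UX}Q((U\alpha\cdot m_X^{op})(\nu,\upsilon),\gamma(\nu,z))$. Categories. A $(\mathbb U,\mathcal Q)$-category is a set $X$ with a $(\mathbb U,\mathcal Q)$-relation $X(-,-)$ from $X$ to $X$ (also denoted $X$) with $\mathbf 1\leqslant X(\dot x,x)$ and $UX(\Upsilon,\upsilon)\otimes X(\upsilon,x)\leqslant X(m_X(\Upsilon),x)$. A $(\mathbb U,\mathcal Q)$-functor is a map $f\colon X\to Y$ with $X(\upsilon,x)\leqslant Y(Uf(\upsilon),f(x))$. Functors are ordered: $f\leqslant g$ iff $\mathbf 1\leqslant Y(e_Y(f x),g x)$ for all $x$; $f\cong g$ means both inequalities; adjunctions are taken in this ordered category, so $f\dashv g$ iff $Y(Uf(\sigma),y)=X(\sigma,g(y))$ for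 all $\sigma\in UX$, $y\in Y$. $Q$ is a $(\mathbb U,\mathcal Q)$-category via $(\sigma,v)\mapsto Q(\xi(\sigma),v)$. $|X|$ is the $(\mathbb U,\mathcal Q)$-category $UX$ with structure $m_X$. $1$ is the one-point category $(1,e_1^{op})$. Distributors. A $(\mathbb U,\mathcal Q)$-distributor from $X$ to $Y$ is a $(\mathbb U,\mathcal Q)$-relation $\varphi$ with $\varphi\circ X=\varphi$ and $Y\circ\varphi=\varphi$. A functor $f\colon X\to Y$ gives distributors $f_*(\sigma,y)=Y(Uf(\sigma),y)$ (from $X$ to $Y$) and $f^*(\nu,x)=Y(\nu,f(x))$ (from $Y$ to $X$); in particular for $x\in X$, viewed as $1\to X$, $x_*(\dot *,y)=X(\dot x,y)$ and $x^*=X(-,x)$. $\mathcal Q^{|X|}$ is the set of $(\mathbb U,\mathcal Q)$-functors $|X|\to Q$ with structure $\mathcal Q^{|X|}(\rho,\psi)=\bigwedge\{Q(\xi(U\mathrm{ev}(\varrho)),\psi(m_X(U\pi_1(\varrho))))\mid\varrho\in U(UX\times\mathcal Q^{|X|}),\,U\pi_2(\varrho)=\rho\}$, where $\mathrm{ev}(\nu,\psi)=\psi(\nu)$. $\widehat X\subseteq\mathcal Q^{|X|}$ is the full subcategory of those $\psi$ that are distributors from $X$ to $1$. Each distributor $\varphi$ from $X$ to $Y$ yields a functor $\ulcorner\varphi\urcorner\colon Y\to\widehat X$, $y\mapsto\varphi(-,y)$; the Yoneda functor is $\mathsf y=\ulcorner X\urcorner\colon X\to\widehat X$, $x\mapsto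 X(-,x)$. The class $J$. $J$ is a class of $(\mathbb U,\mathcal Q)$-distributors closed under Kleisli convolution, containing $f^*$ for every functor $f$, and such that a distributor $\varphi$ from $X$ to $Y$ is in $J$ whenever $y^*\circ\varphi\in J$ for all $y\in Y$ (note $y^*\circ\varphi=\varphi(-,y)$). $JX$ is the full subcategory of $\widehat X$ on the distributors from $X$ to $1$ in $J$; $\mathsf y$ corestricts to $\mathsf y\colon X\to JX$, and $\mathsf y_*(\nu,\psi)=\psi(\nu)$. $X$ is $J$-cocomplete if $\mathsf y\colon X\to JX$ has a left adjoint $\mathcal S\colon JX\to X$, i.e. a functor with $X(U\mathcal S(\Upsilon),x)=\widehat X(\Upsilon,\mathsf y(x))$ for all $\Upsilon\in U(JX)$, $x\in X$. In a $(\mathbb U,\mathcal Q)$-category $X$, a supremum of $\psi\in JX$ is an $x\in X$ with $x_*=X\mathbin{\circ\!-}\psi$ (if $X$ is $J$-cocomplete, $\mathcal S(\psi)$ is one). Further notions. The way-below distributor $\Downarrow$ from $X$ to $X$, if it exists, is the lifting of $\mathsf y_*$ along $\mathcal S^*$: a distributor such that for every distributor $\gamma$ from $X$ to $X$, $\mathcal S^*\circ\gamma\leqslant\mathsf y_*$ iff $\gamma\leqslant\Downarrow$. A distributor $v$ from $X$ to $X$ is approximating if $v\in J$ and $X\mathbin{\circ\!-}v=X$; it is approximating at $x\in X$ if $v\in J$ and $X\mathbin{\circ\!-}v_x=x_*$, where $v_x=x^*\circ v$; it is $J$-cocontinuous if $\mathcal S^*\circ v=\mathsf y_*\circ v$.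 A $(\mathbb U,\mathcal Q)$-functor $f\colon X\to Y$ is $J$-cocontinuous if, for every $\varphi\in JX$ such that suprema of $\varphi$ and of $\varphi\circ f^*\in JY$ exist, $f$ sends a supremum of $\varphi$ to a supremum of $\varphi\circ f^*$. *)

theory Defs
  imports Complex_Main "HOL-Library.FuncSet"
begin

section \<open>Quantales\<close>

text \<open>The tensor product of the quantale is written \<open>*\<close> and its unit \<open>1\<close>. The library class
  \<^class>\<open>complete_distrib_lattice\<close> is complete distributivity in the strong sense
  (distributivity of arbitrary infima over arbitrary suprema).\<close>

class quantale = complete_distrib_lattice + comm_monoid_mult +
  assumes mult_Sup_distrib: "a * Sup B = (SUP b\<in>B. a * b)"
    and one_eq_top: "1 = top"
    and bot_neq_one: "bot \<noteq> 1"

definition qhom :: "'q::quantale \<Rightarrow> 'q \<Rightarrow> 'q" where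
  "qhom a b = Sup {c. a * c \<le> b}"


section \<open>The ultrafilter monad\<close>

text \<open>Ultrafilters on a set \<open>A\<close> are represented by the ultrafilters on the ambient type that
  contain \<open>A\<close>. With this encoding \<open>U f\<close> is \<^const>\<open>filtermap\<close> \<open>f\<close>, the principal ultrafilter
  of \<open>x\<close> is \<^term>\<open>principal {x}\<close>, and \<open>U\<close> of the inclusion of a subset is the identity.\<close>

definition ultrafilter :: "'a filter \<Rightarrow> bool" where
  "ultrafilter F \<longleftrightarrow> F \<noteq> bot \<and> (\<forall>P. eventually P F \<or> eventually (\<lambda>x. \<not> P x) F)"

definition UU :: "'a set \<Rightarrow> 'a filter set" where
  "UU A = {F. ultrafilter F \<and> F \<le> principal A}"

definition sets_of :: "'a filter \<Rightarrow> 'a set set" where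
  "sets_of F = {A. eventually (\<lambda>x. x \<in> A) F}"

definition umult :: "'a filter filter \<Rightarrow> 'a filter" where
  "umult \<Upsilon> = Abs_filter (\<lambda>P. eventually (\<lambda>\<sigma>. eventually P \<sigma>) \<Upsilon>)"

lemma eventually_umult: "eventually P (umult \<Upsilon>) \<longleftrightarrow> eventually (\<lambda>\<sigma>. eventually P \<sigma>) \<Upsilon>"
  unfolding umult_def
proof (rule eventually_Abs_filter, rule is_filter.intro)
  fix P Q :: "'a \<Rightarrow> bool"
  assume "eventually (\<lambda>\<sigma>. eventually P \<sigma>) \<Upsilon>" "eventually (\<lambda>\<sigma>. eventually Q \<sigma>) \<Upsilon>"
  then show "eventually (\<lambda>\<sigma>. eventually (\<lambda>x. P x \<and> Q x) \<sigma>) \<Upsilon>"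
    by eventually_elim (rule eventually_conj)
next
  fix P Q :: "'a \<Rightarrow> bool"
  assume "\<forall>x. P x \<longrightarrow> Q x" and P: "eventually (\<lambda>\<sigma>. eventually P \<sigma>) \<Upsilon>"
  with P show "eventually (\<lambda>\<sigma>. eventually Q \<sigma>) \<Upsilon>"
    by (auto elim!: eventually_mono)
qed (rule always_eventually, simp)

definition xi :: "'q::complete_lattice filter \<Rightarrow> 'q" where
  "xi \<sigma> = (INF A\<in>sets_of \<sigma>. Sup A)"


section \<open>Quantale-valued relations\<close>

text \<open>Sets are carriers inside a type; only the values of a relation on its carriers matter, so
  equality and order of relations from \<open>A\<close> to \<open>B\<close> are \<open>rel_eq A B\<close> and \<open>rel_le A B\<close>.\<close>

definition rel_eq :: "'a set \<Rightarrow> 'b set \<Rightarrow> ('a \<Rightarrow> 'b \<Rightarrow> 'q) \<Rightarrow> ('a \<Rightarrow> 'b \<Rightarrow> 'q) \<Rightarrow> bool" where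
  "rel_eq A B r s \<longleftrightarrow> (\<forall>x\<in>A. \<forall>y\<in>B. r x y = s x y)"

definition rel_le :: "'a set \<Rightarrow> 'b set \<Rightarrow> ('a \<Rightarrow> 'b \<Rightarrow> 'q::order) \<Rightarrow> ('a \<Rightarrow> 'b \<Rightarrow> 'q) \<Rightarrow> bool" where
  "rel_le A B r s \<longleftrightarrow> (\<forall>x\<in>A. \<forall>y\<in>B. r x y \<le> s x y)"

text \<open>\<open>rcomp B s r\<close> is the composite \<open>s \<cdot> r\<close> through the middle set \<open>B\<close>.\<close>

definition rcomp :: "'b set \<Rightarrow> ('b \<Rightarrow> 'c \<Rightarrow> 'q) \<Rightarrow> ('a \<Rightarrow> 'b \<Rightarrow> 'q) \<Rightarrow> 'a \<Rightarrow> 'c \<Rightarrow> 'q::quantale" where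
  "rcomp B s r = (\<lambda>x z. SUP y\<in>B. r x y * s y z)"

definition transp :: "('a \<Rightarrow> 'b \<Rightarrow> 'q) \<Rightarrow> 'b \<Rightarrow> 'a \<Rightarrow> 'q" where
  "transp r = (\<lambda>y x. r x y)"

definition graph :: "('a \<Rightarrow> 'b) \<Rightarrow> 'a \<Rightarrow> 'b \<Rightarrow> 'q::quantale" where
  "graph f = (\<lambda>x y. if f x = y then 1 else bot)"

definition Uext :: "('a \<Rightarrow> 'b \<Rightarrow> 'q) \<Rightarrow> 'a filter \<Rightarrow> 'b filter \<Rightarrow> 'q::quantale" where
  "Uext r = (\<lambda>\<sigma> \<nu>. INF A\<in>sets_of \<sigma>. INF B\<in>sets_of \<nu>. SUP x\<in>A. SUP y\<in>B. r x y)"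

text \<open>\<open>Umop A \<alpha>\<close> is \<open>U \<alpha> \<cdot> m\<^sup>o\<^sup>p\<close> for a \<open>(U,Q)\<close>-relation \<open>\<alpha>\<close> with source \<open>A\<close>; \<open>kleisli A B \<beta> \<alpha>\<close> is the
  Kleisli convolution of \<open>\<alpha>\<close> from \<open>A\<close> to \<open>B\<close> with \<open>\<beta>\<close> from \<open>B\<close>; \<open>kext A \<gamma> \<alpha>\<close> is the extension of
  \<open>\<gamma>\<close> along \<open>\<alpha>\<close>, both with source \<open>A\<close>.\<close>

definition Umop :: "'a set \<Rightarrow> ('a filter \<Rightarrow> 'b \<Rightarrow> 'q) \<Rightarrow> 'a filter \<Rightarrow> 'b filter \<Rightarrow> 'q::quantale" where
  "Umop A \<alpha> = rcomp (UU (UU A)) (Uext \<alpha>) (transp (graph umult))"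

definition kleisli :: "'a set \<Rightarrow> 'b set \<Rightarrow> ('b filter \<Rightarrow> 'c \<Rightarrow> 'q) \<Rightarrow> ('a filter \<Rightarrow> 'b \<Rightarrow> 'q)
    \<Rightarrow> 'a filter \<Rightarrow> 'c \<Rightarrow> 'q::quantale" where
  "kleisli A B \<beta> \<alpha> = rcomp (UU B) \<beta> (Umop A \<alpha>)"

definition kext :: "'a set \<Rightarrow> ('a filter \<Rightarrow> 'c \<Rightarrow> 'q) \<Rightarrow> ('a filter \<Rightarrow> 'b \<Rightarrow> 'q)
    \<Rightarrow> 'b filter \<Rightarrow> 'c \<Rightarrow> 'q::quantale" where
  "kext A \<gamma> \<alpha> = (\<lambda>\<upsilon> z. INF \<nu>\<in>UU A. qhom (Umop A \<alpha> \<nu> \<upsilon>) (\<gamma> \<nu> z))"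


section \<open>Categories and functors\<close>

record ('a, 'q) ucat =
  Obj :: "'a set"
  Hom :: "'a filter \<Rightarrow> 'a \<Rightarrow> 'q"

definition uq_category :: "('a, 'q::quantale) ucat \<Rightarrow> bool" where
  "uq_category X \<longleftrightarrow>
     (\<forall>x\<in>Obj X. 1 \<le> Hom X (principal {x}) x) \<and>
     (\<forall>\<Upsilon>\<in>UU (UU (Obj X)). \<forall>\<upsilon>\<in>UU (Obj X). \<forall>x\<in>Obj X.
        Uext (Hom X) \<Upsilon> \<upsilon> * Hom X \<upsilon> x \<le> Hom X (umult \<Upsilon>) x)"

definition uq_functor :: "('a, 'q::quantale) ucat \<Rightarrow> ('a \<Rightarrow> 'b) \<Rightarrow> ('b, 'q) ucat \<Rightarrow> bool" where
  "uq_functor X f Y \<longleftrightarrow> f ` Obj X \<subseteq> Obj Y \<and>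
     (\<forall>\<upsilon>\<in>UU (Obj X). \<forall>x\<in>Obj X. Hom X \<upsilon> x \<le> Hom Y (filtermap f \<upsilon>) (f x))"

definition functor_le :: "('a, 'q::quantale) ucat \<Rightarrow> ('b, 'q) ucat \<Rightarrow> ('a \<Rightarrow> 'b) \<Rightarrow> ('a \<Rightarrow> 'b) \<Rightarrow> bool" where
  "functor_le X Y f g \<longleftrightarrow> (\<forall>x\<in>Obj X. 1 \<le> Hom Y (principal {f x}) (g x))"

text \<open>\<open>adjoint X f Y g\<close>: the functor \<open>f\<close> from \<open>X\<close> to \<open>Y\<close> is left adjoint to \<open>g\<close> in the ordered
  category of \<open>(U,Q)\<close>-categories.\<close>

definition adjoint :: "('a, 'q::quantale) ucat \<Rightarrow> ('a \<Rightarrow> 'b) \<Rightarrow> ('b, 'q) ucat \<Rightarrow> ('b \<Rightarrow> 'a) \<Rightarrow> bool" where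
  "adjoint X f Y g \<longleftrightarrow> uq_functor X f Y \<and> uq_functor Y g X \<and>
     functor_le X X (\<lambda>x. x) (g \<circ> f) \<and> functor_le Y Y (f \<circ> g) (\<lambda>y. y)"

definition Q_cat :: "('q, 'q::quantale) ucat" where
  "Q_cat = \<lparr>Obj = UNIV, Hom = (\<lambda>\<sigma> v. qhom (xi \<sigma>) v)\<rparr>"

definition disc_cat :: "('a, 'q::quantale) ucat \<Rightarrow> ('a filter, 'q) ucat" where
  "disc_cat X = \<lparr>Obj = UU (Obj X), Hom = graph umult\<rparr>"

definition one_cat :: "(unit, 'q::quantale) ucat" where
  "one_cat = \<lparr>Obj = UNIV, Hom = transp (graph (\<lambda>x. principal {x}))\<rparr>"

definition full_sub :: "('a, 'q) ucat \<Rightarrow> ('a \<Rightarrow> bool) \<Rightarrow> ('a, 'q) ucat" where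
  "full_sub X P = X\<lparr>Obj := {x \<in> Obj X. P x}\<rparr>"


section \<open>Distributors and presheaves\<close>

definition distributor :: "('a, 'q::quantale) ucat \<Rightarrow> ('a filter \<Rightarrow> 'b \<Rightarrow> 'q) \<Rightarrow> ('b, 'q) ucat \<Rightarrow> bool" where
  "distributor X \<phi> Y \<longleftrightarrow>
     rel_eq (UU (Obj X)) (Obj Y) (kleisli (Obj X) (Obj X) \<phi> (Hom X)) \<phi> \<and>
     rel_eq (UU (Obj X)) (Obj Y) (kleisli (Obj X) (Obj Y) (Hom Y) \<phi>) \<phi>"

text \<open>For a functor \<open>f\<close> from \<open>X\<close> to \<open>Y\<close>, \<open>lower_star Y f\<close> and \<open>upper_star Y f\<close> are the
  distributors \<open>f\<^sub>*\<close> and \<open>f\<^sup>*\<close>. A point \<open>x\<close> is viewed as the map \<open>\<lambda>_::unit. x\<close>.\<close>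

definition lower_star :: "('b, 'q) ucat \<Rightarrow> ('a \<Rightarrow> 'b) \<Rightarrow> 'a filter \<Rightarrow> 'b \<Rightarrow> 'q" where
  "lower_star Y f = (\<lambda>\<sigma> y. Hom Y (filtermap f \<sigma>) y)"

definition upper_star :: "('b, 'q) ucat \<Rightarrow> ('a \<Rightarrow> 'b) \<Rightarrow> 'b filter \<Rightarrow> 'a \<Rightarrow> 'q" where
  "upper_star Y f = (\<lambda>\<nu> x. Hom Y \<nu> (f x))"

text \<open>Maps \<open>U X \<rightarrow> Q\<close> are taken extensional, so that they are determined by their values on \<open>U X\<close>.\<close>

definition exp_cat :: "('a, 'q::quantale) ucat \<Rightarrow> ('a filter \<Rightarrow> 'q, 'q) ucat" where
  "exp_cat X = (let P = {\<psi> \<in> UU (Obj X) \<rightarrow>\<^sub>E UNIV. uq_functor (disc_cat X) \<psi> Q_cat} in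
     \<lparr>Obj = P,
      Hom = (\<lambda>\<rho> \<psi>. INF \<omega>\<in>{\<omega> \<in> UU (UU (Obj X) \<times> P). filtermap snd \<omega> = \<rho>}.
        qhom (xi (filtermap (\<lambda>(\<nu>, \<chi>). \<chi> \<nu>) \<omega>)) (\<psi> (umult (filtermap fst \<omega>))))\<rparr>)"

definition to_one :: "('a filter \<Rightarrow> 'q) \<Rightarrow> 'a filter \<Rightarrow> unit \<Rightarrow> 'q" where
  "to_one \<psi> = (\<lambda>\<sigma> _. \<psi> \<sigma>)"

definition hat :: "('a, 'q::quantale) ucat \<Rightarrow> ('a filter \<Rightarrow> 'q, 'q) ucat" where
  "hat X = full_sub (exp_cat X) (\<lambda>\<psi>. distributor X (to_one \<psi>) one_cat)"

definition transpose_dist :: "('a, 'q) ucat \<Rightarrow> ('a filter \<Rightarrow> 'b \<Rightarrow> 'q) \<Rightarrow> 'b \<Rightarrow> 'a filter \<Rightarrow> 'q" where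
  "transpose_dist X \<phi> = (\<lambda>y. restrict (\<lambda>\<sigma>. \<phi> \<sigma> y) (UU (Obj X)))"

definition yoneda :: "('a, 'q) ucat \<Rightarrow> 'a \<Rightarrow> 'a filter \<Rightarrow> 'q" where
  "yoneda X = transpose_dist X (Hom X)"

text \<open>\<open>is_lifting X Y Z \<alpha> \<beta> l\<close>: the distributor \<open>l\<close> from \<open>X\<close> to \<open>Y\<close> is the lifting of
  \<open>\<alpha>\<close> (from \<open>X\<close> to \<open>Z\<close>) along \<open>\<beta>\<close> (from \<open>Y\<close> to \<open>Z\<close>).\<close>

definition is_lifting :: "('a, 'q::quantale) ucat \<Rightarrow> ('b, 'q) ucat \<Rightarrow> ('c, 'q) ucat \<Rightarrow>
    ('a filter \<Rightarrow> 'c \<Rightarrow> 'q) \<Rightarrow> ('b filter \<Rightarrow> 'c \<Rightarrow> 'q) \<Rightarrow> ('a filter \<Rightarrow> 'b \<Rightarrow> 'q) \<Rightarrow> bool" where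
  "is_lifting X Y Z \<alpha> \<beta> l \<longleftrightarrow> distributor X l Y \<and>
     (\<forall>\<gamma>. distributor X \<gamma> Y \<longrightarrow>
        (rel_le (UU (Obj X)) (Obj Z) (kleisli (Obj X) (Obj Y) \<beta> \<gamma>) \<alpha> \<longleftrightarrow>
         rel_le (UU (Obj X)) (Obj Y) \<gamma> l))"


section \<open>Classes of distributors\<close>

text \<open>A class \<open>J\<close> of distributors is a predicate on the distributors between categories carried by
  subsets of one type \<open>'u\<close>, which plays the role of the universe of sets. A distributor between
  categories carried by other types belongs to \<open>J\<close> if a copy of it along injections of the
  carriers into \<open>'u\<close> does; for \<open>J\<close> as below, which contains \<open>f\<^sup>*\<close> for every isomorphism \<open>f\<close> and is
  closed under convolution, the choice of the injections does not matter.\<close>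

type_synonym ('u, 'q) dist_class =
  "('u, 'q) ucat \<Rightarrow> ('u filter \<Rightarrow> 'u \<Rightarrow> 'q) \<Rightarrow> ('u, 'q) ucat \<Rightarrow> bool"

definition copy_rel :: "('a \<Rightarrow> 'u) \<Rightarrow> 'a set \<Rightarrow> ('b \<Rightarrow> 'w) \<Rightarrow> 'b set \<Rightarrow> ('a filter \<Rightarrow> 'b \<Rightarrow> 'q) \<Rightarrow>
    'u filter \<Rightarrow> 'w \<Rightarrow> 'q" where
  "copy_rel i A j B r = (\<lambda>\<sigma> y. r (filtermap (inv_into A i) \<sigma>) (inv_into B j y))"

definition copy_cat :: "('a \<Rightarrow> 'u) \<Rightarrow> ('a, 'q) ucat \<Rightarrow> ('u, 'q) ucat" where
  "copy_cat i X = \<lparr>Obj = i ` Obj X, Hom = copy_rel i (Obj X) i (Obj X) (Hom X)\<rparr>"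

definition in_class :: "('u, 'q) dist_class \<Rightarrow>
    ('a, 'q) ucat \<Rightarrow> ('a filter \<Rightarrow> 'b \<Rightarrow> 'q) \<Rightarrow> ('b, 'q) ucat \<Rightarrow> bool" where
  "in_class J X \<phi> Y \<longleftrightarrow> (\<exists>i j. inj_on i (Obj X) \<and> inj_on j (Obj Y) \<and>
     J (copy_cat i X) (copy_rel i (Obj X) j (Obj Y) \<phi>) (copy_cat j Y))"

text \<open>The second clause says that membership in \<open>J\<close> does not depend on the irrelevant values of a
  relation outside its carriers.\<close>

definition distributor_class :: "('u, 'q::quantale) dist_class \<Rightarrow> bool" where
  "distributor_class J \<longleftrightarrow>
     (\<forall>X \<phi> Y. J X \<phi> Y \<longrightarrow> uq_category X \<and> uq_category Y \<and> distributor X \<phi> Y) \<and>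
     (\<forall>X \<phi> \<phi>' Y. J X \<phi> Y \<longrightarrow> rel_eq (UU (Obj X)) (Obj Y) \<phi> \<phi>' \<longrightarrow> J X \<phi>' Y) \<and>
     (\<forall>X Y Z \<phi> \<psi>. J X \<phi> Y \<longrightarrow> J Y \<psi> Z \<longrightarrow> J X (kleisli (Obj X) (Obj Y) \<psi> \<phi>) Z) \<and>
     (\<forall>X Y f. uq_category X \<longrightarrow> uq_category Y \<longrightarrow> uq_functor X f Y \<longrightarrow> J Y (upper_star Y f) X) \<and>
     (\<forall>X Y \<phi>. uq_category X \<longrightarrow> uq_category Y \<longrightarrow> distributor X \<phi> Y \<longrightarrow>
        (\<forall>y\<in>Obj Y. in_class J X
            (kleisli (Obj X) (Obj Y) (upper_star Y (\<lambda>_::unit. y)) \<phi>) one_cat) \<longrightarrow>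
        J X \<phi> Y)"

definition J_cat :: "('u, 'q::quantale) dist_class \<Rightarrow> ('a, 'q) ucat \<Rightarrow> ('a filter \<Rightarrow> 'q, 'q) ucat" where
  "J_cat J X = full_sub (hat X) (\<lambda>\<psi>. in_class J X (to_one \<psi>) one_cat)"

definition J_cocomplete :: "('u, 'q::quantale) dist_class \<Rightarrow> ('a, 'q) ucat \<Rightarrow> bool" where
  "J_cocomplete J X \<longleftrightarrow> (\<exists>S. adjoint (J_cat J X) S X (yoneda X))"

definition is_supremum :: "('a, 'q::quantale) ucat \<Rightarrow> ('a filter \<Rightarrow> 'q) \<Rightarrow> 'a \<Rightarrow> bool" where
  "is_supremum X \<psi> x \<longleftrightarrow> x \<in> Obj X \<and>
     rel_eq (UU UNIV) (Obj X) (lower_star X (\<lambda>_::unit. x)) (kext (Obj X) (Hom X) (to_one \<psi>))"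

text \<open>\<open>push X f Y \<psi>\<close> is \<open>\<psi> \<circ> f\<^sup>*\<close> as a map on \<open>U Y\<close>.\<close>

definition push :: "('a, 'q::quantale) ucat \<Rightarrow> ('a \<Rightarrow> 'b) \<Rightarrow> ('b, 'q) ucat \<Rightarrow> ('a filter \<Rightarrow> 'q) \<Rightarrow>
    'b filter \<Rightarrow> 'q" where
  "push X f Y \<psi> = transpose_dist Y (kleisli (Obj Y) (Obj X) (to_one \<psi>) (upper_star Y f)) ()"

definition J_cocontinuous_functor :: "('u, 'q::quantale) dist_class \<Rightarrow>
    ('a, 'q) ucat \<Rightarrow> ('a \<Rightarrow> 'b) \<Rightarrow> ('b, 'q) ucat \<Rightarrow> bool" where
  "J_cocontinuous_functor J X f Y \<longleftrightarrow> uq_functor X f Y \<and>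
     (\<forall>\<psi>\<in>Obj (J_cat J X).
        push X f Y \<psi> \<in> Obj (J_cat J Y) \<and> (\<exists>x. is_supremum X \<psi> x) \<and>
        (\<exists>y. is_supremum Y (push X f Y \<psi>) y) \<longrightarrow>
        (\<forall>x. is_supremum X \<psi> x \<longrightarrow> is_supremum Y (push X f Y \<psi>) (f x)))"

definition approximating :: "('u, 'q::quantale) dist_class \<Rightarrow> ('a, 'q) ucat \<Rightarrow>
    ('a filter \<Rightarrow> 'a \<Rightarrow> 'q) \<Rightarrow> bool" where
  "approximating J X v \<longleftrightarrow> distributor X v X \<and> in_class J X v X \<and>
     rel_eq (UU (Obj X)) (Obj X) (kext (Obj X) (Hom X) v) (Hom X)"

definition approximating_at :: "('u, 'q::quantale) dist_class \<Rightarrow> ('a, 'q) ucat \<Rightarrow>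
    ('a filter \<Rightarrow> 'a \<Rightarrow> 'q) \<Rightarrow> 'a \<Rightarrow> bool" where
  "approximating_at J X v x \<longleftrightarrow> distributor X v X \<and> in_class J X v X \<and>
     rel_eq (UU UNIV) (Obj X)
       (kext (Obj X) (Hom X) (kleisli (Obj X) (Obj X) (upper_star X (\<lambda>_::unit. x)) v))
       (lower_star X (\<lambda>_::unit. x))"

text \<open>In the following two definitions \<open>S\<close> is a left adjoint of the Yoneda functor into \<open>J_cat J X\<close>.\<close>

definition is_way_below :: "('u, 'q::quantale) dist_class \<Rightarrow> ('a, 'q) ucat \<Rightarrow>
    (('a filter \<Rightarrow> 'q) \<Rightarrow> 'a) \<Rightarrow> ('a filter \<Rightarrow> 'a \<Rightarrow> 'q) \<Rightarrow> bool" where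
  "is_way_below J X S v \<longleftrightarrow>
     is_lifting X X (J_cat J X) (lower_star (J_cat J X) (yoneda X)) (upper_star X S) v"

definition J_cocontinuous_dist :: "('u, 'q::quantale) dist_class \<Rightarrow> ('a, 'q) ucat \<Rightarrow>
    (('a filter \<Rightarrow> 'q) \<Rightarrow> 'a) \<Rightarrow> ('a filter \<Rightarrow> 'a \<Rightarrow> 'q) \<Rightarrow> bool" where
  "J_cocontinuous_dist J X S v \<longleftrightarrow>
     rel_eq (UU (Obj X)) (Obj (J_cat J X))
       (kleisli (Obj X) (Obj X) (upper_star X S) v)
       (kleisli (Obj X) (Obj X) (lower_star (J_cat J X) (yoneda X)) v)"

end

theory Submission
  imports Defs
begin

text \<open>
  Complete distributivity lets every relation be approximated from below by two-valued ones, so that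
  the lifting \<open>U\<close> and the naturality of \<open>m\<^sup>o\<^sup>p\<close> can be handled with ultrafilters alone; multiplicativity
  of \<open>\<xi>\<close> is needed only for \<open>U (s \<cdot> r) \<le> U s \<cdot> U r\<close>. Hence Kleisli convolution is associative and
  \<open>\<gamma> \<circ>- (\<beta> \<circ> \<alpha>) = (\<gamma> \<circ>- \<alpha>) \<circ>- \<beta>\<close>.

  Write \<open>T\<close> for the transpose of \<open>v\<close>. Then \<open>T\<^sub>* = y\<^sub>* \<circ>- v\<close> and \<open>T\<^sup>* \<circ> y\<^sub>* = v\<close>, so (i) and (vi) both
  say \<open>T\<^sub>* = S\<^sup>*\<close>. This gives \<open>X \<circ>- v = X\<close> by composing with \<open>y\<close>, and the lifting property of \<open>v\<close>.
  If \<open>v\<close> is approximating and the lifting, then \<open>v \<le> v \<circ> v\<close>, because \<open>v \<circ> v\<close> is again approximating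
  and hence \<open>x\<close> is a supremum of \<open>(v \<circ> v)(-, x)\<close>; this yields \<open>S\<^sup>* \<circ> v = y\<^sub>* \<circ> v\<close>, from which \<open>T\<^sub>* = S\<^sup>*\<close>
  follows again. The pointwise versions are equivalent because \<open>X (U (S T) \<sigma>, -) = (X \<circ>- v) (\<sigma>, -)\<close>, and
  cocontinuity of \<open>T\<close> is that of \<open>v\<close> because \<open>\<psi> \<circ> v\<close> is the supremum of \<open>\<psi> \<circ> T\<^sup>*\<close>.
\<close>

section \<open>Quantales\<close>

text \<open>The calculus runs on the adjunction between convolution and \<open>kext\<close>, so
  every structure has to be brought into the shape of a \<open>kext\<close>. The obstacle is the
  structure on presheaves, which is an infimum over ultrafilters on a product and is written with
  \<open>xi\<close> instead of \<open>Uext\<close>. Reading such an ultrafilter as a coupling of its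
  two projections turns the structure into the extension of evaluation along itself, after which
  presheaves obey the same rules as any other relation. Two further points shape the statements.
  Relations count only on their carriers and suprema only up to equivalence of objects, hence the
  many congruence lemmas. And \<open>J\<close> sees only categories carried by subsets of
  \<open>'u\<close>: a distributor with source \<open>J_cat J X\<close> can lie in \<open>J\<close>
  only if those presheaves embed into \<open>'u\<close>. The injection in the theorem serves this
  purpose, for the weight \<open>\<psi> \<circ> T\<^sup>*\<close> in condition (v).\<close>

lemma quantale_mult_mono:
  fixes a b c d :: "'q::quantale"
  assumes "a \<le> b" "c \<le> d"
  shows "a * c \<le> b * d"
proof -
  have *: "x * y \<le> x * z" if "y \<le> z" for x y z :: 'q
  proof -
    have "x * z = x * Sup {y, z}" using that by (simp add: sup_absorb2)
    also have "\<dots> = (SUP b\<in>{y, z}. x * b)" by (rule mult_Sup_distrib)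
    finally show ?thesis by (simp add: le_iff_sup)
  qed
  have "a * c \<le> a * d" using assms(2) by (rule *)
  also have "\<dots> = d * a" by (rule mult.commute)
  also have "\<dots> \<le> d * b" using assms(1) by (rule *)
  finally show ?thesis by (simp add: mult.commute)
qed

lemma quantale_le_one: "(a::'q::quantale) \<le> 1"
  by (simp add: one_eq_top)

lemma mult_SUP_distrib: "(a::'q::quantale) * (SUP i\<in>I. f i) = (SUP i\<in>I. a * f i)"
  by (simp add: mult_Sup_distrib image_image)

lemma SUP_mult_distrib: "(SUP i\<in>I. f i) * (a::'q::quantale) = (SUP i\<in>I. f i * a)"
  using mult_SUP_distrib[of a f I] by (simp add: mult.commute)

lemma quantale_bot_mult [simp]: "bot * (a::'q::quantale) = bot"
  using SUP_mult_distrib[of "\<lambda>x. x" "{}" a] by simp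

lemma le_qhom_iff: "c \<le> qhom a b \<longleftrightarrow> a * c \<le> (b::'q::quantale)"
proof
  assume "c \<le> qhom a b"
  then have "a * c \<le> a * Sup {c. a * c \<le> b}"
    unfolding qhom_def by (intro quantale_mult_mono) auto
  also have "\<dots> = (SUP c\<in>{c. a * c \<le> b}. a * c)" by (rule mult_Sup_distrib)
  also have "\<dots> \<le> b" by (rule SUP_least) simp
  finally show "a * c \<le> b" .
qed (simp add: qhom_def Sup_upper)

lemma qhom_antimono: "a' \<le> a \<Longrightarrow> qhom a b \<le> qhom a' (b::'q::quantale)"
  by (meson le_qhom_iff order_refl order_trans quantale_mult_mono)

text \<open>Raney's totally-below relation; complete distributivity makes each element the join of
  those totally below it. Unlike \<open>\<le>\<close>, it lets a bound by a supremum be charged to a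
  single member, so suprema become existential statements.\<close>

definition totally_below :: "'q::complete_lattice \<Rightarrow> 'q \<Rightarrow> bool" where
  "totally_below u a \<longleftrightarrow> (\<forall>S. a \<le> Sup S \<longrightarrow> (\<exists>s\<in>S. u \<le> s))"

lemma totally_below_SUP: "totally_below u (SUP i\<in>I. f i) \<Longrightarrow> \<exists>i\<in>I. u \<le> f i"
  unfolding totally_below_def by blast

lemma totally_below_mono: "totally_below u a \<Longrightarrow> a \<le> b \<Longrightarrow> totally_below u b"
  unfolding totally_below_def by (meson order_trans)

lemma totally_below_mono': "totally_below u a \<Longrightarrow> w \<le> u \<Longrightarrow> totally_below w a"
  unfolding totally_below_def by (meson order_trans)

text \<open>Distributivity turns the infimum of all joins above \<open>a\<close> into a join over
  choice functions, one choice from each cover. The meet of the values of a choice function lies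
  under its choice in every cover, hence is totally below \<open>a\<close>.\<close>

lemma le_Sup_totally_below:
  fixes a :: "'q::complete_distrib_lattice"
  shows "a \<le> Sup {u. totally_below u a}"
proof -
  let ?C = "{S. a \<le> Sup S}"
  have "a \<le> Inf (Sup ` ?C)" by (rule INF_greatest) simp
  also have "\<dots> \<le> Sup (Inf ` {f ` ?C |f. \<forall>Y\<in>?C. f Y \<in> Y})" by (rule Inf_Sup_le)
  also have "\<dots> \<le> Sup {u. totally_below u a}"
  proof (rule SUP_least, rule Sup_upper)
    fix D assume "D \<in> {f ` ?C |f. \<forall>Y\<in>?C. f Y \<in> Y}"
    then obtain f where f: "\<forall>Y\<in>?C. f Y \<in> Y" and D: "D = f ` ?C" by blast
    show "Inf D \<in> {u. totally_below u a}"
      unfolding totally_below_def using f D by (blast intro: Inf_lower)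
  qed
  finally show ?thesis .
qed

lemma totally_below_leI:
  fixes a :: "'q::complete_distrib_lattice"
  assumes "\<And>u. totally_below u a \<Longrightarrow> u \<le> b"
  shows "a \<le> b"
  using le_Sup_totally_below[of a] assms by (meson Sup_least mem_Collect_eq order_trans)

text \<open>Approximating \<open>a\<close> twice in succession shows that the elements with an
  interpolant have a join above \<open>a\<close>; an element totally below \<open>a\<close> then
  lies under one of them.\<close>

lemma totally_below_interpolate:
  fixes a :: "'q::complete_distrib_lattice"
  assumes "totally_below u a"
  shows "\<exists>w. totally_below u w \<and> totally_below w a"
proof -
  have "a \<le> Sup {u. \<exists>w. totally_below u w \<and> totally_below w a}"
  proof (rule totally_below_leI)
    fix w assume w: "totally_below w a"
    show "w \<le> Sup {u. \<exists>w. totally_below u w \<and> totally_below w a}"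
    proof (rule totally_below_leI)
      fix u assume "totally_below u w"
      with w show "u \<le> Sup {u. \<exists>w. totally_below u w \<and> totally_below w a}"
        by (intro Sup_upper) blast
    qed
  qed
  with assms obtain u' where "\<exists>w. totally_below u' w \<and> totally_below w a" "u \<le> u'"
    unfolding totally_below_def by blast
  then show ?thesis using totally_below_mono' by blast
qed


section \<open>Ultrafilters\<close>

lemma filtermap_eventually_cong:
  assumes "eventually (\<lambda>x. f x = g x) F"
  shows "filtermap f F = filtermap g F"
  unfolding filter_eq_iff eventually_filtermap
  by (intro allI eventually_cong[OF assms]) simp

lemma eventually_choice:
  assumes "eventually (\<lambda>x. \<exists>y. R x y) F"
  shows "\<exists>g. eventually (\<lambda>x. R x (g x)) F"
  by (rule exI[of _ "\<lambda>x. SOME y. R x y"], rule eventually_mono[OF assms]) (rule someI_ex)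

lemma ultrafilter_not_bot: "ultrafilter F \<Longrightarrow> F \<noteq> bot"
  by (simp add: ultrafilter_def)

lemma ultrafilter_eventually_not:
  "ultrafilter F \<Longrightarrow> eventually (\<lambda>x. \<not> P x) F \<longleftrightarrow> \<not> eventually P F"
  unfolding ultrafilter_def using eventually_conj[of P F "\<lambda>x. \<not> P x"]
  by (auto simp: trivial_limit_def)

text \<open>Otherwise the complement of \<open>P\<close> would be a member of \<open>F\<close>. This
  promotes a set that merely meets all members to a member.\<close>

lemma ultrafilter_eventuallyI:
  assumes "ultrafilter F" "\<And>Q. eventually Q F \<Longrightarrow> \<exists>x. Q x \<and> P x"
  shows "eventually P F"
  using assms(2)[of "\<lambda>x. \<not> P x"] ultrafilter_eventually_not[OF assms(1), of P] by blast

lemma ultrafilter_le_eq: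
  assumes "ultrafilter G" "F \<le> G" "F \<noteq> bot"
  shows "F = G"
proof (rule antisym[OF assms(2)], rule filter_leI)
  fix P assume P: "eventually P F"
  show "eventually P G"
  proof (rule ultrafilter_eventuallyI[OF assms(1)])
    fix Q assume "eventually Q G"
    then have "eventually Q F" using assms(2) filter_leD by blast
    with P have "eventually (\<lambda>x. Q x \<and> P x) F" by (rule eventually_conj[rotated])
    then show "\<exists>x. Q x \<and> P x" using assms(3) eventually_happens' by blast
  qed
qed

text \<open>Finer filters are smaller, so Zorn is applied downwards: a minimal proper filter below
  \<open>F\<close> is sought, and a nonempty chain is bounded by its infimum.\<close>

lemma ultrafilter_exists:
  assumes "F \<noteq> bot"
  shows "\<exists>G. ultrafilter G \<and> G \<le> F"
proof -
  let ?A = "{G. G \<noteq> bot \<and> G \<le> F}"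
  have "\<exists>m\<in>?A. \<forall>a\<in>?A. m \<ge> a \<longrightarrow> a = m"
  proof (rule predicate_Zorn)
    show "partial_order_on ?A (relation_of (\<ge>) ?A)"
      by (rule partial_order_on_relation_ofI) auto
  next
    fix C assume "C \<in> Chains (relation_of (\<ge>) ?A)"
    then have C: "C \<subseteq> ?A" "\<And>a b. a \<in> C \<Longrightarrow> b \<in> C \<Longrightarrow> a \<le> b \<or> b \<le> a"
      unfolding Chains_def relation_of_def by auto
    show "\<exists>u\<in>?A. \<forall>a\<in>C. a \<ge> u"
    proof (cases "C = {}")
      case False
      \<comment> \<open>A chain is directed, so a set in the infimum already belongs to one filter
        of the chain, and the empty set belongs to none.\<close>
      have "Inf C \<noteq> bot"
      proof
        assume "Inf C = bot"
        then have "eventually (\<lambda>_. False) (Inf C)" by simp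
        moreover have "\<exists>x\<in>C. x \<le> inf a b" if "a \<in> C" "b \<in> C" for a b
          using C(2)[OF that] that by (metis inf.absorb1 inf.absorb2 order_refl)
        ultimately obtain b where "b \<in> C" "eventually (\<lambda>_. False) b"
          using False by (subst (asm) eventually_Inf_base) auto
        then show False using C(1) by (auto simp: trivial_limit_def)
      qed
      moreover have "Inf C \<le> F"
        using False C(1) Inf_lower by (metis (mono_tags, lifting) all_not_in_conv mem_Collect_eq order_trans subset_eq)
      ultimately show ?thesis by (auto intro: Inf_lower)
    qed (use assms in auto)
  qed
  then obtain m where m: "m \<noteq> bot" "m \<le> F" "\<And>a. a \<noteq> bot \<Longrightarrow> a \<le> m \<Longrightarrow> a = m"
    using order_trans by blast
  have "ultrafilter m" unfolding ultrafilter_def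
  proof (intro conjI allI m(1))
    fix P
    show "eventually P m \<or> eventually (\<lambda>x. \<not> P x) m"
    proof (cases "eventually (\<lambda>x. \<not> P x) m")
      case False
      then have "inf m (principal {x. P x}) \<noteq> bot"
        by (simp add: trivial_limit_def eventually_inf_principal)
      then have "inf m (principal {x. P x}) = m" using m(3) by simp
      then have "eventually P m"
        by (metis (mono_tags) eventually_inf_principal eventually_mono always_eventually mem_Collect_eq)
      then show ?thesis ..
    qed simp
  qed
  with m(2) show ?thesis by blast
qed

lemma ultrafilter_filtermap: "ultrafilter F \<Longrightarrow> ultrafilter (filtermap f F)"
  by (simp add: ultrafilter_def eventually_filtermap filtermap_bot_iff)

lemma UU_iff: "F \<in> UU A \<longleftrightarrow> ultrafilter F \<and> eventually (\<lambda>x. x \<in> A) F"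
  by (simp add: UU_def le_principal)

lemma UU_ultrafilter: "F \<in> UU A \<Longrightarrow> ultrafilter F"
  by (simp add: UU_iff)

lemma UU_eventually: "F \<in> UU A \<Longrightarrow> eventually (\<lambda>x. x \<in> A) F"
  by (simp add: UU_iff)

lemma UU_mono: "A \<subseteq> B \<Longrightarrow> UU A \<subseteq> UU B"
  unfolding UU_def using order_trans[OF _ iffD2[OF principal_le_iff]] by blast

lemma UU_filtermap:
  assumes "F \<in> UU A" "\<And>x. x \<in> A \<Longrightarrow> f x \<in> B"
  shows "filtermap f F \<in> UU B"
  using assms by (auto simp: UU_iff ultrafilter_filtermap eventually_filtermap elim: eventually_mono)

lemma UU_filtermap_cong:
  assumes "F \<in> UU A" "\<And>x. x \<in> A \<Longrightarrow> f x = g x"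
  shows "filtermap f F = filtermap g F"
  by (rule filtermap_eventually_cong[OF eventually_mono[OF UU_eventually[OF assms(1)]]]) (rule assms(2))

lemma filtermap_id_UU:
  assumes "F \<in> UU A" "\<And>x. x \<in> A \<Longrightarrow> f x = x"
  shows "filtermap f F = F"
  using UU_filtermap_cong[OF assms(1), of f "\<lambda>x. x"] assms(2) by (simp add: filtermap_ident)

lemma ultrafilter_principal: "ultrafilter (principal {x})"
  by (simp add: ultrafilter_def eventually_principal principal_eq_bot_iff)

lemma UU_principal: "x \<in> A \<Longrightarrow> principal {x} \<in> UU A"
  by (simp add: UU_iff eventually_principal ultrafilter_principal)

lemma UU_unit: "(UU UNIV :: unit filter set) = {principal {()}}"
proof -
  have "F = principal {()}" if "ultrafilter F" for F :: "unit filter"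
    using ultrafilter_le_eq[OF ultrafilter_principal, of F "()"] that
    by (simp add: le_principal ultrafilter_not_bot)
  then show ?thesis by (auto simp: UU_iff ultrafilter_principal eventually_principal)
qed

section \<open>The multiplication of the ultrafilter monad\<close>

lemma umult_UU:
  assumes "\<Xi> \<in> UU (UU A)"
  shows "umult \<Xi> \<in> UU A"
proof -
  have ev: "eventually (\<lambda>\<sigma>. \<sigma> \<in> UU A) \<Xi>" and u: "ultrafilter \<Xi>" using assms by (simp_all add: UU_iff)
  have "eventually (\<lambda>x. x \<in> A) (umult \<Xi>)"
    unfolding eventually_umult using ev by eventually_elim (rule UU_eventually)
  moreover have "umult \<Xi> \<noteq> bot"
  proof
    assume "umult \<Xi> = bot"
    then have "eventually (\<lambda>\<sigma>. eventually (\<lambda>_. False) \<sigma>) \<Xi>" by (metis eventually_bot eventually_umult)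
    with ev have "eventually (\<lambda>_. False) \<Xi>"
      by eventually_elim (use UU_ultrafilter ultrafilter_not_bot trivial_limit_def in blast)
    then show False using u ultrafilter_not_bot trivial_limit_def by blast
  qed
  moreover have "eventually P (umult \<Xi>) \<or> eventually (\<lambda>x. \<not> P x) (umult \<Xi>)" for P
  proof (cases "eventually (\<lambda>\<sigma>. eventually P \<sigma>) \<Xi>")
    case False
    then have "eventually (\<lambda>\<sigma>. \<not> eventually P \<sigma>) \<Xi>" using u ultrafilter_eventually_not by blast
    \<comment> \<open>Negation moves through \<open>eventually\<close> only for an ultrafilter
      \<sigma>, and \<Xi> concentrates on those.\<close>
    with ev have "eventually (\<lambda>\<sigma>. eventually (\<lambda>x. \<not> P x) \<sigma>) \<Xi>"
      by eventually_elim (use UU_ultrafilter ultrafilter_eventually_not in blast)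
    then show ?thesis by (simp add: eventually_umult)
  qed (simp add: eventually_umult)
  ultimately show ?thesis by (simp add: UU_iff ultrafilter_def)
qed

lemma umult_principal [simp]: "umult (principal {\<sigma>}) = \<sigma>"
  by (subst filter_eq_iff) (simp add: eventually_umult eventually_principal)

lemma umult_filtermap_principal [simp]: "umult (filtermap (\<lambda>x. principal {x}) \<sigma>) = \<sigma>"
  by (simp add: filter_eq_iff eventually_umult eventually_principal eventually_filtermap)

lemma umult_filtermap_filtermap: "umult (filtermap (filtermap f) \<Xi>) = filtermap f (umult \<Xi>)"
  by (simp add: filter_eq_iff eventually_umult eventually_filtermap)

lemma umult_filtermap_umult: "umult (filtermap umult \<Lambda>) = umult (umult \<Lambda>)"
  by (simp add: filter_eq_iff eventually_umult eventually_filtermap)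


section \<open>Lifting relations to ultrafilters\<close>

text \<open>The two-valued case of \<open>Uext\<close>. By \<open>urel_coupling\<close>, related
  ultrafilters are the two projections of an ultrafilter on pairs that contains
  \<open>R\<close>.\<close>

definition urel :: "('a \<Rightarrow> 'b \<Rightarrow> bool) \<Rightarrow> 'a filter \<Rightarrow> 'b filter \<Rightarrow> bool" where
  "urel R \<sigma> \<nu> \<longleftrightarrow> (\<forall>P Q. eventually P \<sigma> \<longrightarrow> eventually Q \<nu> \<longrightarrow> (\<exists>x y. P x \<and> Q y \<and> R x y))"

lemma urel_filtermap:
  assumes "\<omega> \<noteq> bot" "eventually (\<lambda>p. R (f p) (g p)) \<omega>"
  shows "urel R (filtermap f \<omega>) (filtermap g \<omega>)"
  unfolding urel_def eventually_filtermap
proof (intro allI impI)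
  fix P Q assume "eventually (\<lambda>x. P (f x)) \<omega>" "eventually (\<lambda>x. Q (g x)) \<omega>"
  with assms(2) have "eventually (\<lambda>p. P (f p) \<and> Q (g p) \<and> R (f p) (g p)) \<omega>"
    by eventually_elim simp
  then show "\<exists>x y. P x \<and> Q y \<and> R x y" using assms(1) eventually_happens' by blast
qed

text \<open>The relation meets every rectangle of the product filter, so it can be added without
  losing properness. The projections of an ultrafilter refining the result refine \<sigma> and
  \<nu>, and ultrafilters have no proper refinements.\<close>

lemma urel_coupling:
  assumes \<sigma>: "ultrafilter \<sigma>" and \<nu>: "ultrafilter \<nu>" and R: "urel R \<sigma> \<nu>"
  shows "\<exists>\<omega>. ultrafilter \<omega> \<and> filtermap fst \<omega> = \<sigma> \<and> filtermap snd \<omega> = \<nu> \<and>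
           eventually (\<lambda>p. R (fst p) (snd p)) \<omega>"
proof -
  let ?F = "inf (\<sigma> \<times>\<^sub>F \<nu>) (principal {p. R (fst p) (snd p)})"
  have "?F \<noteq> bot"
  proof
    assume "?F = bot"
    then have "eventually (\<lambda>p. \<not> R (fst p) (snd p)) (\<sigma> \<times>\<^sub>F \<nu>)"
      by (simp add: trivial_limit_def eventually_inf_principal)
    then obtain P Q where "eventually P \<sigma>" "eventually Q \<nu>" "\<forall>x y. P x \<longrightarrow> Q y \<longrightarrow> \<not> R x y"
      unfolding eventually_prod_filter by auto
    with R show False unfolding urel_def by blast
  qed
  then obtain \<omega> where \<omega>: "ultrafilter \<omega>" "\<omega> \<le> ?F" using ultrafilter_exists by blast
  have 1: "eventually (\<lambda>p. P (fst p)) \<omega>" if "eventually P \<sigma>" for P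
  proof -
    have "eventually (\<lambda>p. P (fst p)) (\<sigma> \<times>\<^sub>F \<nu>)"
      unfolding eventually_prod_filter using that by (intro exI[of _ P] exI[of _ "\<lambda>_. True"]) simp
    then show ?thesis using \<omega>(2) by (meson filter_leD le_inf_iff)
  qed
  have 2: "eventually (\<lambda>p. Q (snd p)) \<omega>" if "eventually Q \<nu>" for Q
  proof -
    have "eventually (\<lambda>p. Q (snd p)) (\<sigma> \<times>\<^sub>F \<nu>)"
      unfolding eventually_prod_filter using that by (intro exI[of _ "\<lambda>_. True"] exI[of _ Q]) simp
    then show ?thesis using \<omega>(2) by (meson filter_leD le_inf_iff)
  qed
  have "filtermap fst \<omega> = \<sigma>"
    by (rule ultrafilter_le_eq[OF \<sigma>])
      (auto intro!: filter_leI 1 simp: eventually_filtermap filtermap_bot_iff ultrafilter_not_bot[OF \<omega>(1)])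
  moreover have "filtermap snd \<omega> = \<nu>"
    by (rule ultrafilter_le_eq[OF \<nu>])
      (auto intro!: filter_leI 2 simp: eventually_filtermap filtermap_bot_iff ultrafilter_not_bot[OF \<omega>(1)])
  moreover have "eventually (\<lambda>p. R (fst p) (snd p)) \<omega>"
    using \<omega>(2) by (simp add: le_principal)
  ultimately show ?thesis using \<omega>(1) by blast
qed

text \<open>The nontrivial half of the naturality of \<open>m\<^sup>o\<^sup>p\<close>: a witness \<open>\<Xi>\<close> is the first projection of an ultrafilter
  containing all sets of pairs satisfying \<open>good p q\<close>.\<close>

lemma urel_umult:
  assumes \<Psi>: "\<Psi> \<in> UU C" and \<Omega>: "\<Omega> \<in> UU (UU B)" and R: "urel R \<Psi> (umult \<Omega>)"
  shows "\<exists>\<Xi>\<in>UU (UU C). umult \<Xi> = \<Psi> \<and> urel (urel R) \<Xi> \<Omega>"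
proof -
  define good where "good p q \<Lambda> \<nu> \<longleftrightarrow> \<Lambda> \<in> UU C \<and> eventually p \<Lambda> \<and> q \<nu> \<and> urel R \<Lambda> \<nu>"
    for p q \<Lambda> \<nu>
  define H where "H = Abs_filter (\<lambda>P. \<exists>p q. eventually p \<Psi> \<and> eventually q \<Omega> \<and>
      (\<forall>\<Lambda> \<nu>. good p q \<Lambda> \<nu> \<longrightarrow> P (\<Lambda>, \<nu>)))"
  have H: "eventually P H \<longleftrightarrow> (\<exists>p q. eventually p \<Psi> \<and> eventually q \<Omega> \<and>
      (\<forall>\<Lambda> \<nu>. good p q \<Lambda> \<nu> \<longrightarrow> P (\<Lambda>, \<nu>)))" for P
    unfolding H_def
  proof (rule eventually_Abs_filter, rule is_filter.intro, goal_cases)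
    case 1
    show ?case by (intro exI[of _ "\<lambda>_. True"]) simp
  next
    case (2 P Q)
    then obtain p q p' q' where pq: "eventually p \<Psi>" "eventually q \<Omega>" "eventually p' \<Psi>" "eventually q' \<Omega>"
      "\<forall>\<Lambda> \<nu>. good p q \<Lambda> \<nu> \<longrightarrow> P (\<Lambda>, \<nu>)" "\<forall>\<Lambda> \<nu>. good p' q' \<Lambda> \<nu> \<longrightarrow> Q (\<Lambda>, \<nu>)" by blast
    have "good p q \<Lambda> \<nu> \<and> good p' q' \<Lambda> \<nu>"
      if "good (\<lambda>x. p x \<and> p' x) (\<lambda>x. q x \<and> q' x) \<Lambda> \<nu>" for \<Lambda> \<nu>
      using that by (auto simp: good_def elim: eventually_mono)
    with pq show ?case
      by (intro exI[of _ "\<lambda>x. p x \<and> p' x"] exI[of _ "\<lambda>x. q x \<and> q' x"]) (simp add: eventually_conj)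
  next
    case 3
    then show ?case by blast
  qed
  \<comment> \<open>The points with an \<open>R\<close>-partner in \<open>C\<close> satisfying
    \<open>p\<close> meet every member of \<open>umult \<Omega>\<close>, so they form a member of
    it, and \<Omega>-almost every \<nu> contains them. For one such \<nu> satisfying
    \<open>q\<close>, choosing a partner for each point pushes \<nu> forward to the required
    \<Lambda>.\<close>
  have good_ex: "\<exists>\<Lambda> \<nu>. good p q \<Lambda> \<nu>" if p: "eventually p \<Psi>" and q: "eventually q \<Omega>" for p q
  proof -
    have p': "eventually (\<lambda>x. p x \<and> x \<in> C) \<Psi>"
      using p UU_eventually[OF \<Psi>] by (rule eventually_conj)
    have "eventually (\<lambda>y. \<exists>x. (p x \<and> x \<in> C) \<and> R x y) (umult \<Omega>)"
    proof (rule ultrafilter_eventuallyI)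
      show "ultrafilter (umult \<Omega>)" using umult_UU[OF \<Omega>] by (rule UU_ultrafilter)
      show "\<exists>y. Q y \<and> (\<exists>x. (p x \<and> x \<in> C) \<and> R x y)" if "eventually Q (umult \<Omega>)" for Q
        using R[unfolded urel_def] p' that by blast
    qed
    then have "eventually (\<lambda>\<nu>. eventually (\<lambda>y. \<exists>x. (p x \<and> x \<in> C) \<and> R x y) \<nu>) \<Omega>"
      by (simp add: eventually_umult)
    with q UU_eventually[OF \<Omega>]
    have "eventually (\<lambda>\<nu>. \<nu> \<in> UU B \<and> q \<nu> \<and> eventually (\<lambda>y. \<exists>x. (p x \<and> x \<in> C) \<and> R x y) \<nu>) \<Omega>"
      by eventually_elim simp
    then obtain \<nu> where \<nu>: "\<nu> \<in> UU B" "q \<nu>" "eventually (\<lambda>y. \<exists>x. (p x \<and> x \<in> C) \<and> R x y) \<nu>"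
      using eventually_happens' ultrafilter_not_bot[OF UU_ultrafilter[OF \<Omega>]] by blast
    from eventually_choice[OF \<nu>(3)] obtain g
      where g: "eventually (\<lambda>y. (p (g y) \<and> g y \<in> C) \<and> R (g y) y) \<nu>" ..
    have "urel R (filtermap g \<nu>) (filtermap (\<lambda>x. x) \<nu>)"
      using g by (intro urel_filtermap) (auto simp: ultrafilter_not_bot UU_ultrafilter[OF \<nu>(1)] elim: eventually_mono)
    moreover have "filtermap g \<nu> \<in> UU C"
      using g UU_ultrafilter[OF \<nu>(1)]
      by (auto simp: UU_iff ultrafilter_filtermap eventually_filtermap elim: eventually_mono)
    moreover have "eventually p (filtermap g \<nu>)"
      using g by (auto simp: eventually_filtermap elim: eventually_mono)
    ultimately have "good p q (filtermap g \<nu>) \<nu>"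
      using \<nu>(2) by (simp add: good_def filtermap_ident)
    then show ?thesis by blast
  qed
  have "H \<noteq> bot" unfolding trivial_limit_def H using good_ex by blast
  then obtain W where W: "ultrafilter W" "W \<le> H" using ultrafilter_exists by blast
  have ev: "eventually P W" if "eventually p \<Psi>" "eventually q \<Omega>" "\<And>\<Lambda> \<nu>. good p q \<Lambda> \<nu> \<Longrightarrow> P (\<Lambda>, \<nu>)"
    for P p q
    using that by (intro filter_leD[OF W(2)]) (auto simp: H)
  let ?\<Xi> = "filtermap fst W"
  have \<Xi>: "?\<Xi> \<in> UU (UU C)"
    using W(1) ev[of "\<lambda>_. True" "\<lambda>_. True" "\<lambda>p. fst p \<in> UU C"]
    by (simp add: UU_iff[of ?\<Xi>] ultrafilter_filtermap eventually_filtermap good_def)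
  have "umult ?\<Xi> = \<Psi>"
  proof (rule ultrafilter_le_eq[OF UU_ultrafilter[OF \<Psi>]], rule filter_leI)
    fix p assume "eventually p \<Psi>"
    then show "eventually p (umult ?\<Xi>)"
      using ev[of p "\<lambda>_. True" "\<lambda>w. eventually p (fst w)"]
      by (simp add: eventually_umult eventually_filtermap good_def)
  qed (rule ultrafilter_not_bot[OF UU_ultrafilter[OF umult_UU[OF \<Xi>]]])
  moreover have "filtermap snd W = \<Omega>"
  proof (rule ultrafilter_le_eq[OF UU_ultrafilter[OF \<Omega>]], rule filter_leI)
    fix q assume "eventually q \<Omega>"
    then show "eventually q (filtermap snd W)"
      using ev[of "\<lambda>_. True" q "\<lambda>w. q (snd w)"] by (simp add: eventually_filtermap good_def)
  qed (simp add: filtermap_bot_iff ultrafilter_not_bot[OF W(1)])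
  moreover have "urel (urel R) ?\<Xi> (filtermap snd W)"
    using W(1) ev[of "\<lambda>_. True" "\<lambda>_. True" "\<lambda>p. urel R (fst p) (snd p)"]
    by (intro urel_filtermap) (simp_all add: ultrafilter_not_bot good_def)
  ultimately show ?thesis using \<Xi> by auto
qed


lemma urel_mono_on:
  assumes "\<sigma> \<in> UU A" "\<nu> \<in> UU B" "urel R \<sigma> \<nu>" "\<And>x y. x \<in> A \<Longrightarrow> y \<in> B \<Longrightarrow> R x y \<Longrightarrow> T x y"
  shows "urel T \<sigma> \<nu>"
  unfolding urel_def
proof (intro allI impI)
  fix P Q assume "eventually P \<sigma>" "eventually Q \<nu>"
  then have "eventually (\<lambda>x. P x \<and> x \<in> A) \<sigma>" "eventually (\<lambda>y. Q y \<and> y \<in> B) \<nu>"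
    using assms(1,2) by (auto simp: UU_iff intro: eventually_conj)
  with assms(3) have "\<exists>x y. (P x \<and> x \<in> A) \<and> (Q y \<and> y \<in> B) \<and> R x y"
    unfolding urel_def by blast
  then show "\<exists>x y. P x \<and> Q y \<and> T x y" using assms(4) by blast
qed

lemma urel_filtermap_iff:
  "urel R (filtermap f \<sigma>) (filtermap g \<nu>) \<longleftrightarrow> urel (\<lambda>x y. R (f x) (g y)) \<sigma> \<nu>"
proof
  assume L: "urel R (filtermap f \<sigma>) (filtermap g \<nu>)"
  show "urel (\<lambda>x y. R (f x) (g y)) \<sigma> \<nu>"
    unfolding urel_def
  proof (intro allI impI)
    fix P Q assume PQ: "eventually P \<sigma>" "eventually Q \<nu>"
    have "eventually (\<lambda>x'. \<exists>x. P x \<and> f x = x') (filtermap f \<sigma>)"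
      "eventually (\<lambda>y'. \<exists>y. Q y \<and> g y = y') (filtermap g \<nu>)"
      using PQ by (auto simp: eventually_filtermap elim: eventually_mono)
    then have "\<exists>x' y'. (\<exists>x. P x \<and> f x = x') \<and> (\<exists>y. Q y \<and> g y = y') \<and> R x' y'"
      using L unfolding urel_def by blast
    then show "\<exists>x y. P x \<and> Q y \<and> R (f x) (g y)" by blast
  qed
next
  assume L: "urel (\<lambda>x y. R (f x) (g y)) \<sigma> \<nu>"
  show "urel R (filtermap f \<sigma>) (filtermap g \<nu>)"
    unfolding urel_def eventually_filtermap
  proof (intro allI impI)
    fix P Q assume PQ: "eventually (\<lambda>x. P (f x)) \<sigma>" "eventually (\<lambda>y. Q (g y)) \<nu>"
    obtain x y where "P (f x)" "Q (g y)" "R (f x) (g y)"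
      using L[unfolded urel_def, rule_format, OF PQ] by auto
    then show "\<exists>x y. P x \<and> Q y \<and> R x y" by auto
  qed
qed


section \<open>Lifting quantale-valued relations to ultrafilters\<close>

lemma urel_le_Uext: "urel (\<lambda>x y. u \<le> r x y) \<sigma> \<nu> \<Longrightarrow> u \<le> Uext r \<sigma> \<nu>"
  unfolding Uext_def sets_of_def urel_def
proof (intro INF_greatest)
  fix A B
  assume L: "\<forall>P Q. eventually P \<sigma> \<longrightarrow> eventually Q \<nu> \<longrightarrow> (\<exists>x y. P x \<and> Q y \<and> u \<le> r x y)"
    and "A \<in> {A. eventually (\<lambda>x. x \<in> A) \<sigma>}" "B \<in> {B. eventually (\<lambda>y. y \<in> B) \<nu>}"
  then have "eventually (\<lambda>x. x \<in> A) \<sigma>" "eventually (\<lambda>y. y \<in> B) \<nu>" by simp_all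
  from L[rule_format, OF this] obtain x y where "x \<in> A" "y \<in> B" "u \<le> r x y" by blast
  then show "u \<le> (SUP x\<in>A. SUP y\<in>B. r x y)" by (auto intro: SUP_upper2)
qed

text \<open>An element totally below \<open>Uext r\<close> cuts \<open>r\<close> down to a two-valued relation, so identities
  for \<^const>\<open>Uext\<close> reduce to combinatorics of \<^const>\<open>urel\<close>.\<close>

lemma totally_below_Uext:
  assumes "totally_below u (Uext r \<sigma> \<nu>)"
  shows "urel (\<lambda>x y. totally_below u (r x y)) \<sigma> \<nu>"
  unfolding urel_def
proof (intro allI impI)
  fix P Q assume "eventually P \<sigma>" "eventually Q \<nu>"
  then have "Collect P \<in> sets_of \<sigma>" "Collect Q \<in> sets_of \<nu>" by (simp_all add: sets_of_def)
  then have *: "Uext r \<sigma> \<nu> \<le> (SUP x\<in>Collect P. SUP y\<in>Collect Q. r x y)"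
    unfolding Uext_def by (intro INF_lower2[of "Collect P"] INF_lower2[of "Collect Q"] order_refl)
  \<comment> \<open>One interpolation pays for each of the two nested suprema; the remaining strict
    step keeps \<open>u\<close> totally below \<open>r x y\<close> and not just below it.\<close>
  obtain w where w: "totally_below u w" "totally_below w (Uext r \<sigma> \<nu>)"
    using totally_below_interpolate[OF assms] by blast
  obtain w' where w': "totally_below w w'" "totally_below w' (Uext r \<sigma> \<nu>)"
    using totally_below_interpolate[OF w(2)] by blast
  obtain x where x: "P x" "w' \<le> (SUP y\<in>Collect Q. r x y)"
    using totally_below_SUP[OF totally_below_mono[OF w'(2) *]] by auto
  obtain y where "Q y" "w \<le> r x y"
    using totally_below_SUP[OF totally_below_mono[OF w'(1) x(2)]] by auto
  then show "\<exists>x y. P x \<and> Q y \<and> totally_below u (r x y)"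
    using x(1) w(1) totally_below_mono by blast
qed

lemma totally_below_imp_le: "totally_below u a \<Longrightarrow> u \<le> a"
  using totally_below_SUP[of u "\<lambda>x. x" "{a}"] by simp

lemma urel_totally_belowD:
  assumes "urel (\<lambda>x y. totally_below u (r x y)) \<sigma> \<nu>"
  shows "urel (\<lambda>x y. u \<le> r x y) \<sigma> \<nu>"
  unfolding urel_def
proof (intro allI impI)
  fix P Q assume "eventually P \<sigma>" "eventually Q \<nu>"
  from assms[unfolded urel_def, rule_format, OF this]
  show "\<exists>x y. P x \<and> Q y \<and> u \<le> r x y" using totally_below_imp_le by blast
qed

text \<open>Together with \<open>urel_le_Uext\<close> this proves inequalities of liftings cut by
  cut, with a strict cut on the left and a weak one on the right.\<close>

lemma Uext_leI:
  assumes "\<And>u. urel (\<lambda>x y. totally_below u (r x y)) \<sigma> \<nu> \<Longrightarrow> u \<le> b"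
  shows "Uext r \<sigma> \<nu> \<le> b"
  by (rule totally_below_leI, rule assms, rule totally_below_Uext)

lemma Uext_mono_on:
  assumes "\<sigma> \<in> UU A" "\<nu> \<in> UU B" "\<And>x y. x \<in> A \<Longrightarrow> y \<in> B \<Longrightarrow> r x y \<le> s x y"
  shows "Uext r \<sigma> \<nu> \<le> Uext s \<sigma> \<nu>"
proof (rule Uext_leI, rule urel_le_Uext)
  fix u assume "urel (\<lambda>x y. totally_below u (r x y)) \<sigma> \<nu>"
  with assms(1,2) show "urel (\<lambda>x y. u \<le> s x y) \<sigma> \<nu>"
    by (rule urel_mono_on) (rule order_trans[OF totally_below_imp_le assms(3)])
qed

lemma Uext_filtermap:
  "Uext r (filtermap f \<sigma>) (filtermap g \<nu>) = Uext (\<lambda>x y. r (f x) (g y)) \<sigma> \<nu>"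
proof (rule antisym)
  show "Uext r (filtermap f \<sigma>) (filtermap g \<nu>) \<le> Uext (\<lambda>x y. r (f x) (g y)) \<sigma> \<nu>"
    by (rule Uext_leI, rule urel_le_Uext, rule urel_totally_belowD) (simp add: urel_filtermap_iff)
  show "Uext (\<lambda>x y. r (f x) (g y)) \<sigma> \<nu> \<le> Uext r (filtermap f \<sigma>) (filtermap g \<nu>)"
    by (rule Uext_leI, rule urel_le_Uext, simp only: urel_filtermap_iff, rule urel_totally_belowD)
qed

lemma Uext_filtermap_right: "Uext r \<sigma> (filtermap g \<nu>) = Uext (\<lambda>x y. r x (g y)) \<sigma> \<nu>"
  using Uext_filtermap[of r "\<lambda>x. x" \<sigma> g \<nu>] by (simp add: filtermap_ident)

lemma Uext_principal: "r x y \<le> Uext r (principal {x}) (principal {y})"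
  by (rule urel_le_Uext) (auto simp: urel_def eventually_principal)

section \<open>Liftings as suprema of \<open>xi\<close> over couplings\<close>

lemma le_xi_filtermap:
  assumes "\<omega> \<noteq> bot" "eventually (\<lambda>p. u \<le> h p) \<omega>"
  shows "u \<le> xi (filtermap h \<omega>)"
  unfolding xi_def
proof (rule INF_greatest)
  fix A assume "A \<in> sets_of (filtermap h \<omega>)"
  then have "eventually (\<lambda>p. h p \<in> A) \<omega>" by (simp add: sets_of_def eventually_filtermap)
  with assms(2) have "eventually (\<lambda>p. h p \<in> A \<and> u \<le> h p) \<omega>" by eventually_elim simp
  then obtain p where "h p \<in> A" "u \<le> h p" using eventually_happens'[OF assms(1)] by blast
  then show "u \<le> Sup A" by (rule Sup_upper2)
qed

text \<open>Members of the two image filters pull back to a single member of \<omega>, and the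
  values of \<open>r\<close> on it form one of the sets over which \<open>xi\<close> takes its
  infimum.\<close>

lemma xi_le_Uext: "xi (filtermap (\<lambda>p. r (f p) (g p)) \<omega>) \<le> Uext r (filtermap f \<omega>) (filtermap g \<omega>)"
  unfolding Uext_def
proof (intro INF_greatest)
  fix A B assume "A \<in> sets_of (filtermap f \<omega>)" "B \<in> sets_of (filtermap g \<omega>)"
  then have "eventually (\<lambda>p. f p \<in> A \<and> g p \<in> B) \<omega>"
    by (auto simp: sets_of_def eventually_filtermap intro: eventually_conj)
  then have "(\<lambda>p. r (f p) (g p)) ` {p. f p \<in> A \<and> g p \<in> B} \<in> sets_of (filtermap (\<lambda>p. r (f p) (g p)) \<omega>)"
    by (auto simp: sets_of_def eventually_filtermap elim!: eventually_mono)
  then have "xi (filtermap (\<lambda>p. r (f p) (g p)) \<omega>) \<le> (SUP p\<in>{p. f p \<in> A \<and> g p \<in> B}. r (f p) (g p))"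
    unfolding xi_def by (rule INF_lower)
  also have "\<dots> \<le> (SUP x\<in>A. SUP y\<in>B. r x y)"
    by (rule SUP_least) (auto intro: SUP_upper2)
  finally show "xi (filtermap (\<lambda>p. r (f p) (g p)) \<omega>) \<le> (SUP x\<in>A. SUP y\<in>B. r x y)" .
qed

text \<open>The coupling comes from the cut at \<open>u\<close>, where \<open>r\<close> is at least
  \<open>u\<close> almost everywhere. With \<open>xi_le_Uext\<close> it identifies
  \<open>Uext\<close> with a supremum over couplings, the form that presheaf structures use.\<close>

lemma Uext_le_SUP_xi:
  assumes \<sigma>: "\<sigma> \<in> UU A" and \<nu>: "\<nu> \<in> UU B"
  shows "Uext r \<sigma> \<nu> \<le> (SUP \<omega>\<in>{\<omega>\<in>UU (A \<times> B). filtermap fst \<omega> = \<sigma> \<and> filtermap snd \<omega> = \<nu>}.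
           xi (filtermap (\<lambda>(x, y). r x y) \<omega>))"
proof (rule Uext_leI)
  fix u assume u: "urel (\<lambda>x y. totally_below u (r x y)) \<sigma> \<nu>"
  obtain \<omega> where \<omega>: "ultrafilter \<omega>" "filtermap fst \<omega> = \<sigma>" "filtermap snd \<omega> = \<nu>"
      "eventually (\<lambda>p. totally_below u (r (fst p) (snd p))) \<omega>"
    using urel_coupling[OF UU_ultrafilter[OF \<sigma>] UU_ultrafilter[OF \<nu>] u] by blast
  have "eventually (\<lambda>p. fst p \<in> A) \<omega>" "eventually (\<lambda>p. snd p \<in> B) \<omega>"
    using UU_eventually[OF \<sigma>] UU_eventually[OF \<nu>]
    unfolding \<omega>(2,3)[symmetric] by (simp_all add: eventually_filtermap)
  then have "eventually (\<lambda>p. p \<in> A \<times> B) \<omega>"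
    by eventually_elim (simp add: mem_Times_iff)
  with \<omega>(1-3) have "\<omega> \<in> {\<omega>\<in>UU (A \<times> B). filtermap fst \<omega> = \<sigma> \<and> filtermap snd \<omega> = \<nu>}"
    by (simp add: UU_iff)
  moreover have "u \<le> xi (filtermap (\<lambda>(x, y). r x y) \<omega>)"
    using \<omega>(1,4) by (intro le_xi_filtermap)
      (auto simp: ultrafilter_not_bot case_prod_beta elim!: eventually_mono dest: totally_below_imp_le)
  ultimately show "u \<le> (SUP \<omega>\<in>{\<omega>\<in>UU (A \<times> B). filtermap fst \<omega> = \<sigma> \<and> filtermap snd \<omega> = \<nu>}.
           xi (filtermap (\<lambda>(x, y). r x y) \<omega>))"
    by (rule SUP_upper2)
qed

text \<open>The cuts of \<open>r\<close> and \<open>s\<close> each give a member of the same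
  ultrafilter \<nu>, so they share a middle point.\<close>

lemma Uext_mult_le:
  assumes \<nu>: "\<nu> \<in> UU B"
  shows "Uext r \<sigma> \<nu> * Uext s \<nu> \<tau> \<le> Uext (rcomp B s r) \<sigma> \<tau>"
proof -
  let ?b = "Uext (rcomp B s r) \<sigma> \<tau>"
  have *: "u * w \<le> ?b" if u: "urel (\<lambda>x y. totally_below u (r x y)) \<sigma> \<nu>"
    and w: "urel (\<lambda>y z. totally_below w (s y z)) \<nu> \<tau>" for u w
  proof (rule urel_le_Uext, unfold urel_def, intro allI impI)
    fix P Q assume PQ: "eventually P \<sigma>" "eventually Q \<tau>"
    have "eventually (\<lambda>y. \<exists>x. P x \<and> totally_below u (r x y)) \<nu>"
      by (rule ultrafilter_eventuallyI[OF UU_ultrafilter[OF \<nu>]])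
        (use u PQ(1) in \<open>unfold urel_def, blast\<close>)
    moreover have "eventually (\<lambda>y. \<exists>z. Q z \<and> totally_below w (s y z)) \<nu>"
      by (rule ultrafilter_eventuallyI[OF UU_ultrafilter[OF \<nu>]])
        (use w PQ(2) in \<open>unfold urel_def, blast\<close>)
    ultimately have "eventually (\<lambda>y. y \<in> B \<and> (\<exists>x. P x \<and> totally_below u (r x y)) \<and>
        (\<exists>z. Q z \<and> totally_below w (s y z))) \<nu>"
      using UU_eventually[OF \<nu>] by eventually_elim simp
    then obtain x y z where xyz: "y \<in> B" "P x" "Q z" "u \<le> r x y" "w \<le> s y z"
      using eventually_happens'[OF ultrafilter_not_bot[OF UU_ultrafilter[OF \<nu>]]] totally_below_imp_le
      by blast
    then have "u * w \<le> rcomp B s r x z"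
      unfolding rcomp_def by (intro SUP_upper2[of y] quantale_mult_mono)
    with xyz show "\<exists>x z. P x \<and> Q z \<and> u * w \<le> rcomp B s r x z" by blast
  qed
  \<comment> \<open>\<open>Uext_leI\<close> needs a single lifting on the left, so the product is
    residuated, first in one factor and then in the other.\<close>
  have "Uext r \<sigma> \<nu> \<le> qhom (Uext s \<nu> \<tau>) ?b"
  proof (rule Uext_leI, unfold le_qhom_iff)
    fix u assume u: "urel (\<lambda>x y. totally_below u (r x y)) \<sigma> \<nu>"
    have "Uext s \<nu> \<tau> \<le> qhom u ?b"
      by (rule Uext_leI) (use *[OF u] in \<open>simp add: le_qhom_iff\<close>)
    then show "Uext s \<nu> \<tau> * u \<le> ?b" by (simp add: le_qhom_iff mult.commute)
  qed
  then show ?thesis by (simp add: le_qhom_iff mult.commute)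
qed


text \<open>On a coupling of \<sigma> and \<nu> the supremum over a fibre is witnessed by a chosen
  point of it; the image of the coupling under this choice is the required \<tau>.\<close>

lemma Uext_SUP_fibre_le:
  assumes \<sigma>: "ultrafilter \<sigma>" and \<nu>: "ultrafilter \<nu>"
  shows "Uext (\<lambda>x y. SUP a\<in>{a\<in>A. f a = x}. r a y) \<sigma> \<nu> \<le> (SUP \<tau>\<in>{\<tau>\<in>UU A. filtermap f \<tau> = \<sigma>}. Uext r \<tau> \<nu>)"
proof (rule Uext_leI)
  fix u assume "urel (\<lambda>x y. totally_below u (SUP a\<in>{a\<in>A. f a = x}. r a y)) \<sigma> \<nu>"
  from urel_coupling[OF \<sigma> \<nu> this] obtain \<omega> where \<omega>: "ultrafilter \<omega>" "filtermap fst \<omega> = \<sigma>" "filtermap snd \<omega> = \<nu>"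
    "eventually (\<lambda>p. totally_below u (SUP a\<in>{a\<in>A. f a = fst p}. r a (snd p))) \<omega>" by blast
  have "eventually (\<lambda>p. \<exists>a. (a \<in> A \<and> f a = fst p) \<and> u \<le> r a (snd p)) \<omega>"
    using \<omega>(4)
  proof eventually_elim
    case (elim p)
    from totally_below_SUP[OF elim] show ?case by auto
  qed
  from eventually_choice[OF this] obtain g
    where g: "eventually (\<lambda>p. (g p \<in> A \<and> f (g p) = fst p) \<and> u \<le> r (g p) (snd p)) \<omega>" ..
  have "filtermap g \<omega> \<in> UU A"
    unfolding UU_iff eventually_filtermap
    using ultrafilter_filtermap[OF \<omega>(1)] eventually_mono[OF g] by simp
  moreover have "filtermap f (filtermap g \<omega>) = \<sigma>"
    unfolding \<omega>(2)[symmetric] filtermap_filtermap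
    by (rule filtermap_eventually_cong[OF eventually_mono[OF g]]) simp
  ultimately have m: "filtermap g \<omega> \<in> {\<tau>\<in>UU A. filtermap f \<tau> = \<sigma>}" by blast
  have "urel (\<lambda>a y. u \<le> r a y) (filtermap g \<omega>) (filtermap snd \<omega>)"
    by (rule urel_filtermap[OF ultrafilter_not_bot[OF \<omega>(1)] eventually_mono[OF g]]) simp
  then have "u \<le> Uext r (filtermap g \<omega>) \<nu>"
    unfolding \<omega>(3) by (rule urel_le_Uext)
  with m show "u \<le> (SUP \<tau>\<in>{\<tau>\<in>UU A. filtermap f \<tau> = \<sigma>}. Uext r \<tau> \<nu>)"
    by (rule SUP_upper2)
qed

text \<open>With \<open>f = umult\<close> and \<open>r = Uext \<alpha>\<close> this moves the
  lifting past the supremum that makes up \<open>Umop\<close>.\<close>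

lemma Uext_SUP_fibre:
  assumes \<sigma>: "ultrafilter \<sigma>" and \<nu>: "ultrafilter \<nu>"
  shows "Uext (\<lambda>x y. SUP a\<in>{a\<in>A. f a = x}. r a y) \<sigma> \<nu> = (SUP \<tau>\<in>{\<tau>\<in>UU A. filtermap f \<tau> = \<sigma>}. Uext r \<tau> \<nu>)"
proof (rule antisym[OF Uext_SUP_fibre_le[OF assms]], rule SUP_least)
  fix \<tau> assume "\<tau> \<in> {\<tau>\<in>UU A. filtermap f \<tau> = \<sigma>}"
  then have \<tau>: "\<tau> \<in> UU A" and [simp]: "filtermap f \<tau> = \<sigma>" by auto
  have "\<nu> \<in> UU UNIV" using \<nu> by (simp add: UU_iff)
  then have "Uext r \<tau> \<nu> \<le> Uext (\<lambda>x y. SUP a\<in>{a\<in>A. f a = f x}. r a y) \<tau> \<nu>"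
    by (rule Uext_mono_on[OF \<tau>]) (auto intro: SUP_upper)
  then show "Uext r \<tau> \<nu> \<le> Uext (\<lambda>x y. SUP a\<in>{a\<in>A. f a = x}. r a y) \<sigma> \<nu>"
    using Uext_filtermap[of "\<lambda>x y. SUP a\<in>{a\<in>A. f a = x}. r a y" f \<tau> "\<lambda>y. y" \<nu>]
    by (simp add: filtermap_ident)
qed

text \<open>Naturality of \<open>m\<^sup>o\<^sup>p\<close>: a multiplication in the right argument
  is traded for a decomposition of the left one. One inequality applies \<open>urel_umult\<close> to
  each cut, the other opens a double cut level by level.\<close>

lemma Uext_umult_right:
  assumes \<Psi>: "\<Psi> \<in> UU C" and \<Omega>: "\<Omega> \<in> UU (UU B)"
  shows "Uext r \<Psi> (umult \<Omega>) = (SUP \<Xi>\<in>{\<Xi>\<in>UU (UU C). umult \<Xi> = \<Psi>}. Uext (Uext r) \<Xi> \<Omega>)"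
proof (rule antisym)
  show "Uext r \<Psi> (umult \<Omega>) \<le> (SUP \<Xi>\<in>{\<Xi>\<in>UU (UU C). umult \<Xi> = \<Psi>}. Uext (Uext r) \<Xi> \<Omega>)"
  proof (rule Uext_leI)
    fix u assume u: "urel (\<lambda>x y. totally_below u (r x y)) \<Psi> (umult \<Omega>)"
    obtain \<Xi> where \<Xi>: "\<Xi> \<in> UU (UU C)" "umult \<Xi> = \<Psi>"
      "urel (urel (\<lambda>x y. totally_below u (r x y))) \<Xi> \<Omega>"
      using urel_umult[OF \<Psi> \<Omega> u] by blast
    have "u \<le> Uext (Uext r) \<Xi> \<Omega>"
    proof (rule urel_le_Uext, rule urel_mono_on[OF \<Xi>(1) \<Omega> \<Xi>(3)])
      fix \<Lambda> \<nu> assume "\<Lambda> \<in> UU C" "\<nu> \<in> UU B" "urel (\<lambda>x y. totally_below u (r x y)) \<Lambda> \<nu>"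
      then have "urel (\<lambda>x y. u \<le> r x y) \<Lambda> \<nu>"
        by (rule urel_mono_on) (rule totally_below_imp_le)
      then show "u \<le> Uext r \<Lambda> \<nu>" by (rule urel_le_Uext)
    qed
    then show "u \<le> (SUP \<Xi>\<in>{\<Xi>\<in>UU (UU C). umult \<Xi> = \<Psi>}. Uext (Uext r) \<Xi> \<Omega>)"
      using \<Xi>(1,2) by (intro SUP_upper2[of \<Xi>]) auto
  qed
next
  have "Uext (Uext r) \<Xi> \<Omega> \<le> Uext r (umult \<Xi>) (umult \<Omega>)" for \<Xi>
  proof (rule Uext_leI, rule urel_le_Uext, unfold urel_def eventually_umult, intro allI impI)
    fix u P Q
    assume "\<forall>P Q. eventually P \<Xi> \<longrightarrow> eventually Q \<Omega> \<longrightarrow> (\<exists>x y. P x \<and> Q y \<and> totally_below u (Uext r x y))"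
      and "eventually (\<lambda>\<sigma>. eventually P \<sigma>) \<Xi>" "eventually (\<lambda>\<sigma>. eventually Q \<sigma>) \<Omega>"
    then obtain \<Lambda> \<nu> where "eventually P \<Lambda>" "eventually Q \<nu>" "totally_below u (Uext r \<Lambda> \<nu>)" by blast
    with totally_below_Uext[OF this(3)] show "\<exists>x y. P x \<and> Q y \<and> u \<le> r x y"
      unfolding urel_def using totally_below_imp_le by blast
  qed
  then show "(SUP \<Xi>\<in>{\<Xi>\<in>UU (UU C). umult \<Xi> = \<Psi>}. Uext (Uext r) \<Xi> \<Omega>) \<le> Uext r \<Psi> (umult \<Omega>)"
    by (intro SUP_least) auto
qed


section \<open>Kleisli convolution\<close>

lemma Umop_eq: "Umop A \<alpha> \<nu> \<upsilon> = (SUP \<Xi>\<in>{\<Xi>\<in>UU (UU A). umult \<Xi> = \<nu>}. Uext \<alpha> \<Xi> \<upsilon>)"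
  unfolding Umop_def rcomp_def transp_def graph_def
proof (intro antisym SUP_least)
  fix \<Xi> assume "\<Xi> \<in> UU (UU A)"
  then show "(if umult \<Xi> = \<nu> then 1 else bot) * Uext \<alpha> \<Xi> \<upsilon>
      \<le> (SUP \<Xi>\<in>{\<Xi>\<in>UU (UU A). umult \<Xi> = \<nu>}. Uext \<alpha> \<Xi> \<upsilon>)"
    by (auto intro: SUP_upper)
next
  fix \<Xi> assume "\<Xi> \<in> {\<Xi>\<in>UU (UU A). umult \<Xi> = \<nu>}"
  then show "Uext \<alpha> \<Xi> \<upsilon> \<le> (SUP \<Xi>\<in>UU (UU A). (if umult \<Xi> = \<nu> then 1 else bot) * Uext \<alpha> \<Xi> \<upsilon>)"
    by (intro SUP_upper2[of \<Xi>]) auto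
qed

lemma Uext_le_Umop: "\<Xi> \<in> UU (UU A) \<Longrightarrow> Uext \<alpha> \<Xi> \<upsilon> \<le> Umop A \<alpha> (umult \<Xi>) \<upsilon>"
  unfolding Umop_eq by (rule SUP_upper) simp

lemma Umop_leI:
  "(\<And>\<Xi>. \<Xi> \<in> UU (UU A) \<Longrightarrow> umult \<Xi> = \<nu> \<Longrightarrow> Uext \<alpha> \<Xi> \<upsilon> \<le> q) \<Longrightarrow> Umop A \<alpha> \<nu> \<upsilon> \<le> q"
  unfolding Umop_eq by (rule SUP_least) auto

lemma Umop_mono_on:
  assumes "\<upsilon> \<in> UU B" "\<And>\<sigma> y. \<sigma> \<in> UU A \<Longrightarrow> y \<in> B \<Longrightarrow> \<alpha> \<sigma> y \<le> \<alpha>' \<sigma> y"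
  shows "Umop A \<alpha> \<nu> \<upsilon> \<le> Umop A \<alpha>' \<nu> \<upsilon>"
  unfolding Umop_eq by (rule SUP_mono) (use assms Uext_mono_on in blast)

lemma Umop_filtermap: "Umop A \<alpha> \<nu> (filtermap f \<upsilon>) = Umop A (\<lambda>\<sigma> x. \<alpha> \<sigma> (f x)) \<nu> \<upsilon>"
  by (simp add: Umop_eq Uext_filtermap_right)

lemma le_Umop_principal:
  assumes "\<sigma> \<in> UU A"
  shows "\<alpha> \<sigma> y \<le> Umop A \<alpha> \<sigma> (principal {y})"
  using order_trans[OF Uext_principal[of \<alpha> \<sigma> y] Uext_le_Umop[OF UU_principal[OF assms]]] by simp

text \<open>The decomposition is the image of \<upsilon> under
  \<open>x \<mapsto> principal {f x}\<close>, which multiplies to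
  \<open>filtermap f \<upsilon>\<close>. It lifts inequalities at points to arbitrary
  ultrafilters.\<close>

lemma one_le_Umop:
  assumes \<upsilon>: "\<upsilon> \<in> UU A" and f: "\<And>x. x \<in> A \<Longrightarrow> f x \<in> B" and "\<And>x. x \<in> A \<Longrightarrow> 1 \<le> \<alpha> (principal {f x}) (g x)"
  shows "1 \<le> Umop B \<alpha> (filtermap f \<upsilon>) (filtermap g \<upsilon>)"
proof -
  let ?e = "\<lambda>x. principal {f x}"
  have "1 \<le> Uext \<alpha> (filtermap ?e \<upsilon>) (filtermap g \<upsilon>)"
    by (intro urel_le_Uext urel_filtermap)
      (use \<upsilon> assms(3) in \<open>auto simp: UU_iff ultrafilter_not_bot elim!: eventually_mono\<close>)
  also have "\<dots> \<le> Umop B \<alpha> (umult (filtermap ?e \<upsilon>)) (filtermap g \<upsilon>)"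
    by (intro Uext_le_Umop UU_filtermap[OF \<upsilon>] UU_principal f)
  also have "umult (filtermap ?e \<upsilon>) = filtermap f \<upsilon>"
    using umult_filtermap_principal[of "filtermap f \<upsilon>"] by (simp add: filtermap_filtermap)
  finally show ?thesis .
qed

lemma kleisli_eq: "kleisli A B \<beta> \<alpha> \<sigma> z = (SUP \<upsilon>\<in>UU B. Umop A \<alpha> \<sigma> \<upsilon> * \<beta> \<upsilon> z)"
  by (simp add: kleisli_def rcomp_def)

lemma le_kleisli: "\<upsilon> \<in> UU B \<Longrightarrow> Umop A \<alpha> \<sigma> \<upsilon> * \<beta> \<upsilon> z \<le> kleisli A B \<beta> \<alpha> \<sigma> z"
  unfolding kleisli_eq by (rule SUP_upper)

lemma kleisli_mono:
  assumes "\<And>\<sigma> y. \<sigma> \<in> UU A \<Longrightarrow> y \<in> B \<Longrightarrow> \<alpha> \<sigma> y \<le> \<alpha>' \<sigma> y" "\<And>\<upsilon>. \<upsilon> \<in> UU B \<Longrightarrow> \<beta> \<upsilon> z \<le> \<beta>' \<upsilon> z'"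
  shows "kleisli A B \<beta> \<alpha> \<sigma> z \<le> kleisli A B \<beta>' \<alpha>' \<sigma> z'"
  unfolding kleisli_eq by (intro SUP_mono) (use assms Umop_mono_on quantale_mult_mono in blast)

lemma kleisli_cong:
  assumes "\<And>\<sigma> y. \<sigma> \<in> UU A \<Longrightarrow> y \<in> B \<Longrightarrow> \<alpha> \<sigma> y = \<alpha>' \<sigma> y" "\<And>\<upsilon>. \<upsilon> \<in> UU B \<Longrightarrow> \<beta> \<upsilon> z = \<beta>' \<upsilon> z'"
  shows "kleisli A B \<beta> \<alpha> \<sigma> z = kleisli A B \<beta>' \<alpha>' \<sigma> z'"
  by (intro antisym kleisli_mono) (simp_all add: assms)

text \<open>The adjunction between convolution and extension, one column at a time. The columns
  \<open>z\<close> and \<open>z'\<close> may belong to different targets, such as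
  \<open>S \<psi>\<close> in \<open>X\<close> and \<psi> in \<open>JX\<close>.\<close>

lemma kleisli_kext_iff:
  "(\<forall>\<sigma>\<in>UU A. kleisli A B \<beta> \<alpha> \<sigma> z \<le> \<gamma> \<sigma> z') \<longleftrightarrow> (\<forall>\<upsilon>\<in>UU B. \<beta> \<upsilon> z \<le> kext A \<gamma> \<alpha> \<upsilon> z')"
  unfolding kleisli_eq kext_def le_INF_iff SUP_le_iff le_qhom_iff by blast

lemma kext_filtermap: "kext A \<gamma> \<alpha> (filtermap f \<upsilon>) z = kext A \<gamma> (\<lambda>\<sigma> x. \<alpha> \<sigma> (f x)) \<upsilon> z"
  by (simp add: kext_def Umop_filtermap)

lemma kext_cong:
  assumes "\<upsilon> \<in> UU B" "\<And>\<sigma> y. \<sigma> \<in> UU A \<Longrightarrow> y \<in> B \<Longrightarrow> \<alpha> \<sigma> y = \<alpha>' \<sigma> y" "\<And>\<sigma>. \<sigma> \<in> UU A \<Longrightarrow> \<gamma> \<sigma> z = \<gamma>' \<sigma> z'"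
  shows "kext A \<gamma> \<alpha> \<upsilon> z = kext A \<gamma>' \<alpha>' \<upsilon> z'"
proof -
  have "Umop A \<alpha> \<nu> \<upsilon> = Umop A \<alpha>' \<nu> \<upsilon>" for \<nu>
    by (intro antisym Umop_mono_on[OF assms(1)]) (simp_all add: assms(2))
  then show ?thesis by (simp add: kext_def assms(3))
qed

text \<open>The parameter \<open>T\<close> pins down the quantale type, while carrier types stay
  free in every lemma.\<close>

locale multiplicative_xi =
  fixes T :: "'q::quantale itself"
  assumes xi_mult: "\<And>\<omega> :: ('q \<times> 'q) filter. \<omega> \<in> UU UNIV \<Longrightarrow>
        xi (filtermap (\<lambda>(a, b). a * b) \<omega>) = xi (filtermap fst \<omega>) * xi (filtermap snd \<omega>)"
begin

text \<open>The middle ultrafilter is the image of a coupling of \<sigma> and \<tau> under a choice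
  of middle points. The cut bounds only the product of the two values and neither factor by itself;
  multiplicativity of \<open>xi\<close> splits it.\<close>

lemma Uext_rcomp_le:
  fixes r :: "'a \<Rightarrow> 'b \<Rightarrow> 'q" and s :: "'b \<Rightarrow> 'c \<Rightarrow> 'q"
  assumes \<sigma>: "ultrafilter \<sigma>" and \<tau>: "ultrafilter \<tau>"
  shows "Uext (rcomp B s r) \<sigma> \<tau> \<le> (SUP \<nu>\<in>UU B. Uext r \<sigma> \<nu> * Uext s \<nu> \<tau>)"
proof (rule Uext_leI)
  fix u assume "urel (\<lambda>x z. totally_below u (rcomp B s r x z)) \<sigma> \<tau>"
  from urel_coupling[OF \<sigma> \<tau> this] obtain \<omega> where \<omega>: "ultrafilter \<omega>" "filtermap fst \<omega> = \<sigma>" "filtermap snd \<omega> = \<tau>"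
    "eventually (\<lambda>p. totally_below u (rcomp B s r (fst p) (snd p))) \<omega>" by blast
  have "eventually (\<lambda>p. \<exists>y. y \<in> B \<and> u \<le> r (fst p) y * s y (snd p)) \<omega>"
    using \<omega>(4)
  proof eventually_elim
    case (elim p)
    from totally_below_SUP[OF elim[unfolded rcomp_def]] show ?case by auto
  qed
  from eventually_choice[OF this] obtain g
    where g: "eventually (\<lambda>p. g p \<in> B \<and> u \<le> r (fst p) (g p) * s (g p) (snd p)) \<omega>" ..
  let ?\<nu> = "filtermap g \<omega>"
  let ?f = "\<lambda>p. r (fst p) (g p)" and ?h = "\<lambda>p. s (g p) (snd p)"
  have \<nu>: "?\<nu> \<in> UU B"
    using g \<omega>(1) by (auto simp: UU_iff ultrafilter_filtermap eventually_filtermap elim: eventually_mono)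
  have "u \<le> xi (filtermap (\<lambda>p. ?f p * ?h p) \<omega>)"
    using g \<omega>(1) by (intro le_xi_filtermap) (auto simp: ultrafilter_not_bot elim: eventually_mono)
  also have "\<dots> = xi (filtermap (\<lambda>(a, b). a * b) (filtermap (\<lambda>p. (?f p, ?h p)) \<omega>))"
    by (simp add: filtermap_filtermap)
  also have "\<dots> = xi (filtermap ?f \<omega>) * xi (filtermap ?h \<omega>)"
    using \<omega>(1) by (subst xi_mult) (simp_all add: UU_iff ultrafilter_filtermap filtermap_filtermap)
  also have "\<dots> \<le> Uext r \<sigma> ?\<nu> * Uext s ?\<nu> \<tau>"
    unfolding \<omega>(2,3)[symmetric] by (intro quantale_mult_mono xi_le_Uext)
  also have "\<dots> \<le> (SUP \<nu>\<in>UU B. Uext r \<sigma> \<nu> * Uext s \<nu> \<tau>)" using \<nu> by (rule SUP_upper)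
  finally show "u \<le> (SUP \<nu>\<in>UU B. Uext r \<sigma> \<nu> * Uext s \<nu> \<tau>)" .
qed

lemma Uext_rcomp:
  fixes r :: "'a \<Rightarrow> 'b \<Rightarrow> 'q" and s :: "'b \<Rightarrow> 'c \<Rightarrow> 'q"
  assumes "ultrafilter \<sigma>" "ultrafilter \<tau>"
  shows "Uext (rcomp B s r) \<sigma> \<tau> = rcomp (UU B) (Uext s) (Uext r) \<sigma> \<tau>"
  using Uext_rcomp_le[OF assms] Uext_mult_le
  by (auto simp: rcomp_def intro!: antisym SUP_least)

text \<open>Both sides are the supremum of \<open>Uext (Uext \<alpha>) \<Lambda> \<Theta> * Uext
  \<beta> \<Theta> \<tau>\<close> over all \<Theta> and all \<Lambda> with
  \<open>umult (umult \<Lambda>) = \<sigma>\<close>: the left one because the lifting respects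
  composition and fibres of \<open>umult\<close>, the right one by naturality. Associativity of the
  multiplication matches the indexings.\<close>

lemma Umop_kleisli:
  fixes \<alpha> :: "'a filter \<Rightarrow> 'b \<Rightarrow> 'q" and \<beta> :: "'b filter \<Rightarrow> 'c \<Rightarrow> 'q"
  assumes \<tau>: "ultrafilter \<tau>"
  shows "Umop A (kleisli A B \<beta> \<alpha>) \<sigma> \<tau> = rcomp (UU B) (Umop B \<beta>) (Umop A \<alpha>) \<sigma> \<tau>"
proof -
  have 1: "Uext (Umop A \<alpha>) \<Xi> \<Theta> = (SUP \<Lambda>\<in>{\<Lambda>\<in>UU (UU (UU A)). filtermap umult \<Lambda> = \<Xi>}. Uext (Uext \<alpha>) \<Lambda> \<Theta>)"
    if "\<Xi> \<in> UU (UU A)" "\<Theta> \<in> UU (UU B)" for \<Xi> \<Theta>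
    using Uext_SUP_fibre[OF UU_ultrafilter[OF that(1)] UU_ultrafilter[OF that(2)], where A="UU (UU A)" and f=umult and r="Uext \<alpha>"]
    by (simp add: Umop_eq[abs_def])
  have 2: "Uext (kleisli A B \<beta> \<alpha>) \<Xi> \<tau> = (SUP \<Theta>\<in>UU (UU B). Uext (Umop A \<alpha>) \<Xi> \<Theta> * Uext \<beta> \<Theta> \<tau>)"
    if "\<Xi> \<in> UU (UU A)" for \<Xi>
    using Uext_rcomp[OF UU_ultrafilter[OF that] \<tau>, of "UU B" \<beta> "Umop A \<alpha>"] by (simp add: kleisli_def rcomp_def)
  let ?L = "{\<Lambda>\<in>UU (UU (UU A)). umult (umult \<Lambda>) = \<sigma>}"
  show ?thesis
  proof (rule antisym)
    show "Umop A (kleisli A B \<beta> \<alpha>) \<sigma> \<tau> \<le> rcomp (UU B) (Umop B \<beta>) (Umop A \<alpha>) \<sigma> \<tau>"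
    proof (rule Umop_leI)
      fix \<Xi> assume \<Xi>: "\<Xi> \<in> UU (UU A)" "umult \<Xi> = \<sigma>"
      have "Uext (Uext \<alpha>) \<Lambda> \<Theta> * Uext \<beta> \<Theta> \<tau> \<le> Umop A \<alpha> \<sigma> (umult \<Theta>) * Umop B \<beta> (umult \<Theta>) \<tau>"
        if "\<Theta> \<in> UU (UU B)" "\<Lambda> \<in> UU (UU (UU A))" "filtermap umult \<Lambda> = \<Xi>" for \<Lambda> \<Theta>
      proof (rule quantale_mult_mono)
        have "Uext (Uext \<alpha>) \<Lambda> \<Theta> \<le> Uext \<alpha> (umult \<Lambda>) (umult \<Theta>)"
          using that by (subst Uext_umult_right[OF umult_UU[OF that(2)] that(1)]) (auto intro: SUP_upper)
        also have "\<dots> \<le> Umop A \<alpha> \<sigma> (umult \<Theta>)"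
          using Uext_le_Umop[OF umult_UU[OF that(2)], of \<alpha>] that(3) \<Xi>(2) umult_filtermap_umult[of \<Lambda>] by simp
        finally show "Uext (Uext \<alpha>) \<Lambda> \<Theta> \<le> Umop A \<alpha> \<sigma> (umult \<Theta>)" .
      qed (rule Uext_le_Umop[OF that(1)])
      also have "Umop A \<alpha> \<sigma> (umult \<Theta>) * Umop B \<beta> (umult \<Theta>) \<tau> \<le> rcomp (UU B) (Umop B \<beta>) (Umop A \<alpha>) \<sigma> \<tau>"
        if "\<Theta> \<in> UU (UU B)" for \<Theta>
        unfolding rcomp_def using umult_UU[OF that] by (rule SUP_upper)
      finally show "Uext (kleisli A B \<beta> \<alpha>) \<Xi> \<tau> \<le> rcomp (UU B) (Umop B \<beta>) (Umop A \<alpha>) \<sigma> \<tau>"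
        using \<Xi>(1) by (auto simp: 2 1 SUP_mult_distrib intro!: SUP_least)
    qed
  next
    have "Uext \<alpha> \<Xi> (umult \<Theta>) * Uext \<beta> \<Theta> \<tau> \<le> Umop A (kleisli A B \<beta> \<alpha>) \<sigma> \<tau>"
      if \<Theta>: "\<Theta> \<in> UU (UU B)" and \<Xi>: "\<Xi> \<in> UU (UU A)" "umult \<Xi> = \<sigma>" for \<Theta> \<Xi>
    proof -
      have "Uext (Uext \<alpha>) \<Lambda> \<Theta> * Uext \<beta> \<Theta> \<tau> \<le> Umop A (kleisli A B \<beta> \<alpha>) \<sigma> \<tau>"
        if \<Lambda>: "\<Lambda> \<in> UU (UU (UU A))" "umult \<Lambda> = \<Xi>" for \<Lambda>
      proof -
        have m: "filtermap umult \<Lambda> \<in> UU (UU A)" using \<Lambda>(1) umult_UU by (rule UU_filtermap)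
        have "Uext (Uext \<alpha>) \<Lambda> \<Theta> \<le> Uext (Umop A \<alpha>) (filtermap umult \<Lambda>) \<Theta>"
          unfolding 1[OF m \<Theta>] using \<Lambda>(1) by (auto intro: SUP_upper)
        then have "Uext (Uext \<alpha>) \<Lambda> \<Theta> * Uext \<beta> \<Theta> \<tau> \<le> Uext (kleisli A B \<beta> \<alpha>) (filtermap umult \<Lambda>) \<tau>"
          unfolding 2[OF m] using \<Theta> by (intro SUP_upper2[of \<Theta>] quantale_mult_mono) auto
        also have "\<dots> \<le> Umop A (kleisli A B \<beta> \<alpha>) \<sigma> \<tau>"
          using Uext_le_Umop[OF m] \<Lambda>(2) \<Xi>(2) by (metis umult_filtermap_umult)
        finally show ?thesis .
      qed
      then show ?thesis
        by (auto simp: Uext_umult_right[OF \<Xi>(1) \<Theta>] SUP_mult_distrib intro!: SUP_least)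
    qed
    then show "rcomp (UU B) (Umop B \<beta>) (Umop A \<alpha>) \<sigma> \<tau> \<le> Umop A (kleisli A B \<beta> \<alpha>) \<sigma> \<tau>"
      unfolding rcomp_def Umop_eq[of A \<alpha>] Umop_eq[of B \<beta>]
      by (auto simp: SUP_mult_distrib mult_SUP_distrib intro!: SUP_least)
  qed
qed

lemma kleisli_assoc:
  fixes \<alpha> :: "'a filter \<Rightarrow> 'b \<Rightarrow> 'q" and \<beta> :: "'b filter \<Rightarrow> 'c \<Rightarrow> 'q" and \<gamma> :: "'c filter \<Rightarrow> 'd \<Rightarrow> 'q"
  shows "kleisli A C \<gamma> (kleisli A B \<beta> \<alpha>) = kleisli A B (kleisli B C \<gamma> \<beta>) \<alpha>"
proof (intro ext)
  fix \<sigma> z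
  have "kleisli A C \<gamma> (kleisli A B \<beta> \<alpha>) \<sigma> z = (SUP \<tau>\<in>UU C. SUP \<upsilon>\<in>UU B. Umop A \<alpha> \<sigma> \<upsilon> * Umop B \<beta> \<upsilon> \<tau> * \<gamma> \<tau> z)"
    unfolding kleisli_eq[of A C] using Umop_kleisli[OF UU_ultrafilter, of _ C A B \<beta> \<alpha> \<sigma>]
    by (intro SUP_cong) (simp_all add: rcomp_def SUP_mult_distrib)
  also have "\<dots> = (SUP \<upsilon>\<in>UU B. SUP \<tau>\<in>UU C. Umop A \<alpha> \<sigma> \<upsilon> * (Umop B \<beta> \<upsilon> \<tau> * \<gamma> \<tau> z))"
    by (subst SUP_commute) (simp add: mult.assoc)
  also have "\<dots> = kleisli A B (kleisli B C \<gamma> \<beta>) \<alpha> \<sigma> z"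
    by (simp add: kleisli_eq mult_SUP_distrib)
  finally show "kleisli A C \<gamma> (kleisli A B \<beta> \<alpha>) \<sigma> z = kleisli A B (kleisli B C \<gamma> \<beta>) \<alpha> \<sigma> z" .
qed

text \<open>Tested against \<open>c\<close>, both sides bound the same threefold product by
  \<gamma>.\<close>

lemma kext_kleisli:
  fixes \<alpha> :: "'a filter \<Rightarrow> 'b \<Rightarrow> 'q" and \<beta> :: "'b filter \<Rightarrow> 'c \<Rightarrow> 'q" and \<gamma> :: "'a filter \<Rightarrow> 'd \<Rightarrow> 'q"
  assumes "\<tau> \<in> UU C"
  shows "kext A \<gamma> (kleisli A B \<beta> \<alpha>) \<tau> z = kext B (kext A \<gamma> \<alpha>) \<beta> \<tau> z"
proof -
  have "c \<le> kext A \<gamma> (kleisli A B \<beta> \<alpha>) \<tau> z \<longleftrightarrow> c \<le> kext B (kext A \<gamma> \<alpha>) \<beta> \<tau> z" for c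
  proof -
    have "c \<le> kext A \<gamma> (kleisli A B \<beta> \<alpha>) \<tau> z \<longleftrightarrow>
        (\<forall>\<sigma>\<in>UU A. \<forall>\<upsilon>\<in>UU B. Umop A \<alpha> \<sigma> \<upsilon> * (Umop B \<beta> \<upsilon> \<tau> * c) \<le> \<gamma> \<sigma> z)"
      by (simp add: kext_def le_INF_iff le_qhom_iff Umop_kleisli[OF UU_ultrafilter[OF assms]] rcomp_def
          SUP_mult_distrib SUP_le_iff mult.assoc)
    also have "\<dots> \<longleftrightarrow> c \<le> kext B (kext A \<gamma> \<alpha>) \<beta> \<tau> z"
      unfolding kext_def le_INF_iff le_qhom_iff by blast
    finally show ?thesis .
  qed
  then show ?thesis by (meson antisym order_refl)
qed

end


section \<open>Categories, functors and distributors\<close>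

lemma one_cat_simps [simp]: "Obj one_cat = UNIV" "Hom one_cat (principal {()}) () = 1"
  by (simp_all add: one_cat_def transp_def graph_def)

lemma kleisli_one: "kleisli A UNIV (Hom one_cat) \<alpha> \<sigma> () = Umop A \<alpha> \<sigma> (principal {()})"
  by (simp add: kleisli_eq UU_unit)

lemma uq_category_one: "uq_category (one_cat :: (unit, 'q::quantale) ucat)"
proof -
  have "umult \<Upsilon> = principal {()}" if "\<Upsilon> \<in> UU (UU (UNIV :: unit set))" for \<Upsilon>
    using umult_UU[OF that] by (simp add: UU_unit)
  then show ?thesis by (simp add: uq_category_def quantale_le_one)
qed

text \<open>Convolution joins the left sides of the transitivity inequalities over all
  decompositions of \<sigma>, so the axiom becomes \<open>X \<circ> X \<le> X\<close>.\<close>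

lemma uq_category_iff:
  "uq_category X \<longleftrightarrow> (\<forall>x\<in>Obj X. 1 \<le> Hom X (principal {x}) x) \<and>
     (\<forall>\<sigma>\<in>UU (Obj X). \<forall>x\<in>Obj X. kleisli (Obj X) (Obj X) (Hom X) (Hom X) \<sigma> x \<le> Hom X \<sigma> x)"
  (is "_ \<longleftrightarrow> ?R \<and> ?K")
proof -
  have "?K \<longleftrightarrow> (\<forall>\<Upsilon>\<in>UU (UU (Obj X)). \<forall>\<upsilon>\<in>UU (Obj X). \<forall>x\<in>Obj X.
        Uext (Hom X) \<Upsilon> \<upsilon> * Hom X \<upsilon> x \<le> Hom X (umult \<Upsilon>) x)" (is "_ \<longleftrightarrow> ?U")
  proof
    assume K: ?K
    show ?U
    proof (intro ballI)
      fix \<Upsilon> \<upsilon> x assume *: "\<Upsilon> \<in> UU (UU (Obj X))" "\<upsilon> \<in> UU (Obj X)" "x \<in> Obj X"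
      have "Uext (Hom X) \<Upsilon> \<upsilon> * Hom X \<upsilon> x \<le> Umop (Obj X) (Hom X) (umult \<Upsilon>) \<upsilon> * Hom X \<upsilon> x"
        by (intro quantale_mult_mono Uext_le_Umop *(1) order_refl)
      also have "\<dots> \<le> kleisli (Obj X) (Obj X) (Hom X) (Hom X) (umult \<Upsilon>) x"
        using *(2) by (rule le_kleisli)
      also have "\<dots> \<le> Hom X (umult \<Upsilon>) x" using K *(3) umult_UU[OF *(1)] by blast
      finally show "Uext (Hom X) \<Upsilon> \<upsilon> * Hom X \<upsilon> x \<le> Hom X (umult \<Upsilon>) x" .
    qed
  next
    assume U: ?U
    then show ?K
      by (auto simp: kleisli_eq Umop_eq SUP_mult_distrib intro!: SUP_least)
  qed
  then show ?thesis by (simp add: uq_category_def)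
qed

lemma Hom_refl: "uq_category X \<Longrightarrow> x \<in> Obj X \<Longrightarrow> Hom X (principal {x}) x = 1"
  by (auto simp: uq_category_iff intro: antisym quantale_le_one)

lemma kleisli_Hom_Hom_le:
  "uq_category X \<Longrightarrow> \<sigma> \<in> UU (Obj X) \<Longrightarrow> x \<in> Obj X \<Longrightarrow>
    kleisli (Obj X) (Obj X) (Hom X) (Hom X) \<sigma> x \<le> Hom X \<sigma> x"
  by (simp add: uq_category_iff)

lemma Umop_Hom_le:
  assumes "uq_category X" "\<sigma> \<in> UU (Obj X)" "\<upsilon> \<in> UU (Obj X)" "x \<in> Obj X"
  shows "Umop (Obj X) (Hom X) \<sigma> \<upsilon> * Hom X \<upsilon> x \<le> Hom X \<sigma> x"
  using le_kleisli[OF assms(3)] kleisli_Hom_Hom_le[OF assms(1,2,4)] by (rule order_trans)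

lemma one_le_Umop_Hom:
  assumes "uq_category X" "\<upsilon> \<in> UU (Obj X)"
  shows "1 \<le> Umop (Obj X) (Hom X) \<upsilon> \<upsilon>"
  using one_le_Umop[OF assms(2), of "\<lambda>x. x" "Obj X" "Hom X" "\<lambda>x. x"] Hom_refl[OF assms(1)]
  by (simp add: filtermap_ident)

lemma Hom_mono_right:
  assumes X: "uq_category X" and \<sigma>: "\<sigma> \<in> UU (Obj X)" and x: "x \<in> Obj X" "y \<in> Obj X" and "1 \<le> Hom X (principal {x}) y"
  shows "Hom X \<sigma> x \<le> Hom X \<sigma> y"
proof -
  have "Hom X \<sigma> x * 1 \<le> Umop (Obj X) (Hom X) \<sigma> (principal {x}) * Hom X (principal {x}) y"
    by (intro quantale_mult_mono le_Umop_principal assms)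
  also have "\<dots> \<le> Hom X \<sigma> y" by (intro Umop_Hom_le X \<sigma> x UU_principal)
  finally show ?thesis by simp
qed

text \<open>\<open>one_le_Umop\<close> lifts the comparison of \<open>f\<close> and \<open>g\<close>
  from points to \<sigma>, and transitivity composes it with the structure.\<close>

lemma Hom_mono_left:
  assumes X: "uq_category X" and \<sigma>: "\<sigma> \<in> UU A" and fg: "\<And>a. a \<in> A \<Longrightarrow> f a \<in> Obj X" "\<And>a. a \<in> A \<Longrightarrow> g a \<in> Obj X"
    and "\<And>a. a \<in> A \<Longrightarrow> 1 \<le> Hom X (principal {f a}) (g a)" and x: "x \<in> Obj X"
  shows "Hom X (filtermap g \<sigma>) x \<le> Hom X (filtermap f \<sigma>) x"
proof -
  have "1 * Hom X (filtermap g \<sigma>) x \<le>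
      Umop (Obj X) (Hom X) (filtermap f \<sigma>) (filtermap g \<sigma>) * Hom X (filtermap g \<sigma>) x"
    by (intro quantale_mult_mono one_le_Umop[OF \<sigma>] assms order_refl)
  also have "\<dots> \<le> Hom X (filtermap f \<sigma>) x"
    by (intro Umop_Hom_le X x UU_filtermap[OF \<sigma>] fg)
  finally show ?thesis by simp
qed

lemma le_kleisli_Hom_right:
  assumes "uq_category X" "\<sigma> \<in> UU (Obj X)"
  shows "\<alpha> \<sigma> z \<le> kleisli (Obj X) (Obj X) \<alpha> (Hom X) \<sigma> z"
proof -
  have "1 * \<alpha> \<sigma> z \<le> Umop (Obj X) (Hom X) \<sigma> \<sigma> * \<alpha> \<sigma> z"
    by (intro quantale_mult_mono one_le_Umop_Hom assms order_refl)
  also have "\<dots> \<le> kleisli (Obj X) (Obj X) \<alpha> (Hom X) \<sigma> z" using assms(2) by (rule le_kleisli)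
  finally show ?thesis by simp
qed

lemma le_kleisli_Hom_left:
  assumes "uq_category Y" "\<sigma> \<in> UU A" "y \<in> Obj Y"
  shows "\<phi> \<sigma> y \<le> kleisli A (Obj Y) (Hom Y) \<phi> \<sigma> y"
proof -
  have "\<phi> \<sigma> y * 1 \<le> Umop A \<phi> \<sigma> (principal {y}) * Hom Y (principal {y}) y"
    using Hom_refl[OF assms(1,3)] by (intro quantale_mult_mono le_Umop_principal[OF assms(2)]) simp
  also have "\<dots> \<le> kleisli A (Obj Y) (Hom Y) \<phi> \<sigma> y" using assms(3) by (intro le_kleisli UU_principal)
  finally show ?thesis by simp
qed

lemma distributorI:
  assumes "uq_category X" "uq_category Y"
    "\<And>\<sigma> y. \<sigma> \<in> UU (Obj X) \<Longrightarrow> y \<in> Obj Y \<Longrightarrow> kleisli (Obj X) (Obj X) \<phi> (Hom X) \<sigma> y \<le> \<phi> \<sigma> y"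
    "\<And>\<sigma> y. \<sigma> \<in> UU (Obj X) \<Longrightarrow> y \<in> Obj Y \<Longrightarrow> kleisli (Obj X) (Obj Y) (Hom Y) \<phi> \<sigma> y \<le> \<phi> \<sigma> y"
  shows "distributor X \<phi> Y"
  using assms le_kleisli_Hom_left le_kleisli_Hom_right
  unfolding distributor_def rel_eq_def by (intro conjI ballI antisym)

lemma distributor_right:
  "distributor X \<phi> Y \<Longrightarrow> \<sigma> \<in> UU (Obj X) \<Longrightarrow> y \<in> Obj Y \<Longrightarrow> kleisli (Obj X) (Obj X) \<phi> (Hom X) \<sigma> y = \<phi> \<sigma> y"
  by (simp add: distributor_def rel_eq_def)

lemma distributor_left:
  "distributor X \<phi> Y \<Longrightarrow> \<sigma> \<in> UU (Obj X) \<Longrightarrow> y \<in> Obj Y \<Longrightarrow> kleisli (Obj X) (Obj Y) (Hom Y) \<phi> \<sigma> y = \<phi> \<sigma> y"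
  by (simp add: distributor_def rel_eq_def)

lemma distributor_cong:
  assumes \<phi>: "distributor X \<phi> Y" and eq: "\<And>\<sigma> y. \<sigma> \<in> UU (Obj X) \<Longrightarrow> y \<in> Obj Y \<Longrightarrow> \<phi> \<sigma> y = \<phi>' \<sigma> y"
  shows "distributor X \<phi>' Y"
  unfolding distributor_def rel_eq_def
proof (intro conjI ballI)
  fix \<sigma> y assume *: "\<sigma> \<in> UU (Obj X)" "y \<in> Obj Y"
  show "kleisli (Obj X) (Obj X) \<phi>' (Hom X) \<sigma> y = \<phi>' \<sigma> y"
    unfolding eq[OF *, symmetric] distributor_right[OF \<phi> *, symmetric]
    by (rule kleisli_cong) (simp_all add: eq *)
  show "kleisli (Obj X) (Obj Y) (Hom Y) \<phi>' \<sigma> y = \<phi>' \<sigma> y"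
    unfolding eq[OF *, symmetric] distributor_left[OF \<phi> *, symmetric]
    by (rule kleisli_cong) (simp_all add: eq *)
qed

text \<open>Over the one-point category the left law reads off \<open>Umop\<close> at
  \<open>principal {y}\<close>, where reflexivity of \<open>Y\<close> at \<open>y\<close> leaves
  only \<phi>.\<close>

lemma distributor_point:
  assumes Y: "uq_category Y" and \<phi>: "distributor X \<phi> Y" and y: "y \<in> Obj Y"
  shows "distributor X (\<lambda>\<sigma> _. \<phi> \<sigma> y) one_cat"
  unfolding distributor_def rel_eq_def
proof (intro conjI ballI)
  fix \<sigma> and z :: unit assume \<sigma>: "\<sigma> \<in> UU (Obj X)"
  have "kleisli (Obj X) (Obj X) (\<lambda>\<sigma> _. \<phi> \<sigma> y) (Hom X) \<sigma> z = kleisli (Obj X) (Obj X) \<phi> (Hom X) \<sigma> y"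
    by (rule kleisli_cong) simp_all
  then show "kleisli (Obj X) (Obj X) (\<lambda>\<sigma> _. \<phi> \<sigma> y) (Hom X) \<sigma> z = \<phi> \<sigma> y"
    using distributor_right[OF \<phi> \<sigma> y] by simp
  have "Umop (Obj X) (\<lambda>\<sigma> _. \<phi> \<sigma> y) \<sigma> (principal {()}) = Umop (Obj X) \<phi> \<sigma> (principal {y})"
    using Umop_filtermap[of "Obj X" \<phi> \<sigma> "\<lambda>_. y" "principal {()}"] by (simp add: filtermap_principal)
  also have "\<dots> = \<phi> \<sigma> y"
  proof (rule antisym[OF _ le_Umop_principal[OF \<sigma>]])
    have "Umop (Obj X) \<phi> \<sigma> (principal {y}) * Hom Y (principal {y}) y \<le> kleisli (Obj X) (Obj Y) (Hom Y) \<phi> \<sigma> y"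
      using y by (intro le_kleisli UU_principal)
    then show "Umop (Obj X) \<phi> \<sigma> (principal {y}) \<le> \<phi> \<sigma> y"
      using distributor_left[OF \<phi> \<sigma> y] Hom_refl[OF Y y] by simp
  qed
  finally show "kleisli (Obj X) (Obj one_cat) (Hom one_cat) (\<lambda>\<sigma> _. \<phi> \<sigma> y) \<sigma> z = \<phi> \<sigma> y"
    by (simp add: kleisli_one)
qed

text \<open>The infimum evaluated at \<upsilon> itself gives \<open>\<le>\<close>, the adjunction
  gives \<open>\<ge>\<close>. Only the column \<open>z\<close> is constrained, so that a single
  presheaf can take the place of \<gamma>.\<close>

lemma kext_Hom:
  assumes X: "uq_category X" and \<upsilon>: "\<upsilon> \<in> UU (Obj X)"
    and \<gamma>: "\<And>\<sigma>. \<sigma> \<in> UU (Obj X) \<Longrightarrow> kleisli (Obj X) (Obj X) \<gamma> (Hom X) \<sigma> z \<le> \<gamma> \<sigma> z"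
  shows "kext (Obj X) \<gamma> (Hom X) \<upsilon> z = \<gamma> \<upsilon> z"
proof (rule antisym)
  let ?k = "kext (Obj X) \<gamma> (Hom X) \<upsilon> z"
  have "1 * ?k \<le> Umop (Obj X) (Hom X) \<upsilon> \<upsilon> * qhom (Umop (Obj X) (Hom X) \<upsilon> \<upsilon>) (\<gamma> \<upsilon> z)"
    unfolding kext_def by (intro quantale_mult_mono one_le_Umop_Hom INF_lower X \<upsilon>)
  also have "\<dots> \<le> \<gamma> \<upsilon> z" by (simp flip: le_qhom_iff)
  finally show "?k \<le> \<gamma> \<upsilon> z" by simp
next
  have "\<forall>\<upsilon>\<in>UU (Obj X). \<gamma> \<upsilon> z \<le> kext (Obj X) \<gamma> (Hom X) \<upsilon> z"
    unfolding kleisli_kext_iff[symmetric] using \<gamma> by blast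
  with \<upsilon> show "\<gamma> \<upsilon> z \<le> kext (Obj X) \<gamma> (Hom X) \<upsilon> z" by blast
qed

lemma kleisli_upper_star_le:
  assumes f: "uq_functor X f Y" and x: "x \<in> Obj X"
  shows "kleisli B (Obj X) (Hom X) (\<lambda>\<sigma> x. \<phi> \<sigma> (f x)) \<sigma> x \<le> kleisli B (Obj Y) (Hom Y) \<phi> \<sigma> (f x)"
proof -
  have fX: "f a \<in> Obj Y" if "a \<in> Obj X" for a using f that by (auto simp: uq_functor_def)
  have "Umop B \<phi> \<sigma> (filtermap f \<upsilon>) * Hom X \<upsilon> x \<le> kleisli B (Obj Y) (Hom Y) \<phi> \<sigma> (f x)"
    if \<upsilon>: "\<upsilon> \<in> UU (Obj X)" for \<upsilon>
  proof -
    have "Umop B \<phi> \<sigma> (filtermap f \<upsilon>) * Hom X \<upsilon> x \<le> Umop B \<phi> \<sigma> (filtermap f \<upsilon>) * Hom Y (filtermap f \<upsilon>) (f x)"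
      using f \<upsilon> x by (intro quantale_mult_mono) (auto simp: uq_functor_def)
    also have "\<dots> \<le> kleisli B (Obj Y) (Hom Y) \<phi> \<sigma> (f x)"
      by (intro le_kleisli UU_filtermap[OF \<upsilon>] fX)
    finally show ?thesis .
  qed
  then show ?thesis unfolding kleisli_eq[of B "Obj X"] Umop_filtermap[symmetric] by (intro SUP_least)
qed

lemma distributor_upper_star:
  assumes X: "uq_category X" and Y: "uq_category Y" and f: "uq_functor X f Y"
  shows "distributor Y (upper_star Y f) X"
proof (rule distributorI[OF Y X])
  fix \<sigma> x assume \<sigma>: "\<sigma> \<in> UU (Obj Y)" and x: "x \<in> Obj X"
  then have fx: "f x \<in> Obj Y" using f by (auto simp: uq_functor_def)
  have "kleisli (Obj Y) (Obj Y) (upper_star Y f) (Hom Y) \<sigma> x = kleisli (Obj Y) (Obj Y) (Hom Y) (Hom Y) \<sigma> (f x)"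
    by (rule kleisli_cong) (simp_all add: upper_star_def)
  then show "kleisli (Obj Y) (Obj Y) (upper_star Y f) (Hom Y) \<sigma> x \<le> upper_star Y f \<sigma> x"
    using kleisli_Hom_Hom_le[OF Y \<sigma> fx] by (simp add: upper_star_def)
  show "kleisli (Obj Y) (Obj X) (Hom X) (upper_star Y f) \<sigma> x \<le> upper_star Y f \<sigma> x"
    using kleisli_upper_star_le[OF f x, of "Obj Y" "Hom Y" \<sigma>] kleisli_Hom_Hom_le[OF Y \<sigma> fx]
    by (simp add: upper_star_def[abs_def])
qed

lemma uq_functorD:
  assumes "uq_functor X f Y"
  shows "x \<in> Obj X \<Longrightarrow> f x \<in> Obj Y"
    and "\<upsilon> \<in> UU (Obj X) \<Longrightarrow> x \<in> Obj X \<Longrightarrow> Hom X \<upsilon> x \<le> Hom Y (filtermap f \<upsilon>) (f x)"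
  using assms by (auto simp: uq_functor_def)

text \<open>Unit and counit are inequalities at points; the unit reaches the ultrafilter \<sigma>
  through \<open>Hom_mono_left\<close>.\<close>

lemma adjoint_Hom_eq:
  assumes X: "uq_category X" and Y: "uq_category Y" and adj: "adjoint X f Y g"
    and \<sigma>: "\<sigma> \<in> UU (Obj X)" and y: "y \<in> Obj Y"
  shows "Hom Y (filtermap f \<sigma>) y = Hom X \<sigma> (g y)"
proof (rule antisym)
  have f: "uq_functor X f Y" and g: "uq_functor Y g X"
    and unit: "\<And>x. x \<in> Obj X \<Longrightarrow> 1 \<le> Hom X (principal {x}) (g (f x))"
    and counit: "\<And>y. y \<in> Obj Y \<Longrightarrow> 1 \<le> Hom Y (principal {f (g y)}) y"
    using adj by (auto simp: adjoint_def functor_le_def)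
  have f\<sigma>: "filtermap f \<sigma> \<in> UU (Obj Y)" using \<sigma> uq_functorD(1)[OF f] by (rule UU_filtermap)
  have gy: "g y \<in> Obj X" using g y by (rule uq_functorD(1))
  have fX: "f x \<in> Obj Y" if "x \<in> Obj X" for x using uq_functorD(1)[OF f that] .
  have gY: "g z \<in> Obj X" if "z \<in> Obj Y" for z using uq_functorD(1)[OF g that] .
  have "Hom Y (filtermap f \<sigma>) y \<le> Hom X (filtermap g (filtermap f \<sigma>)) (g y)"
    using uq_functorD(2)[OF g f\<sigma> y] .
  also have "\<dots> = Hom X (filtermap (\<lambda>x. g (f x)) \<sigma>) (g y)" by (simp add: filtermap_filtermap)
  also have "\<dots> \<le> Hom X (filtermap (\<lambda>x. x) \<sigma>) (g y)"
    by (rule Hom_mono_left[OF X \<sigma>]) (simp_all add: fX gY unit gy)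
  finally show "Hom Y (filtermap f \<sigma>) y \<le> Hom X \<sigma> (g y)" by (simp add: filtermap_ident)
  have "Hom X \<sigma> (g y) \<le> Hom Y (filtermap f \<sigma>) (f (g y))" using uq_functorD(2)[OF f \<sigma> gy] .
  also have "\<dots> \<le> Hom Y (filtermap f \<sigma>) y"
    by (rule Hom_mono_right[OF Y f\<sigma>]) (simp_all add: fX gY y counit)
  finally show "Hom X \<sigma> (g y) \<le> Hom Y (filtermap f \<sigma>) y" .
qed

lemma adjointI:
  assumes X: "uq_category X" and Y: "uq_category Y" and f: "uq_functor X f Y" and g: "uq_functor Y g X"
    and eq: "\<And>\<sigma> y. \<sigma> \<in> UU (Obj X) \<Longrightarrow> y \<in> Obj Y \<Longrightarrow> Hom Y (filtermap f \<sigma>) y = Hom X \<sigma> (g y)"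
  shows "adjoint X f Y g"
  unfolding adjoint_def functor_le_def
proof (intro conjI ballI f g)
  fix x assume x: "x \<in> Obj X"
  have fx: "f x \<in> Obj Y" using uq_functorD(1)[OF f x] .
  show "1 \<le> Hom X (principal {x}) ((g \<circ> f) x)"
    using eq[OF UU_principal[OF x] fx] Hom_refl[OF Y fx] by (simp add: filtermap_principal)
next
  fix y assume y: "y \<in> Obj Y"
  have gy: "g y \<in> Obj X" using uq_functorD(1)[OF g y] .
  show "1 \<le> Hom Y (principal {(f \<circ> g) y}) y"
    using eq[OF UU_principal[OF gy] y] Hom_refl[OF X gy] by (simp add: filtermap_principal)
qed

context multiplicative_xi
begin

lemma distributor_kleisli:
  fixes \<phi> :: "'a filter \<Rightarrow> 'b \<Rightarrow> 'q" and \<psi> :: "'b filter \<Rightarrow> 'c \<Rightarrow> 'q"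
  assumes \<phi>: "distributor X \<phi> Y" and \<psi>: "distributor Y \<psi> Z"
  shows "distributor X (kleisli (Obj X) (Obj Y) \<psi> \<phi>) Z"
  unfolding distributor_def rel_eq_def
proof (intro conjI ballI)
  fix \<sigma> z assume *: "\<sigma> \<in> UU (Obj X)" "z \<in> Obj Z"
  show "kleisli (Obj X) (Obj X) (kleisli (Obj X) (Obj Y) \<psi> \<phi>) (Hom X) \<sigma> z = kleisli (Obj X) (Obj Y) \<psi> \<phi> \<sigma> z"
    unfolding kleisli_assoc[symmetric] by (rule kleisli_cong) (simp_all add: distributor_right[OF \<phi>])
  show "kleisli (Obj X) (Obj Z) (Hom Z) (kleisli (Obj X) (Obj Y) \<psi> \<phi>) \<sigma> z = kleisli (Obj X) (Obj Y) \<psi> \<phi> \<sigma> z"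
    unfolding kleisli_assoc by (rule kleisli_cong) (simp_all add: distributor_left[OF \<psi>] *)
qed

end


section \<open>Presheaves\<close>

text \<open>As a relation from \<open>X\<close> to \<open>J_cat J X\<close> this is \<open>y\<^sub>*\<close>, and \<open>Hom (J_cat J X)\<close> is \<open>y\<^sub>* \<circ>- y\<^sub>*\<close>.\<close>

abbreviation (input) eval_rel :: "'a filter \<Rightarrow> ('a filter \<Rightarrow> 'q) \<Rightarrow> 'q" where
  "eval_rel \<equiv> \<lambda>\<nu> \<chi>. \<chi> \<nu>"

text \<open>Each \<omega> over \<rho> is a coupling of \<rho> with its first projection \<Xi>.
  Grouping the infimum by \<Xi> and then by \<open>umult \<Xi>\<close>, the values of
  \<open>xi\<close> join to \<open>Uext\<close> and then to \<open>Umop\<close> of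
  evaluation.\<close>

lemma Hom_exp_cat:
  assumes \<rho>: "\<rho> \<in> UU (Obj (exp_cat X))"
  shows "Hom (exp_cat X) \<rho> \<psi> = kext (Obj X) eval_rel eval_rel \<rho> \<psi>"
proof -
  define P where "P = Obj (exp_cat X)"
  let ?W = "\<lambda>\<Xi>. {\<omega> \<in> UU (UU (Obj X) \<times> P). filtermap fst \<omega> = \<Xi> \<and> filtermap snd \<omega> = \<rho>}"
  let ?x = "\<lambda>\<omega>. xi (filtermap (\<lambda>(\<nu>, \<chi>). \<chi> \<nu>) \<omega>)"
  have eq: "Hom (exp_cat X) \<rho> \<psi> = (INF \<omega>\<in>{\<omega> \<in> UU (UU (Obj X) \<times> P). filtermap snd \<omega> = \<rho>}.
        qhom (?x \<omega>) (\<psi> (umult (filtermap fst \<omega>))))"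
    by (simp add: exp_cat_def Let_def P_def)
  show ?thesis
  proof (rule antisym)
    show "Hom (exp_cat X) \<rho> \<psi> \<le> kext (Obj X) eval_rel eval_rel \<rho> \<psi>"
      unfolding kext_def
    proof (rule INF_greatest, unfold le_qhom_iff)
      fix \<nu> assume "\<nu> \<in> UU (Obj X)"
      have "Uext eval_rel \<Xi> \<rho> * Hom (exp_cat X) \<rho> \<psi> \<le> \<psi> \<nu>" if \<Xi>: "\<Xi> \<in> UU (UU (Obj X))" "umult \<Xi> = \<nu>" for \<Xi>
      proof -
        have "Uext eval_rel \<Xi> \<rho> * Hom (exp_cat X) \<rho> \<psi> \<le> (SUP \<omega>\<in>?W \<Xi>. ?x \<omega>) * Hom (exp_cat X) \<rho> \<psi>"
          using Uext_le_SUP_xi[OF \<Xi>(1) \<rho>[folded P_def], of eval_rel]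
          by (intro quantale_mult_mono) simp_all
        also have "\<dots> \<le> \<psi> \<nu>"
          unfolding SUP_mult_distrib le_qhom_iff[symmetric] eq
        proof (rule SUP_least, unfold le_qhom_iff[symmetric])
          fix \<omega> assume "\<omega> \<in> ?W \<Xi>"
          then show "(INF \<omega>\<in>{\<omega> \<in> UU (UU (Obj X) \<times> P). filtermap snd \<omega> = \<rho>}.
              qhom (?x \<omega>) (\<psi> (umult (filtermap fst \<omega>)))) \<le> qhom (?x \<omega>) (\<psi> \<nu>)"
            using \<Xi>(2) by (intro INF_lower2[of \<omega>]) auto
        qed
        finally show ?thesis .
      qed
      then show "Umop (Obj X) eval_rel \<nu> \<rho> * Hom (exp_cat X) \<rho> \<psi> \<le> \<psi> \<nu>"
        by (auto simp: Umop_eq SUP_mult_distrib intro!: SUP_least)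
    qed
  next
    show "kext (Obj X) eval_rel eval_rel \<rho> \<psi> \<le> Hom (exp_cat X) \<rho> \<psi>"
      unfolding eq
    proof (rule INF_greatest)
      fix \<omega> assume "\<omega> \<in> {\<omega> \<in> UU (UU (Obj X) \<times> P). filtermap snd \<omega> = \<rho>}"
      then have \<omega>: "\<omega> \<in> UU (UU (Obj X) \<times> P)" "filtermap snd \<omega> = \<rho>" by auto
      let ?\<Xi> = "filtermap fst \<omega>"
      have \<Xi>: "?\<Xi> \<in> UU (UU (Obj X))" by (rule UU_filtermap[OF \<omega>(1)]) auto
      have "?x \<omega> \<le> Uext eval_rel ?\<Xi> \<rho>"
        using xi_le_Uext[of eval_rel fst snd \<omega>] \<omega>(2) by (simp add: case_prod_beta')
      also have "\<dots> \<le> Umop (Obj X) eval_rel (umult ?\<Xi>) \<rho>" using \<Xi> by (rule Uext_le_Umop)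
      finally have "qhom (Umop (Obj X) eval_rel (umult ?\<Xi>) \<rho>) (\<psi> (umult ?\<Xi>)) \<le> qhom (?x \<omega>) (\<psi> (umult ?\<Xi>))"
        by (rule qhom_antimono)
      then show "kext (Obj X) eval_rel eval_rel \<rho> \<psi> \<le> qhom (?x \<omega>) (\<psi> (umult ?\<Xi>))"
        unfolding kext_def using umult_UU[OF \<Xi>] by (intro INF_lower2)
    qed
  qed
qed

lemma Umop_eval_rel_principal:
  assumes "distributor X (to_one \<chi>) one_cat" "\<nu> \<in> UU (Obj X)"
  shows "Umop (Obj X) eval_rel \<nu> (principal {\<chi>}) = \<chi> \<nu>"
proof -
  have "Umop (Obj X) eval_rel \<nu> (principal {\<chi>}) = Umop (Obj X) (to_one \<chi>) \<nu> (principal {()})"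
    using Umop_filtermap[of "Obj X" eval_rel \<nu> "\<lambda>_. \<chi>" "principal {()}"]
    by (simp add: filtermap_principal to_one_def)
  also have "\<dots> = kleisli (Obj X) UNIV (Hom one_cat) (to_one \<chi>) \<nu> ()" by (simp add: kleisli_one)
  also have "\<dots> = \<chi> \<nu>" using distributor_left[OF assms(1,2)] by (simp add: to_one_def)
  finally show ?thesis .
qed

text \<open>Discharges the functor clause of \<open>exp_cat\<close>, so that objects of
  \<open>J_cat\<close> are just extensional distributors in the class. A constant map sends \<Xi> to
  \<open>principal {\<psi>}\<close>, which reduces the clause to the left law of \<psi>.\<close>

lemma uq_functor_disc_Q_cat:
  assumes \<psi>: "distributor X (to_one \<psi>) one_cat"
  shows "uq_functor (disc_cat X) \<psi> Q_cat"
proof -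
  have "xi (filtermap \<psi> \<Xi>) \<le> \<psi> (umult \<Xi>)" if \<Xi>: "\<Xi> \<in> UU (UU (Obj X))" for \<Xi>
  proof -
    have "filtermap (\<lambda>_. \<psi>) \<Xi> = principal {\<psi>}"
    proof (rule ultrafilter_le_eq[OF ultrafilter_principal])
      show "filtermap (\<lambda>_. \<psi>) \<Xi> \<le> principal {\<psi>}" by (simp add: le_principal eventually_filtermap)
    qed (simp add: filtermap_bot_iff ultrafilter_not_bot[OF UU_ultrafilter[OF \<Xi>]])
    then have "xi (filtermap \<psi> \<Xi>) \<le> Uext eval_rel \<Xi> (principal {\<psi>})"
      using xi_le_Uext[of eval_rel "\<lambda>x. x" "\<lambda>_. \<psi>" \<Xi>] by (simp add: filtermap_ident)
    also have "\<dots> \<le> Umop (Obj X) eval_rel (umult \<Xi>) (principal {\<psi>})" using \<Xi> by (rule Uext_le_Umop)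
    also have "\<dots> = \<psi> (umult \<Xi>)" using \<psi> umult_UU[OF \<Xi>] by (rule Umop_eval_rel_principal)
    finally show ?thesis .
  qed
  then show ?thesis by (auto simp: uq_functor_def disc_cat_def Q_cat_def graph_def le_qhom_iff mult.commute[of _ bot])
qed

lemma J_cat_iff:
  "\<psi> \<in> Obj (J_cat J X) \<longleftrightarrow> \<psi> \<in> extensional (UU (Obj X)) \<and> distributor X (to_one \<psi>) one_cat \<and>
     in_class J X (to_one \<psi>) one_cat"
  using uq_functor_disc_Q_cat[of X \<psi>]
  by (auto simp: J_cat_def hat_def full_sub_def exp_cat_def Let_def PiE_def)

lemma Hom_hat_eq: "Hom (hat X) = Hom (J_cat J X)"
  by (simp add: J_cat_def hat_def full_sub_def)

lemma Hom_J_cat: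
  assumes "\<rho> \<in> UU (Obj (J_cat J X))"
  shows "Hom (J_cat J X) \<rho> \<psi> = kext (Obj X) eval_rel eval_rel \<rho> \<psi>"
proof -
  have "Obj (J_cat J X) \<subseteq> Obj (exp_cat X)" by (auto simp: J_cat_def hat_def full_sub_def)
  then have "\<rho> \<in> UU (Obj (exp_cat X))" using assms UU_mono by blast
  from Hom_exp_cat[OF this] show ?thesis by (simp add: J_cat_def hat_def full_sub_def)
qed

lemma kleisli_J_cat_le:
  assumes "\<sigma> \<in> UU (Obj X)"
  shows "kleisli (Obj X) (Obj (J_cat J X)) (Hom (J_cat J X)) eval_rel \<sigma> \<psi> \<le> \<psi> \<sigma>"
proof -
  have "\<forall>\<sigma>\<in>UU (Obj X). kleisli (Obj X) (Obj (J_cat J X)) (Hom (J_cat J X)) eval_rel \<sigma> \<psi> \<le> eval_rel \<sigma> \<psi>"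
    by (rule iffD2[OF kleisli_kext_iff[where \<gamma>=eval_rel and z'=\<psi>]]) (simp add: Hom_J_cat)
  with assms show ?thesis by blast
qed

lemma Hom_J_cat_refl:
  assumes "\<chi> \<in> Obj (J_cat J X)"
  shows "1 \<le> Hom (J_cat J X) (principal {\<chi>}) \<chi>"
proof -
  have "distributor X (to_one \<chi>) one_cat" using assms by (simp add: J_cat_iff)
  then show ?thesis
    unfolding Hom_J_cat[OF UU_principal[OF assms]] kext_def
    by (intro INF_greatest) (simp add: le_qhom_iff Umop_eval_rel_principal)
qed

text \<open>The left law for \<open>y\<^sub>*\<close>: one half is the adjunction applied to
  \<open>y\<^sub>* \<circ>- y\<^sub>*\<close>, the other reflexivity at \<psi>. It later turns
  \<open>T\<^sup>* \<circ> y\<^sub>*\<close> into \<open>v\<close>.\<close>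

lemma kleisli_J_cat:
  assumes \<sigma>: "\<sigma> \<in> UU (Obj X)" and \<psi>: "\<psi> \<in> Obj (J_cat J X)"
  shows "kleisli (Obj X) (Obj (J_cat J X)) (Hom (J_cat J X)) eval_rel \<sigma> \<psi> = \<psi> \<sigma>"
proof (rule antisym[OF kleisli_J_cat_le[OF \<sigma>]])
  have "\<psi> \<sigma> * 1 \<le> Umop (Obj X) eval_rel \<sigma> (principal {\<psi>}) * Hom (J_cat J X) (principal {\<psi>}) \<psi>"
    by (intro quantale_mult_mono le_Umop_principal[OF \<sigma>] Hom_J_cat_refl[OF \<psi>])
  also have "\<dots> \<le> kleisli (Obj X) (Obj (J_cat J X)) (Hom (J_cat J X)) eval_rel \<sigma> \<psi>"
    by (intro le_kleisli UU_principal \<psi>)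
  finally show "\<psi> \<sigma> \<le> kleisli (Obj X) (Obj (J_cat J X)) (Hom (J_cat J X)) eval_rel \<sigma> \<psi>" by simp
qed

lemma Hom_J_cat_le:
  assumes "1 \<le> Hom (J_cat J X) (principal {\<chi>}) \<psi>" "\<chi> \<in> Obj (J_cat J X)" "\<sigma> \<in> UU (Obj X)"
  shows "\<chi> \<sigma> \<le> \<psi> \<sigma>"
proof -
  have "1 \<le> qhom (Umop (Obj X) eval_rel \<sigma> (principal {\<chi>})) (\<psi> \<sigma>)"
    using assms(1) unfolding Hom_J_cat[OF UU_principal[OF assms(2)]] kext_def
    using assms(3) by (simp add: le_INF_iff)
  then show ?thesis
    using assms(2,3) by (simp add: le_qhom_iff Umop_eval_rel_principal J_cat_iff)
qed

text \<open>An extension of a relation along itself is transitive: acting with it twice on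
  evaluation stays below evaluation, and the adjunction turns this into the claim.\<close>

lemma (in multiplicative_xi) uq_category_J_cat:
  fixes X :: "('a, 'q) ucat"
  shows "uq_category (J_cat J X)"
  unfolding uq_category_iff
proof (intro conjI ballI Hom_J_cat_refl)
  fix \<rho> \<chi> assume \<rho>: "\<rho> \<in> UU (Obj (J_cat J X))"
  let ?A = "Obj X" and ?B = "Obj (J_cat J X)" and ?P = "Hom (J_cat J X)"
  have "\<forall>\<sigma>\<in>UU ?A. kleisli ?A ?B (kleisli ?B ?B ?P ?P) eval_rel \<sigma> \<chi> \<le> eval_rel \<sigma> \<chi>"
  proof
    fix \<sigma> assume \<sigma>: "\<sigma> \<in> UU ?A"
    have "kleisli ?A ?B (kleisli ?B ?B ?P ?P) eval_rel \<sigma> \<chi> = kleisli ?A ?B ?P (kleisli ?A ?B ?P eval_rel) \<sigma> \<chi>"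
      by (simp add: kleisli_assoc)
    also have "\<dots> \<le> kleisli ?A ?B ?P eval_rel \<sigma> \<chi>"
      by (rule kleisli_mono) (simp_all add: kleisli_J_cat_le)
    also have "\<dots> \<le> \<chi> \<sigma>" by (rule kleisli_J_cat_le[OF \<sigma>])
    finally show "kleisli ?A ?B (kleisli ?B ?B ?P ?P) eval_rel \<sigma> \<chi> \<le> \<chi> \<sigma>" .
  qed
  from iffD1[OF kleisli_kext_iff[where \<gamma>=eval_rel and z'=\<chi>] this]
  show "kleisli ?B ?B ?P ?P \<rho> \<chi> \<le> ?P \<rho> \<chi>" using \<rho> by (simp add: Hom_J_cat)
qed

lemma transpose_dist_eval: "\<nu> \<in> UU (Obj X) \<Longrightarrow> transpose_dist X \<phi> y \<nu> = \<phi> \<nu> y"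
  by (simp add: transpose_dist_def)

lemma transpose_dist_J_cat:
  assumes "distributor X (\<lambda>\<sigma> _. \<phi> \<sigma> y) one_cat" "in_class J X (to_one (transpose_dist X \<phi> y)) one_cat"
  shows "transpose_dist X \<phi> y \<in> Obj (J_cat J X)"
  unfolding J_cat_iff
proof (intro conjI assms(2))
  show "distributor X (to_one (transpose_dist X \<phi> y)) one_cat"
    by (rule distributor_cong[OF assms(1)]) (simp add: to_one_def transpose_dist_eval)
qed (simp add: transpose_dist_def)

text \<open>Kept general in \<phi>, since it is applied to the structure of \<open>X\<close>, to
  \<open>v\<close>, and to \<open>\<psi> \<circ> v\<close> as a distributor into a point.\<close>

lemma Hom_transpose_dist:
  assumes \<sigma>: "\<sigma> \<in> UU B" and "\<And>y. y \<in> B \<Longrightarrow> transpose_dist X \<phi> y \<in> Obj (J_cat J X)"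
  shows "Hom (J_cat J X) (filtermap (transpose_dist X \<phi>) \<sigma>) \<psi> = kext (Obj X) eval_rel \<phi> \<sigma> \<psi>"
proof -
  have "filtermap (transpose_dist X \<phi>) \<sigma> \<in> UU (Obj (J_cat J X))"
    using \<sigma> assms(2) by (rule UU_filtermap)
  then have "Hom (J_cat J X) (filtermap (transpose_dist X \<phi>) \<sigma>) \<psi> =
      kext (Obj X) eval_rel (\<lambda>\<nu> y. transpose_dist X \<phi> y \<nu>) \<sigma> \<psi>"
    by (simp add: Hom_J_cat kext_filtermap)
  also have "\<dots> = kext (Obj X) eval_rel \<phi> \<sigma> \<psi>"
    by (rule kext_cong[OF \<sigma>, where \<gamma>=eval_rel and \<gamma>'=eval_rel and z=\<psi> and z'=\<psi>])
      (simp_all add: transpose_dist_eval)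
  finally show ?thesis .
qed

text \<open>The Yoneda lemma for ultrafilters: \<psi> is its own extension along the identity
  distributor.\<close>

lemma Hom_yoneda:
  assumes X: "uq_category X" and \<sigma>: "\<sigma> \<in> UU (Obj X)" and \<psi>: "\<psi> \<in> Obj (J_cat J X)"
    and "\<And>x. x \<in> Obj X \<Longrightarrow> yoneda X x \<in> Obj (J_cat J X)"
  shows "Hom (J_cat J X) (filtermap (yoneda X) \<sigma>) \<psi> = \<psi> \<sigma>"
proof -
  have "Hom (J_cat J X) (filtermap (yoneda X) \<sigma>) \<psi> = kext (Obj X) eval_rel (Hom X) \<sigma> \<psi>"
    using Hom_transpose_dist[OF \<sigma>] assms(4) unfolding yoneda_def by blast
  also have "\<dots> = \<psi> \<sigma>"
  proof (rule kext_Hom[OF X \<sigma>])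
    fix \<sigma> assume \<sigma>: "\<sigma> \<in> UU (Obj X)"
    have "kleisli (Obj X) (Obj X) eval_rel (Hom X) \<sigma> \<psi> = kleisli (Obj X) (Obj X) (to_one \<psi>) (Hom X) \<sigma> ()"
      by (rule kleisli_cong) (simp_all add: to_one_def)
    also have "\<dots> = \<psi> \<sigma>"
      using distributor_right[of X "to_one \<psi>" one_cat \<sigma> "()"] \<psi> \<sigma> by (simp add: J_cat_iff to_one_def)
    finally show "kleisli (Obj X) (Obj X) eval_rel (Hom X) \<sigma> \<psi> \<le> \<psi> \<sigma>" by simp
  qed
  finally show ?thesis .
qed


section \<open>Classes of distributors\<close>

lemma bij_betw_UU_filtermap:
  assumes g: "bij_betw g A' A"
  shows "bij_betw (filtermap g) (UU A') (UU A)"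
proof -
  let ?h = "inv_into A' g"
  have h: "bij_betw ?h A A'" using g by (rule bij_betw_inv_into)
  have "filtermap ?h (filtermap g F) = F" if "F \<in> UU A'" for F
    unfolding filtermap_filtermap
    using that by (rule filtermap_id_UU) (rule bij_betw_inv_into_left[OF g])
  moreover have "filtermap g (filtermap ?h F) = F" if "F \<in> UU A" for F
    unfolding filtermap_filtermap
    using that by (rule filtermap_id_UU) (rule bij_betw_inv_into_right[OF g])
  moreover have "filtermap g ` UU A' \<subseteq> UU A"
    using UU_filtermap[of _ A' g A] bij_betwE[OF g] by blast
  moreover have "filtermap ?h ` UU A \<subseteq> UU A'"
    using UU_filtermap[of _ A ?h A'] bij_betwE[OF h] by blast
  ultimately show ?thesis by (intro bij_betw_byWitness[where f'="filtermap ?h"]) blast+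
qed

lemma Umop_bij:
  assumes g: "bij_betw g A' A" and \<sigma>: "\<sigma> \<in> UU A'"
  shows "Umop A' (\<lambda>\<sigma> y. \<alpha> (filtermap g \<sigma>) (h y)) \<sigma> \<upsilon> = Umop A \<alpha> (filtermap g \<sigma>) (filtermap h \<upsilon>)"
proof -
  let ?G = "filtermap (filtermap g)"
  have G: "bij_betw ?G (UU (UU A')) (UU (UU A))"
    by (intro bij_betw_UU_filtermap g)
  have g': "bij_betw (filtermap g) (UU A') (UU A)" by (rule bij_betw_UU_filtermap[OF g])
  have "{\<Xi> \<in> UU (UU A). umult \<Xi> = filtermap g \<sigma>} = ?G ` {\<Xi> \<in> UU (UU A'). umult \<Xi> = \<sigma>}"
  proof (intro set_eqI iffI)
    fix \<Xi> assume "\<Xi> \<in> {\<Xi> \<in> UU (UU A). umult \<Xi> = filtermap g \<sigma>}"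
    then have \<Xi>: "\<Xi> \<in> UU (UU A)" "umult \<Xi> = filtermap g \<sigma>" by auto
    from \<Xi>(1) obtain \<Xi>' where \<Xi>': "\<Xi>' \<in> UU (UU A')" "\<Xi> = ?G \<Xi>'"
      using bij_betw_imp_surj_on[OF G] by (metis imageE)
    have "filtermap g (umult \<Xi>') = filtermap g \<sigma>"
      using \<Xi>(2) \<Xi>'(2) by (simp add: umult_filtermap_filtermap)
    then have "umult \<Xi>' = \<sigma>"
      using inj_onD[OF bij_betw_imp_inj_on[OF g'] _ umult_UU[OF \<Xi>'(1)] \<sigma>] by simp
    with \<Xi>' show "\<Xi> \<in> ?G ` {\<Xi> \<in> UU (UU A'). umult \<Xi> = \<sigma>}" by simp
  next
    fix \<Xi> assume "\<Xi> \<in> ?G ` {\<Xi> \<in> UU (UU A'). umult \<Xi> = \<sigma>}"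
    then obtain \<Xi>' where "\<Xi>' \<in> UU (UU A')" "umult \<Xi>' = \<sigma>" "\<Xi> = ?G \<Xi>'" by auto
    then show "\<Xi> \<in> {\<Xi> \<in> UU (UU A). umult \<Xi> = filtermap g \<sigma>}"
      using bij_betwE[OF G] by (simp add: umult_filtermap_filtermap)
  qed
  then show ?thesis
    by (simp add: Umop_eq image_image Uext_filtermap)
qed

lemma kleisli_bij:
  assumes g: "bij_betw g A' A" and h: "bij_betw h B' B" and \<sigma>: "\<sigma> \<in> UU A'"
  shows "kleisli A' B' (\<lambda>\<upsilon> z. \<beta> (filtermap h \<upsilon>) (k z)) (\<lambda>\<sigma> y. \<alpha> (filtermap g \<sigma>) (h y)) \<sigma> z =
    kleisli A B \<beta> \<alpha> (filtermap g \<sigma>) (k z)"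
proof -
  have "UU B = filtermap h ` UU B'"
    using bij_betw_imp_surj_on[OF bij_betw_UU_filtermap[OF h]] by simp
  then show ?thesis by (simp add: kleisli_eq image_image Umop_bij[OF g \<sigma>])
qed

lemma bij_betw_inv_into_image: "inj_on i A \<Longrightarrow> bij_betw (inv_into A i) (i ` A) A"
  by (intro bij_betw_inv_into inj_on_imp_bij_betw)

lemma kleisli_copy_rel:
  assumes "inj_on i A" "inj_on j B" "\<sigma> \<in> UU (i ` A)"
  shows "kleisli (i ` A) (j ` B) (copy_rel j B k C \<beta>) (copy_rel i A j B \<alpha>) \<sigma> z =
    copy_rel i A k C (kleisli A B \<beta> \<alpha>) \<sigma> z"
  unfolding copy_rel_def
  by (rule kleisli_bij) (intro bij_betw_inv_into_image assms)+

lemma uq_category_copy_cat: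
  assumes X: "uq_category X" and i: "inj_on i (Obj X)"
  shows "uq_category (copy_cat i X)"
  unfolding uq_category_iff
proof (intro conjI ballI)
  fix x assume "x \<in> Obj (copy_cat i X)"
  then show "1 \<le> Hom (copy_cat i X) (principal {x}) x"
    using i X by (auto simp: copy_cat_def copy_rel_def filtermap_principal Hom_refl)
next
  fix \<sigma> x assume *: "\<sigma> \<in> UU (Obj (copy_cat i X))" "x \<in> Obj (copy_cat i X)"
  let ?g = "inv_into (Obj X) i"
  have "?g x \<in> Obj X" using *(2) i by (auto simp: copy_cat_def)
  moreover have "filtermap ?g \<sigma> \<in> UU (Obj X)"
    using *(1) i by (auto simp: copy_cat_def intro: UU_filtermap)
  ultimately show "kleisli (Obj (copy_cat i X)) (Obj (copy_cat i X)) (Hom (copy_cat i X)) (Hom (copy_cat i X)) \<sigma> x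
      \<le> Hom (copy_cat i X) \<sigma> x"
    using * i kleisli_Hom_Hom_le[OF X] by (simp add: copy_cat_def kleisli_copy_rel) (simp add: copy_rel_def)
qed

lemma uq_functor_copy_cat:
  assumes f: "uq_functor X f Y" and i: "inj_on i (Obj X)" and j: "inj_on j (Obj Y)"
  shows "uq_functor (copy_cat i X) (\<lambda>x. j (f (inv_into (Obj X) i x))) (copy_cat j Y)"
  unfolding uq_functor_def
proof (intro conjI ballI)
  let ?g = "inv_into (Obj X) i" and ?h = "inv_into (Obj Y) j"
  show "(\<lambda>x. j (f (?g x))) ` Obj (copy_cat i X) \<subseteq> Obj (copy_cat j Y)"
    using uq_functorD(1)[OF f] i by (auto simp: copy_cat_def)
  fix \<upsilon> x assume *: "\<upsilon> \<in> UU (Obj (copy_cat i X))" "x \<in> Obj (copy_cat i X)"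
  have gx: "?g x \<in> Obj X" using *(2) i by (auto simp: copy_cat_def)
  have g\<upsilon>: "filtermap ?g \<upsilon> \<in> UU (Obj X)"
    using *(1) i by (auto simp: copy_cat_def intro: UU_filtermap)
  have "filtermap (\<lambda>x. ?h (j (f (?g x)))) \<upsilon> = filtermap (\<lambda>x. f (?g x)) \<upsilon>"
    using *(1) by (rule UU_filtermap_cong) (use i j uq_functorD(1)[OF f] in \<open>auto simp: copy_cat_def\<close>)
  then show "Hom (copy_cat i X) \<upsilon> x \<le> Hom (copy_cat j Y) (filtermap (\<lambda>x. j (f (?g x))) \<upsilon>) (j (f (?g x)))"
    using uq_functorD(2)[OF f g\<upsilon> gx] uq_functorD(1)[OF f gx] j
    by (simp add: copy_cat_def copy_rel_def filtermap_filtermap)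
qed

lemma uq_functor_id: "uq_functor X (\<lambda>x. x) X"
  by (simp add: uq_functor_def filtermap_ident)

lemma uq_functor_point: "uq_category X \<Longrightarrow> x \<in> Obj X \<Longrightarrow> uq_functor one_cat (\<lambda>_. x) X"
  using Hom_refl[of X x] by (simp add: uq_functor_def UU_unit filtermap_principal)

lemma rel_eqI: "(\<And>x y. x \<in> A \<Longrightarrow> y \<in> B \<Longrightarrow> r x y = s x y) \<Longrightarrow> rel_eq A B r s"
  by (simp add: rel_eq_def)

section \<open>Membership in \<open>J\<close> for distributors on arbitrary carriers\<close>

lemma distributor_classD:
  assumes J: "distributor_class J"
  shows "J X \<phi> Y \<Longrightarrow> uq_category X" "J X \<phi> Y \<Longrightarrow> uq_category Y" "J X \<phi> Y \<Longrightarrow> distributor X \<phi> Y"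
    and "J X \<phi> Y \<Longrightarrow> rel_eq (UU (Obj X)) (Obj Y) \<phi> \<phi>' \<Longrightarrow> J X \<phi>' Y"
    and "J X \<phi> Y \<Longrightarrow> J Y \<psi> Z \<Longrightarrow> J X (kleisli (Obj X) (Obj Y) \<psi> \<phi>) Z"
    and "uq_category X \<Longrightarrow> uq_category Y \<Longrightarrow> uq_functor X f Y \<Longrightarrow> J Y (upper_star Y f) X"
proof -
  note c = J[unfolded distributor_class_def]
  show "J X \<phi> Y \<Longrightarrow> uq_category X" "J X \<phi> Y \<Longrightarrow> uq_category Y" "J X \<phi> Y \<Longrightarrow> distributor X \<phi> Y"
    by (meson c[THEN conjunct1])+
  show "J X \<phi> Y \<Longrightarrow> rel_eq (UU (Obj X)) (Obj Y) \<phi> \<phi>' \<Longrightarrow> J X \<phi>' Y"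
    by (rule c[THEN conjunct2, THEN conjunct1, rule_format])
  show "J X \<phi> Y \<Longrightarrow> J Y \<psi> Z \<Longrightarrow> J X (kleisli (Obj X) (Obj Y) \<psi> \<phi>) Z"
    by (rule c[THEN conjunct2, THEN conjunct2, THEN conjunct1, rule_format])
  show "uq_category X \<Longrightarrow> uq_category Y \<Longrightarrow> uq_functor X f Y \<Longrightarrow> J Y (upper_star Y f) X"
    by (rule c[THEN conjunct2, THEN conjunct2, THEN conjunct2, THEN conjunct1, rule_format])
qed

text \<open>Two copies of \<open>Y\<close> are isomorphic through their embeddings, and composing
  with \<open>f\<^sup>*\<close> for this isomorphism, which lies in \<open>J\<close>, replaces one
  by the other. This aligns the middle copies when two members of the class are convolved.\<close>

lemma in_class_copy_target:
  assumes J: "distributor_class J" and \<phi>: "in_class J X \<phi> Y" and Y: "uq_category Y" and j: "inj_on j (Obj Y)"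
  shows "\<exists>i. inj_on i (Obj X) \<and> J (copy_cat i X) (copy_rel i (Obj X) j (Obj Y) \<phi>) (copy_cat j Y)"
proof -
  from \<phi> obtain i j' where i: "inj_on i (Obj X)" and j': "inj_on j' (Obj Y)"
    and \<phi>': "J (copy_cat i X) (copy_rel i (Obj X) j' (Obj Y) \<phi>) (copy_cat j' Y)" (is "J ?X ?\<phi> ?Y'")
    unfolding in_class_def by blast
  let ?Y = "copy_cat j Y"
  let ?f = "\<lambda>y. j' (inv_into (Obj Y) j y)"
  have f: "uq_functor ?Y ?f ?Y'" by (rule uq_functor_copy_cat[OF uq_functor_id j j'])
  have cY: "uq_category ?Y" by (rule uq_category_copy_cat[OF Y j])
  have cY': "uq_category ?Y'" by (rule uq_category_copy_cat[OF Y j'])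
  note J_star = distributor_classD(6)[OF J, OF cY cY' f]
  have J_comp: "J ?X (kleisli (Obj ?X) (Obj ?Y') (upper_star ?Y' ?f) ?\<phi>) ?Y"
    using distributor_classD(5)[OF J, OF \<phi>' J_star] .
  have "rel_eq (UU (Obj ?X)) (Obj ?Y) (kleisli (Obj ?X) (Obj ?Y') (upper_star ?Y' ?f) ?\<phi>)
      (copy_rel i (Obj X) j (Obj Y) \<phi>)"
    unfolding rel_eq_def
  proof (intro ballI)
    fix \<sigma> y assume *: "\<sigma> \<in> UU (Obj ?X)" "y \<in> Obj ?Y"
    have fy: "?f y \<in> Obj ?Y'" using uq_functorD(1)[OF f *(2)] .
    have "kleisli (Obj ?X) (Obj ?Y') (upper_star ?Y' ?f) ?\<phi> \<sigma> y = kleisli (Obj ?X) (Obj ?Y') (Hom ?Y') ?\<phi> \<sigma> (?f y)"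
      by (rule kleisli_cong) (simp_all add: upper_star_def)
    also have "\<dots> = ?\<phi> \<sigma> (?f y)"
      using distributor_left[OF distributor_classD(3)[OF J, OF \<phi>'] *(1) fy] .
    also have "\<dots> = copy_rel i (Obj X) j (Obj Y) \<phi> \<sigma> y"
      using *(2) j j' by (auto simp: copy_rel_def copy_cat_def)
    finally show "kleisli (Obj ?X) (Obj ?Y') (upper_star ?Y' ?f) ?\<phi> \<sigma> y = copy_rel i (Obj X) j (Obj Y) \<phi> \<sigma> y" .
  qed
  from distributor_classD(4)[OF J, OF J_comp this] i show ?thesis by (intro exI[of _ i] conjI)
qed

lemma in_class_kleisli:
  assumes J: "distributor_class J" and Y: "uq_category Y" and \<phi>: "in_class J X \<phi> Y" and \<psi>: "in_class J Y \<psi> Z"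
  shows "in_class J X (kleisli (Obj X) (Obj Y) \<psi> \<phi>) Z"
proof -
  from \<psi> obtain j k where j: "inj_on j (Obj Y)" and k: "inj_on k (Obj Z)"
    and \<psi>': "J (copy_cat j Y) (copy_rel j (Obj Y) k (Obj Z) \<psi>) (copy_cat k Z)"
    unfolding in_class_def by blast
  from in_class_copy_target[OF J \<phi> Y j] obtain i where i: "inj_on i (Obj X)"
    and \<phi>': "J (copy_cat i X) (copy_rel i (Obj X) j (Obj Y) \<phi>) (copy_cat j Y)" by blast
  have "rel_eq (UU (Obj (copy_cat i X))) (Obj (copy_cat k Z))
     (kleisli (Obj (copy_cat i X)) (Obj (copy_cat j Y))
        (copy_rel j (Obj Y) k (Obj Z) \<psi>) (copy_rel i (Obj X) j (Obj Y) \<phi>))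
     (copy_rel i (Obj X) k (Obj Z) (kleisli (Obj X) (Obj Y) \<psi> \<phi>))"
    by (simp add: rel_eq_def copy_cat_def kleisli_copy_rel i j)
  from distributor_classD(4)[OF J, OF distributor_classD(5)[OF J, OF \<phi>' \<psi>'] this]
  have "J (copy_cat i X) (copy_rel i (Obj X) k (Obj Z) (kleisli (Obj X) (Obj Y) \<psi> \<phi>)) (copy_cat k Z)" .
  with i k show ?thesis unfolding in_class_def by (intro exI[of _ i] exI[of _ k] conjI)
qed

lemma in_class_cong:
  assumes J: "distributor_class J" and \<phi>: "in_class J X \<phi> Y"
    and eq: "\<And>\<sigma> y. \<sigma> \<in> UU (Obj X) \<Longrightarrow> y \<in> Obj Y \<Longrightarrow> \<phi> \<sigma> y = \<phi>' \<sigma> y"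
  shows "in_class J X \<phi>' Y"
proof -
  from \<phi> obtain i j where i: "inj_on i (Obj X)" and j: "inj_on j (Obj Y)"
    and \<phi>': "J (copy_cat i X) (copy_rel i (Obj X) j (Obj Y) \<phi>) (copy_cat j Y)"
    unfolding in_class_def by blast
  have "rel_eq (UU (Obj (copy_cat i X))) (Obj (copy_cat j Y))
      (copy_rel i (Obj X) j (Obj Y) \<phi>) (copy_rel i (Obj X) j (Obj Y) \<phi>')"
  proof (rule rel_eqI)
    fix \<sigma> y assume *: "\<sigma> \<in> UU (Obj (copy_cat i X))" "y \<in> Obj (copy_cat j Y)"
    have "filtermap (inv_into (Obj X) i) \<sigma> \<in> UU (Obj X)"
      by (rule UU_filtermap[OF *(1)]) (auto simp: copy_cat_def i)
    moreover have "inv_into (Obj Y) j y \<in> Obj Y" using *(2) by (auto simp: copy_cat_def j)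
    ultimately show "copy_rel i (Obj X) j (Obj Y) \<phi> \<sigma> y = copy_rel i (Obj X) j (Obj Y) \<phi>' \<sigma> y"
      unfolding copy_rel_def by (rule eq)
  qed
  from distributor_classD(4)[OF J, OF \<phi>' this]
  have "J (copy_cat i X) (copy_rel i (Obj X) j (Obj Y) \<phi>') (copy_cat j Y)" .
  with i j show ?thesis unfolding in_class_def by (intro exI[of _ i] exI[of _ j] conjI)
qed

lemma in_class_upper_star:
  fixes J :: "('u, 'q::quantale) dist_class" and i :: "'a \<Rightarrow> 'u" and j :: "'b \<Rightarrow> 'u"
  assumes J: "distributor_class J" and X: "uq_category X" and Y: "uq_category Y" and f: "uq_functor X f Y"
    and i: "inj_on i (Obj X)" and j: "inj_on j (Obj Y)"
  shows "in_class J Y (upper_star Y f) X"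
proof -
  let ?f = "\<lambda>x. j (f (inv_into (Obj X) i x))"
  have c: "J (copy_cat j Y) (upper_star (copy_cat j Y) ?f) (copy_cat i X)"
    by (rule distributor_classD(6)[OF J, OF uq_category_copy_cat[OF X i] uq_category_copy_cat[OF Y j]
          uq_functor_copy_cat[OF f i j]])
  have "rel_eq (UU (Obj (copy_cat j Y))) (Obj (copy_cat i X)) (upper_star (copy_cat j Y) ?f)
      (copy_rel j (Obj Y) i (Obj X) (upper_star Y f))"
    using uq_functorD(1)[OF f] i j by (auto simp: rel_eq_def upper_star_def copy_cat_def copy_rel_def)
  from distributor_classD(4)[OF J, OF c this]
  have "J (copy_cat j Y) (copy_rel j (Obj Y) i (Obj X) (upper_star Y f)) (copy_cat i X)" .
  with i j show ?thesis unfolding in_class_def by (intro exI[of _ j] exI[of _ i] conjI)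
qed

lemma in_class_point:
  fixes J :: "('u, 'q::quantale) dist_class"
  assumes J: "distributor_class J" and Y: "uq_category Y" and \<phi>: "distributor X \<phi> Y" "in_class J X \<phi> Y"
    and y: "y \<in> Obj Y"
  shows "in_class J X (\<lambda>\<sigma> _. \<phi> \<sigma> y) one_cat"
proof -
  \<comment> \<open>Membership of \<phi> already embeds \<open>Y\<close> into the universe; for the
    one-point carrier any map is an embedding.\<close>
  from \<phi>(2) obtain j where j: "inj_on (j :: _ \<Rightarrow> 'u) (Obj Y)" unfolding in_class_def by blast
  have "in_class J Y (upper_star Y (\<lambda>_::unit. y)) one_cat"
    by (rule in_class_upper_star[where i="\<lambda>_. undefined", OF J uq_category_one Y uq_functor_point[OF Y y] _ j])
      (simp add: inj_on_def)
  then have "in_class J X (kleisli (Obj X) (Obj Y) (upper_star Y (\<lambda>_::unit. y)) \<phi>) one_cat"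
    by (rule in_class_kleisli[OF J Y \<phi>(2)])
  then show ?thesis
  proof (rule in_class_cong[OF J])
    fix \<sigma> and z :: unit assume \<sigma>: "\<sigma> \<in> UU (Obj X)"
    have "kleisli (Obj X) (Obj Y) (upper_star Y (\<lambda>_::unit. y)) \<phi> \<sigma> z = kleisli (Obj X) (Obj Y) (Hom Y) \<phi> \<sigma> y"
      by (rule kleisli_cong) (simp_all add: upper_star_def)
    then show "kleisli (Obj X) (Obj Y) (upper_star Y (\<lambda>_::unit. y)) \<phi> \<sigma> z = \<phi> \<sigma> y"
      using distributor_left[OF \<phi>(1) \<sigma> y] by simp
  qed
qed

lemma transpose_dist_in_J_cat:
  assumes J: "distributor_class J" and Y: "uq_category Y" and \<phi>: "distributor X \<phi> Y" "in_class J X \<phi> Y"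
    and y: "y \<in> Obj Y"
  shows "transpose_dist X \<phi> y \<in> Obj (J_cat J X)"
proof (rule transpose_dist_J_cat)
  show "distributor X (\<lambda>\<sigma> _. \<phi> \<sigma> y) one_cat" by (rule distributor_point[OF Y \<phi>(1) y])
  show "in_class J X (to_one (transpose_dist X \<phi> y)) one_cat"
    by (rule in_class_cong[OF J in_class_point[OF J Y \<phi> y]]) (simp add: to_one_def transpose_dist_eval)
qed

text \<open>By the adjunction, functoriality of the transpose is the inequality
  \<open>Y \<circ> \<phi> \<le> \<phi>\<close>.\<close>

lemma uq_functor_transpose_dist:
  assumes J: "distributor_class J" and Y: "uq_category Y" and \<phi>: "distributor X \<phi> Y" "in_class J X \<phi> Y"
  shows "uq_functor Y (transpose_dist X \<phi>) (J_cat J X)"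
  unfolding uq_functor_def
proof (intro conjI ballI)
  note T = transpose_dist_in_J_cat[OF J Y \<phi>]
  show "transpose_dist X \<phi> ` Obj Y \<subseteq> Obj (J_cat J X)" using T by blast
  fix \<upsilon> y assume \<upsilon>: "\<upsilon> \<in> UU (Obj Y)" and y: "y \<in> Obj Y"
  have "\<forall>\<sigma>\<in>UU (Obj X). kleisli (Obj X) (Obj Y) (Hom Y) \<phi> \<sigma> y \<le> eval_rel \<sigma> (transpose_dist X \<phi> y)"
    by (simp add: distributor_left[OF \<phi>(1) _ y] transpose_dist_eval)
  from iffD1[OF kleisli_kext_iff[where \<gamma>=eval_rel and z'="transpose_dist X \<phi> y"] this]
  show "Hom Y \<upsilon> y \<le> Hom (J_cat J X) (filtermap (transpose_dist X \<phi>) \<upsilon>) (transpose_dist X \<phi> y)"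
    using \<upsilon> by (simp add: Hom_transpose_dist[OF \<upsilon> T])
qed


lemma distributor_mono:
  assumes \<phi>: "distributor X \<phi> Y" and \<sigma>: "\<sigma> \<in> UU (Obj X)" and y: "y \<in> Obj Y" "z \<in> Obj Y"
    and "1 \<le> Hom Y (principal {y}) z"
  shows "\<phi> \<sigma> y \<le> \<phi> \<sigma> z"
proof -
  have "\<phi> \<sigma> y * 1 \<le> Umop (Obj X) \<phi> \<sigma> (principal {y}) * Hom Y (principal {y}) z"
    by (intro quantale_mult_mono le_Umop_principal assms)
  also have "\<dots> \<le> kleisli (Obj X) (Obj Y) (Hom Y) \<phi> \<sigma> z"
    using y(1) by (intro le_kleisli UU_principal)
  finally show ?thesis using distributor_left[OF \<phi> \<sigma> y(2)] by simp
qed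

text \<open>Suprema are determined only up to equivalence of objects; this lets the one chosen by
  \<open>S\<close> be exchanged for any other inside a distributor.\<close>

lemma distributor_eq_of_Hom_eq:
  assumes Y: "uq_category Y" and \<phi>: "distributor X \<phi> Y" and \<sigma>: "\<sigma> \<in> UU (Obj X)" and y: "y \<in> Obj Y" "z \<in> Obj Y"
    and eq: "\<And>w. w \<in> Obj Y \<Longrightarrow> Hom Y (principal {y}) w = Hom Y (principal {z}) w"
  shows "\<phi> \<sigma> y = \<phi> \<sigma> z"
  using distributor_mono[OF \<phi> \<sigma> y] distributor_mono[OF \<phi> \<sigma> y(2,1)] eq[OF y(1)] eq[OF y(2)]
    Hom_refl[OF Y y(1)] Hom_refl[OF Y y(2)] by (intro antisym) simp_all

lemma kext_point: "kext A \<gamma> (\<lambda>\<sigma> _. \<phi> \<sigma> y) (principal {()}) z = kext A \<gamma> \<phi> (principal {y}) z"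
  using kext_filtermap[of A \<gamma> \<phi> "\<lambda>_. y" "principal {()}" z] by (simp add: filtermap_principal)


section \<open>Approximation in cocomplete categories\<close>

locale J_cocomplete_category = multiplicative_xi T for T :: "'q::quantale itself" +
  fixes J :: "('u, 'q) dist_class"
    and X :: "('a, 'q) ucat"
    and S :: "('a filter \<Rightarrow> 'q) \<Rightarrow> 'a"
  assumes J: "distributor_class J"
    and X: "uq_category X"
    and S: "adjoint (J_cat J X) S X (yoneda X)"
begin

abbreviation "A \<equiv> Obj X"
abbreviation "JX \<equiv> J_cat J X"
abbreviation "B \<equiv> Obj JX"

lemmas cat_JX = uq_category_J_cat[of J X]

lemma S_functor: "uq_functor JX S X" and yoneda_functor: "uq_functor X (yoneda X) JX"
  using S by (simp_all add: adjoint_def)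

lemma S_in: "\<psi> \<in> B \<Longrightarrow> S \<psi> \<in> A" and yoneda_in: "x \<in> A \<Longrightarrow> yoneda X x \<in> B"
  using uq_functorD(1)[OF S_functor] uq_functorD(1)[OF yoneda_functor] by blast+

lemma yoneda_eval: "\<sigma> \<in> UU A \<Longrightarrow> yoneda X x \<sigma> = Hom X \<sigma> x"
  by (simp add: yoneda_def transpose_dist_eval)

lemma Hom_S: "\<Upsilon> \<in> UU B \<Longrightarrow> x \<in> A \<Longrightarrow> Hom X (filtermap S \<Upsilon>) x = Hom JX \<Upsilon> (yoneda X x)"
  using adjoint_Hom_eq[OF cat_JX X S] .

lemma le_Hom_S:
  assumes "\<psi> \<in> B" "\<sigma> \<in> UU A"
  shows "\<psi> \<sigma> \<le> Hom X \<sigma> (S \<psi>)"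
proof -
  have "1 \<le> Hom JX (principal {\<psi>}) (yoneda X (S \<psi>))"
    using S assms(1) by (auto simp: adjoint_def functor_le_def)
  from Hom_J_cat_le[OF this assms] show ?thesis by (simp add: yoneda_eval assms(2))
qed

lemma Hom_S_yoneda:
  assumes x: "x \<in> A" and \<sigma>: "\<sigma> \<in> UU A"
  shows "Hom X \<sigma> (S (yoneda X x)) = Hom X \<sigma> x"
proof (rule antisym)
  note yx = yoneda_in[OF x] and Syx = S_in[OF yoneda_in[OF x]]
  show "Hom X \<sigma> (S (yoneda X x)) \<le> Hom X \<sigma> x"
    using Hom_S[OF UU_principal[OF yx] x] Hom_refl[OF cat_JX yx]
    by (intro Hom_mono_right[OF X \<sigma> Syx x]) (simp add: filtermap_principal)
  show "Hom X \<sigma> x \<le> Hom X \<sigma> (S (yoneda X x))"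
    using le_Hom_S[OF yx UU_principal[OF x]] Hom_refl[OF X x]
    by (intro Hom_mono_right[OF X \<sigma> x Syx]) (simp add: yoneda_eval UU_principal[OF x])
qed

text \<open>The adjunction at \<open>principal {\<psi>}\<close>. It makes \<open>S \<psi>\<close> a
  supremum of \<psi>, to which every other supremum is equivalent.\<close>

lemma Hom_S_eq_kext:
  assumes "\<psi> \<in> B" "z \<in> A"
  shows "Hom X (principal {S \<psi>}) z = kext A (Hom X) (to_one \<psi>) (principal {()}) z"
proof -
  have "Hom X (principal {S \<psi>}) z = Hom JX (principal {\<psi>}) (yoneda X z)"
    using Hom_S[OF UU_principal[OF assms(1)] assms(2)] by (simp add: filtermap_principal)
  also have "\<dots> = kext A eval_rel eval_rel (principal {\<psi>}) (yoneda X z)"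
    by (rule Hom_J_cat[OF UU_principal[OF assms(1)]])
  also have "\<dots> = kext A (Hom X) eval_rel (principal {\<psi>}) z"
    by (rule kext_cong[OF UU_principal[OF assms(1)], where \<gamma>=eval_rel and \<gamma>'="Hom X"])
      (simp_all add: yoneda_eval)
  also have "\<dots> = kext A (Hom X) (to_one \<psi>) (principal {()}) z"
    unfolding to_one_def by (rule kext_point[symmetric])
  finally show ?thesis .
qed

lemma is_supremum_iff:
  assumes "\<psi> \<in> B"
  shows "is_supremum X \<psi> x \<longleftrightarrow> x \<in> A \<and> (\<forall>z\<in>A. Hom X (principal {x}) z = Hom X (principal {S \<psi>}) z)"
  by (auto simp: is_supremum_def rel_eq_def UU_unit lower_star_def filtermap_principal Hom_S_eq_kext assms)

end

locale J_cocomplete_dist = J_cocomplete_category T J X S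
  for T :: "'q::quantale itself" and J :: "('u, 'q) dist_class" and X :: "('a, 'q) ucat"
    and S :: "('a filter \<Rightarrow> 'q) \<Rightarrow> 'a" +
  fixes v :: "'a filter \<Rightarrow> 'a \<Rightarrow> 'q"
  assumes v: "distributor X v X" "in_class J X v X"
begin

abbreviation "tr \<equiv> transpose_dist X v"

lemma tr_in: "x \<in> A \<Longrightarrow> tr x \<in> B"
  using transpose_dist_in_J_cat[OF J X v] .

lemma tr_functor: "uq_functor X tr JX"
  using uq_functor_transpose_dist[OF J X v] .

lemma Hom_tr: "\<sigma> \<in> UU A \<Longrightarrow> Hom JX (filtermap tr \<sigma>) \<psi> = kext A eval_rel v \<sigma> \<psi>"
  using Hom_transpose_dist[of \<sigma> A X v J \<psi>] tr_in by blast

lemma Hom_S_tr: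
  assumes \<sigma>: "\<sigma> \<in> UU A" and y: "y \<in> A"
  shows "Hom X (filtermap S (filtermap tr \<sigma>)) y = kext A (Hom X) v \<sigma> y"
proof -
  have "Hom X (filtermap S (filtermap tr \<sigma>)) y = Hom JX (filtermap tr \<sigma>) (yoneda X y)"
    by (rule Hom_S[OF UU_filtermap[OF \<sigma> tr_in] y])
  also have "\<dots> = kext A eval_rel v \<sigma> (yoneda X y)" by (rule Hom_tr[OF \<sigma>])
  also have "\<dots> = kext A (Hom X) v \<sigma> y"
    by (rule kext_cong[OF \<sigma>, where \<gamma>=eval_rel and \<gamma>'="Hom X"]) (simp_all add: yoneda_eval)
  finally show ?thesis .
qed

lemma Hom_S_tr_point: "x \<in> A \<Longrightarrow> y \<in> A \<Longrightarrow> Hom X (principal {S (tr x)}) y = kext A (Hom X) v (principal {x}) y"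
  using Hom_S_tr[OF UU_principal] by (simp add: filtermap_principal)

section \<open>The conditions in terms of values at objects and ultrafilters\<close>

lemma kleisli_dist:
  assumes "distributor X \<gamma> X" "\<sigma> \<in> UU A" "\<psi> \<in> B"
  shows "kleisli A A (upper_star X S) \<gamma> \<sigma> \<psi> = \<gamma> \<sigma> (S \<psi>)"
proof -
  have "kleisli A A (upper_star X S) \<gamma> \<sigma> \<psi> = kleisli A A (Hom X) \<gamma> \<sigma> (S \<psi>)"
    by (rule kleisli_cong) (simp_all add: upper_star_def)
  then show ?thesis using distributor_left[OF assms(1,2) S_in[OF assms(3)]] by simp
qed

lemma approximating_iff:
  "approximating J X v \<longleftrightarrow> (\<forall>\<sigma>\<in>UU A. \<forall>x\<in>A. kext A (Hom X) v \<sigma> x = Hom X \<sigma> x)"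
  by (simp add: approximating_def v rel_eq_def)

lemma approximating_at_iff:
  assumes x: "x \<in> A"
  shows "approximating_at J X v x \<longleftrightarrow> (\<forall>z\<in>A. kext A (Hom X) v (principal {x}) z = Hom X (principal {x}) z)"
proof -
  have "kext A (Hom X) (kleisli A A (upper_star X (\<lambda>_::unit. x)) v) (principal {()}) z =
      kext A (Hom X) (\<lambda>\<sigma> _. v \<sigma> x) (principal {()}) z" for z
  proof (rule kext_cong[where B=UNIV and \<gamma>="Hom X" and \<gamma>'="Hom X" and z=z and z'=z])
    fix \<sigma> and u :: unit assume "\<sigma> \<in> UU A"
    have "kleisli A A (upper_star X (\<lambda>_::unit. x)) v \<sigma> u = kleisli A A (Hom X) v \<sigma> x"
      by (rule kleisli_cong) (simp_all add: upper_star_def)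
    then show "kleisli A A (upper_star X (\<lambda>_::unit. x)) v \<sigma> u = v \<sigma> x"
      using distributor_left[OF v(1) \<open>\<sigma> \<in> UU A\<close> x] by simp
  qed (simp_all add: UU_unit)
  then show ?thesis
    by (simp add: approximating_at_def v rel_eq_def UU_unit lower_star_def filtermap_principal kext_point)
qed

text \<open>At points, approximation makes \<open>S (tr x)\<close> equivalent to \<open>x\<close>.
  Applying \<open>Hom_mono_left\<close> in both directions carries this to ultrafilters, where
  \<open>Hom_S_tr\<close> reads it back as a statement on \<open>kext\<close>.\<close>

lemma approximating_iff_all_approximating_at:
  "approximating J X v \<longleftrightarrow> (\<forall>x\<in>A. approximating_at J X v x)"
proof
  assume "approximating J X v"
  then show "\<forall>x\<in>A. approximating_at J X v x"
    by (simp add: approximating_iff approximating_at_iff UU_principal)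
next
  assume a: "\<forall>x\<in>A. approximating_at J X v x"
  have eq: "Hom X (principal {S (tr x)}) y = Hom X (principal {x}) y" if "x \<in> A" "y \<in> A" for x y
    using a that by (simp add: Hom_S_tr_point approximating_at_iff)
  show "approximating J X v"
    unfolding approximating_iff
  proof (intro ballI)
    fix \<sigma> x assume \<sigma>: "\<sigma> \<in> UU A" and x: "x \<in> A"
    have in_A: "S (tr y) \<in> A" if "y \<in> A" for y using S_in[OF tr_in[OF that]] .
    have "Hom X (filtermap (\<lambda>x. S (tr x)) \<sigma>) x = Hom X (filtermap (\<lambda>x. x) \<sigma>) x"
    proof (rule antisym)
      show "Hom X (filtermap (\<lambda>x. S (tr x)) \<sigma>) x \<le> Hom X (filtermap (\<lambda>x. x) \<sigma>) x"
        using eq[symmetric] by (intro Hom_mono_left[OF X \<sigma>]) (simp_all add: in_A x Hom_refl[OF X])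
      show "Hom X (filtermap (\<lambda>x. x) \<sigma>) x \<le> Hom X (filtermap (\<lambda>x. S (tr x)) \<sigma>) x"
        using eq by (intro Hom_mono_left[OF X \<sigma>]) (simp_all add: in_A x Hom_refl[OF X])
    qed
    then show "kext A (Hom X) v \<sigma> x = Hom X \<sigma> x"
      using Hom_S_tr[OF \<sigma> x] by (simp add: filtermap_filtermap filtermap_ident)
  qed
qed

lemma J_cocontinuous_dist_iff:
  "J_cocontinuous_dist J X S v \<longleftrightarrow> (\<forall>\<sigma>\<in>UU A. \<forall>\<psi>\<in>B. v \<sigma> (S \<psi>) = kleisli A A eval_rel v \<sigma> \<psi>)"
proof -
  have "kleisli A A (lower_star JX (yoneda X)) v \<sigma> \<psi> = kleisli A A eval_rel v \<sigma> \<psi>"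
    if "\<psi> \<in> B" for \<sigma> \<psi>
    by (rule kleisli_cong) (simp_all add: lower_star_def Hom_yoneda[OF X _ that yoneda_in])
  then show ?thesis by (simp add: J_cocontinuous_dist_def rel_eq_def kleisli_dist v)
qed

text \<open>By the Yoneda lemma \<open>y\<^sub>*\<close> is evaluation, and
  \<open>S\<^sup>* \<circ> \<gamma>\<close> is \<gamma> at \<open>S \<psi>\<close>; no convolution
  is left in the lifting property.\<close>

lemma is_way_below_iff:
  "is_way_below J X S v \<longleftrightarrow> (\<forall>\<gamma>. distributor X \<gamma> X \<longrightarrow>
     (\<forall>\<sigma>\<in>UU A. \<forall>\<psi>\<in>B. \<gamma> \<sigma> (S \<psi>) \<le> \<psi> \<sigma>) \<longleftrightarrow> (\<forall>\<sigma>\<in>UU A. \<forall>x\<in>A. \<gamma> \<sigma> x \<le> v \<sigma> x))"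
proof -
  have "lower_star JX (yoneda X) \<sigma> \<psi> = \<psi> \<sigma>" if "\<sigma> \<in> UU A" "\<psi> \<in> B" for \<sigma> \<psi>
    by (simp add: lower_star_def Hom_yoneda[OF X that yoneda_in])
  then show ?thesis by (simp add: is_way_below_def is_lifting_def rel_le_def v kleisli_dist cong: ball_cong)
qed

text \<open>With \<open>T = transpose_dist X v\<close> this says \<open>T\<^sub>* = S\<^sup>*\<close>.\<close>

definition lower_star_eq_upper_star :: bool where
  "lower_star_eq_upper_star \<longleftrightarrow> (\<forall>\<sigma>\<in>UU A. \<forall>\<psi>\<in>B. kext A eval_rel v \<sigma> \<psi> = Hom X \<sigma> (S \<psi>))"

lemma lower_star_eq_upper_star_iff_Hom_hat:
  "lower_star_eq_upper_star \<longleftrightarrow> (\<forall>\<sigma>\<in>UU A. \<forall>\<psi>\<in>B. Hom (hat X) (filtermap tr \<sigma>) \<psi> = Hom X \<sigma> (S \<psi>))"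
  by (simp add: lower_star_eq_upper_star_def Hom_hat_eq[of X J] Hom_tr)

lemma adjoint_iff: "uq_functor X tr JX \<and> adjoint X tr JX S \<longleftrightarrow> lower_star_eq_upper_star"
proof
  assume "uq_functor X tr JX \<and> adjoint X tr JX S"
  then show lower_star_eq_upper_star
    unfolding lower_star_eq_upper_star_def using adjoint_Hom_eq[OF X cat_JX] Hom_tr by metis
next
  assume lower_star_eq_upper_star
  then have "adjoint X tr JX S"
    by (intro adjointI X cat_JX tr_functor S_functor) (simp add: Hom_tr lower_star_eq_upper_star_def)
  with tr_functor show "uq_functor X tr JX \<and> adjoint X tr JX S" ..
qed

section \<open>The implications between the conditions\<close>

lemma approximating_of_lower_star_eq_upper_star:
  assumes lower_star_eq_upper_star
  shows "approximating J X v"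
  unfolding approximating_iff
proof (intro ballI)
  fix \<sigma> x assume \<sigma>: "\<sigma> \<in> UU A" and x: "x \<in> A"
  have "kext A (Hom X) v \<sigma> x = kext A eval_rel v \<sigma> (yoneda X x)"
    by (rule kext_cong[OF \<sigma>, where \<gamma>="Hom X" and \<gamma>'=eval_rel]) (simp_all add: yoneda_eval)
  also have "\<dots> = Hom X \<sigma> (S (yoneda X x))"
    using assms \<sigma> yoneda_in[OF x] by (simp add: lower_star_eq_upper_star_def)
  finally show "kext A (Hom X) v \<sigma> x = Hom X \<sigma> x" by (simp add: Hom_S_yoneda x \<sigma>)
qed

text \<open>The unit, \<open>x\<close> below \<open>S (tr x)\<close>, gives \<open>\<gamma> \<sigma>
  x \<le> \<gamma> \<sigma> (S (tr x)) \<le> tr x \<sigma>\<close>, and the last term is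
  \<open>v \<sigma> x\<close>. For the converse, the adjunction of convolution and
  \<open>kext\<close> puts \<open>v\<close> at \<open>S \<psi>\<close> below \<psi>.\<close>

lemma is_way_below_of_lower_star_eq_upper_star:
  assumes eq: lower_star_eq_upper_star
  shows "is_way_below J X S v"
  unfolding is_way_below_iff
proof (intro allI impI iffI ballI)
  fix \<gamma> \<sigma> x assume \<gamma>: "distributor X \<gamma> X" and le: "\<forall>\<sigma>\<in>UU A. \<forall>\<psi>\<in>B. \<gamma> \<sigma> (S \<psi>) \<le> \<psi> \<sigma>"
    and \<sigma>: "\<sigma> \<in> UU A" and x: "x \<in> A"
  have "Hom X (principal {x}) (S (tr x)) = Hom JX (principal {tr x}) (tr x)"
    using eq Hom_tr[OF UU_principal[OF x], of "tr x"] UU_principal[OF x] tr_in[OF x]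
    by (simp add: lower_star_eq_upper_star_def filtermap_principal)
  then have "1 \<le> Hom X (principal {x}) (S (tr x))" by (simp add: Hom_refl[OF cat_JX tr_in[OF x]])
  then have "\<gamma> \<sigma> x \<le> \<gamma> \<sigma> (S (tr x))"
    by (rule distributor_mono[OF \<gamma> \<sigma> x S_in[OF tr_in[OF x]]])
  also have "\<dots> \<le> tr x \<sigma>" using le \<sigma> tr_in[OF x] by blast
  finally show "\<gamma> \<sigma> x \<le> v \<sigma> x" by (simp add: transpose_dist_eval \<sigma>)
next
  fix \<gamma> \<sigma> \<psi> assume \<gamma>: "distributor X \<gamma> X" and le: "\<forall>\<sigma>\<in>UU A. \<forall>x\<in>A. \<gamma> \<sigma> x \<le> v \<sigma> x"
    and \<sigma>: "\<sigma> \<in> UU A" and \<psi>: "\<psi> \<in> B"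
  have "\<gamma> \<sigma> (S \<psi>) \<le> v \<sigma> (S \<psi>)" using le \<sigma> S_in[OF \<psi>] by blast
  also have "\<dots> = kleisli A A (Hom X) v \<sigma> (S \<psi>)"
    using distributor_left[OF v(1) \<sigma> S_in[OF \<psi>]] by simp
  also have "\<dots> \<le> \<psi> \<sigma>"
  proof -
    have "\<forall>\<upsilon>\<in>UU A. Hom X \<upsilon> (S \<psi>) \<le> kext A eval_rel v \<upsilon> \<psi>"
      using eq \<psi> by (simp add: lower_star_eq_upper_star_def)
    then have "\<forall>\<nu>\<in>UU A. kleisli A A (Hom X) v \<nu> (S \<psi>) \<le> eval_rel \<nu> \<psi>"
      by (subst kleisli_kext_iff[where \<gamma>=eval_rel and z'=\<psi> and \<beta>="Hom X" and z="S \<psi>"])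
    with \<sigma> show ?thesis by blast
  qed
  finally show "\<gamma> \<sigma> (S \<psi>) \<le> \<psi> \<sigma>" .
qed

lemma kleisli_eval_v_le:
  assumes "\<sigma> \<in> UU A" "\<psi> \<in> B"
  shows "kleisli A A eval_rel v \<sigma> \<psi> \<le> v \<sigma> (S \<psi>)"
proof -
  have "kleisli A A eval_rel v \<sigma> \<psi> \<le> kleisli A A (Hom X) v \<sigma> (S \<psi>)"
    by (rule kleisli_mono) (simp_all add: le_Hom_S assms)
  then show ?thesis using distributor_left[OF v(1) assms(1) S_in[OF assms(2)]] by simp
qed

text \<open>Interpolation: \<open>v \<circ> v\<close> is again approximating and
  in \<open>J\<close>, so \<open>(v \<circ> v)(-, x)\<close> has supremum \<open>x\<close> and therefore lies above \<open>v(-, x)\<close>.\<close>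

lemma le_kleisli_self:
  assumes app: "approximating J X v" and wb: "is_way_below J X S v" and \<sigma>: "\<sigma> \<in> UU A" and x: "x \<in> A"
  shows "v \<sigma> x \<le> kleisli A A v v \<sigma> x"
proof -
  let ?w = "kleisli A A v v"
  \<comment> \<open>The composite \<open>v \<circ> v\<close> satisfies the assumptions made on
    \<open>v\<close>, so every fact about the transpose holds for it as well.\<close>
  interpret w: J_cocomplete_dist T J X S ?w
    by unfold_locales (intro distributor_kleisli v, intro in_class_kleisli[OF J X] v)
  have "kext A (Hom X) ?w \<sigma> x = Hom X \<sigma> x" if \<sigma>: "\<sigma> \<in> UU A" and x: "x \<in> A" for \<sigma> x
  proof -
    have "kext A (Hom X) ?w \<sigma> x = kext A (kext A (Hom X) v) v \<sigma> x" by (rule kext_kleisli[OF \<sigma>])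
    also have "\<dots> = kext A (Hom X) v \<sigma> x"
      by (rule kext_cong[OF \<sigma>, where \<gamma>="kext A (Hom X) v" and \<gamma>'="Hom X" and z=x and z'=x])
        (use app x in \<open>simp_all add: approximating_iff\<close>)
    also have "\<dots> = Hom X \<sigma> x" using app \<sigma> x by (simp add: approximating_iff)
    finally show ?thesis .
  qed
  then have "Hom X (principal {S (w.tr x)}) z = Hom X (principal {x}) z" if "z \<in> A" for z
    using that x by (simp add: w.Hom_S_tr_point UU_principal)
  then have "v \<sigma> (S (w.tr x)) = v \<sigma> x"
    by (rule distributor_eq_of_Hom_eq[OF X v(1) \<sigma> S_in[OF w.tr_in[OF x]] x])
  moreover have "v \<sigma> (S (w.tr x)) \<le> w.tr x \<sigma>"
    using wb v(1) \<sigma> w.tr_in[OF x] unfolding is_way_below_iff by blast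
  ultimately show ?thesis by (simp add: transpose_dist_eval \<sigma>)
qed

text \<open>Interpolation replaces \<open>v\<close> by \<open>v \<circ> v\<close>, and the lifting
  property applied to \<open>v\<close> itself lowers the outer factor at \<open>S \<psi>\<close> to
  \<psi>.\<close>

lemma J_cocontinuous_dist_of_way_below:
  assumes app: "approximating J X v" and wb: "is_way_below J X S v"
  shows "J_cocontinuous_dist J X S v"
  unfolding J_cocontinuous_dist_iff
proof (intro ballI antisym kleisli_eval_v_le)
  fix \<sigma> \<psi> assume \<sigma>: "\<sigma> \<in> UU A" and \<psi>: "\<psi> \<in> B"
  have "v \<sigma> (S \<psi>) \<le> kleisli A A v v \<sigma> (S \<psi>)" by (rule le_kleisli_self[OF app wb \<sigma> S_in[OF \<psi>]])
  also have "\<dots> \<le> kleisli A A eval_rel v \<sigma> \<psi>"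
  proof (rule kleisli_mono)
    show "v \<upsilon> (S \<psi>) \<le> \<psi> \<upsilon>" if "\<upsilon> \<in> UU A" for \<upsilon>
      using wb v(1) that \<psi> unfolding is_way_below_iff by blast
  qed simp
  finally show "v \<sigma> (S \<psi>) \<le> kleisli A A eval_rel v \<sigma> \<psi>" .
qed

text \<open>Approximation gives \<open>v \<le> X\<close>, so cocontinuity bounds \<open>v\<close> at
  \<open>S \<psi>\<close> by \<open>\<psi> \<circ> X = \<psi>\<close>, and the adjunction turns this
  into \<open>S\<^sup>* \<le> T\<^sub>*\<close>. Conversely, functoriality of \<open>S\<close> maps
  \<open>T\<^sub>*\<close> into the structure of \<open>X\<close> along \<open>S T\<close>, which
  approximation identifies with the identity.\<close>

lemma lower_star_eq_upper_star_of_J_cocontinuous_dist: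
  assumes app: "approximating J X v" and cc: "J_cocontinuous_dist J X S v"
  shows lower_star_eq_upper_star
  unfolding lower_star_eq_upper_star_def
proof (intro ballI antisym)
  have v_le: "v \<sigma> x \<le> Hom X \<sigma> x" if \<sigma>: "\<sigma> \<in> UU A" and x: "x \<in> A" for \<sigma> x
  proof -
    have "\<forall>\<upsilon>\<in>UU A. Hom X \<upsilon> x \<le> kext A (Hom X) v \<upsilon> x" using app x by (simp add: approximating_iff)
    then have "kleisli A A (Hom X) v \<sigma> x \<le> Hom X \<sigma> x"
      using \<sigma> unfolding kleisli_kext_iff[symmetric] by blast
    then show ?thesis using distributor_left[OF v(1) \<sigma> x] by simp
  qed
  fix \<sigma> \<psi> assume \<sigma>: "\<sigma> \<in> UU A" and \<psi>: "\<psi> \<in> B"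
  have "kleisli A A (Hom X) v \<nu> (S \<psi>) \<le> eval_rel \<nu> \<psi>" if \<nu>: "\<nu> \<in> UU A" for \<nu>
  proof -
    have "kleisli A A (Hom X) v \<nu> (S \<psi>) = v \<nu> (S \<psi>)" by (rule distributor_left[OF v(1) \<nu> S_in[OF \<psi>]])
    also have "\<dots> = kleisli A A eval_rel v \<nu> \<psi>" using cc \<nu> \<psi> by (simp add: J_cocontinuous_dist_iff)
    also have "\<dots> \<le> kleisli A A (to_one \<psi>) (Hom X) \<nu> ()"
      by (rule kleisli_mono) (simp_all add: v_le to_one_def)
    also have "\<dots> = \<psi> \<nu>"
      using distributor_right[of X "to_one \<psi>" one_cat \<nu> "()"] \<psi> \<nu> by (simp add: J_cat_iff to_one_def)
    finally show ?thesis .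
  qed
  then have "\<forall>\<upsilon>\<in>UU A. Hom X \<upsilon> (S \<psi>) \<le> kext A eval_rel v \<upsilon> \<psi>"
    by (subst kleisli_kext_iff[where \<gamma>=eval_rel and z'=\<psi> and \<beta>="Hom X" and z="S \<psi>", symmetric]) blast
  with \<sigma> show "Hom X \<sigma> (S \<psi>) \<le> kext A eval_rel v \<sigma> \<psi>" by blast
  have tr\<sigma>: "filtermap tr \<sigma> \<in> UU B" using \<sigma> tr_in by (rule UU_filtermap)
  have "kext A eval_rel v \<sigma> \<psi> = Hom JX (filtermap tr \<sigma>) \<psi>" by (simp add: Hom_tr \<sigma>)
  also have "\<dots> \<le> Hom X (filtermap S (filtermap tr \<sigma>)) (S \<psi>)"
    by (rule uq_functorD(2)[OF S_functor tr\<sigma> \<psi>])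
  also have "\<dots> = Hom X \<sigma> (S \<psi>)"
    using app \<sigma> S_in[OF \<psi>] by (simp add: Hom_S_tr approximating_iff)
  finally show "kext A eval_rel v \<sigma> \<psi> \<le> Hom X \<sigma> (S \<psi>)" .
qed

section \<open>Cocontinuity of the transposed functor\<close>

abbreviation comp_v :: "('a filter \<Rightarrow> 'q) \<Rightarrow> 'a filter \<Rightarrow> 'q" where
  "comp_v \<psi> \<equiv> transpose_dist X (kleisli A A (to_one \<psi>) v) ()"

lemma comp_v_in:
  assumes "\<psi> \<in> B"
  shows "comp_v \<psi> \<in> B"
proof (rule transpose_dist_in_J_cat[OF J uq_category_one])
  show "distributor X (kleisli A A (to_one \<psi>) v) one_cat"
    using assms by (intro distributor_kleisli v(1)) (simp add: J_cat_iff)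
  show "in_class J X (kleisli A A (to_one \<psi>) v) one_cat"
    using assms by (intro in_class_kleisli[OF J X v(2)]) (simp add: J_cat_iff)
qed simp

lemma comp_v_eval: "\<sigma> \<in> UU A \<Longrightarrow> comp_v \<psi> \<sigma> = kleisli A A eval_rel v \<sigma> \<psi>"
  by (simp add: transpose_dist_eval) (rule kleisli_cong, simp_all add: to_one_def)

lemma push_in:
  assumes \<psi>: "\<psi> \<in> B" and c: "inj_on (c :: _ \<Rightarrow> 'u) B"
  shows "push X tr JX \<psi> \<in> Obj (J_cat J JX)"
  unfolding push_def
proof (rule transpose_dist_in_J_cat[OF J uq_category_one])
  have \<psi>': "distributor X (to_one \<psi>) one_cat" "in_class J X (to_one \<psi>) one_cat"
    using \<psi> by (simp_all add: J_cat_iff)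
  from \<psi>'(2) obtain i where i: "inj_on (i :: _ \<Rightarrow> 'u) A" unfolding in_class_def by blast
  show "distributor JX (kleisli B A (to_one \<psi>) (upper_star JX tr)) one_cat"
    by (intro distributor_kleisli distributor_upper_star X cat_JX tr_functor \<psi>'(1))
  show "in_class J JX (kleisli B A (to_one \<psi>) (upper_star JX tr)) one_cat"
    by (rule in_class_kleisli[OF J X in_class_upper_star[OF J X cat_JX tr_functor i c] \<psi>'(2)])
qed simp

text \<open>The left-hand side is \<open>JX \<circ>- (\<psi> \<circ> T\<^sup>*)\<close>. Since \<open>JX = y\<^sub>* \<circ>- y\<^sub>*\<close>, it equals
  \<open>y\<^sub>* \<circ>- (\<psi> \<circ> T\<^sup>* \<circ> y\<^sub>*) = y\<^sub>* \<circ>- (\<psi> \<circ> v)\<close>, so \<open>\<psi> \<circ> v\<close> is a supremum of \<open>\<psi> \<circ> T\<^sup>*\<close>.\<close>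

lemma kext_push:
  assumes \<psi>: "\<psi> \<in> B" and \<zeta>: "\<zeta> \<in> B"
  shows "kext B (Hom JX) (to_one (push X tr JX \<psi>)) (principal {()}) \<zeta> = Hom JX (principal {comp_v \<psi>}) \<zeta>"
proof -
  let ?p = "principal {()}"
  have p: "?p \<in> UU (UNIV :: unit set)" by (simp add: UU_unit)
  let ?h = "kleisli B A (to_one \<psi>) (upper_star JX tr)"
  have "kext B (Hom JX) (to_one (push X tr JX \<psi>)) ?p \<zeta> = kext B (kext A eval_rel eval_rel) ?h ?p \<zeta>"
    by (rule kext_cong[OF p, where \<gamma>="Hom JX" and \<gamma>'="kext A eval_rel eval_rel" and z=\<zeta> and z'=\<zeta>])
      (simp_all add: to_one_def push_def transpose_dist_eval Hom_J_cat)
  also have "\<dots> = kext A eval_rel (kleisli A B ?h eval_rel) ?p \<zeta>"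
    by (rule kext_kleisli[OF p, symmetric])
  also have "kleisli A B ?h eval_rel = kleisli A A (to_one \<psi>) (kleisli A B (upper_star JX tr) eval_rel)"
    by (rule kleisli_assoc[symmetric])
  also have "kext A eval_rel \<dots> ?p \<zeta> = kext A eval_rel (kleisli A A (to_one \<psi>) v) ?p \<zeta>"
  proof (rule kext_cong[OF p, where \<gamma>=eval_rel and \<gamma>'=eval_rel and z=\<zeta> and z'=\<zeta>])
    fix \<sigma> and u :: unit assume "\<sigma> \<in> UU A"
    show "kleisli A A (to_one \<psi>) (kleisli A B (upper_star JX tr) eval_rel) \<sigma> u = kleisli A A (to_one \<psi>) v \<sigma> u"
    proof (rule kleisli_cong)
      fix \<nu> x assume \<nu>: "\<nu> \<in> UU A" and x: "x \<in> A"
      have "kleisli A B (upper_star JX tr) eval_rel \<nu> x = kleisli A B (Hom JX) eval_rel \<nu> (tr x)"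
        by (rule kleisli_cong) (simp_all add: upper_star_def)
      also have "\<dots> = v \<nu> x" by (simp add: kleisli_J_cat \<nu> tr_in x transpose_dist_eval)
      finally show "kleisli A B (upper_star JX tr) eval_rel \<nu> x = v \<nu> x" .
    qed simp
  qed simp
  also have "\<dots> = Hom JX (filtermap (transpose_dist X (kleisli A A (to_one \<psi>) v)) ?p) \<zeta>"
    using Hom_transpose_dist[OF p, of X "kleisli A A (to_one \<psi>) v" J \<zeta>] comp_v_in[OF \<psi>] by simp
  finally show ?thesis by (simp add: filtermap_principal)
qed

lemma is_supremum_push_iff:
  assumes "\<psi> \<in> B"
  shows "is_supremum JX (push X tr JX \<psi>) \<chi> \<longleftrightarrow>
    \<chi> \<in> B \<and> (\<forall>\<zeta>\<in>B. Hom JX (principal {\<chi>}) \<zeta> = Hom JX (principal {comp_v \<psi>}) \<zeta>)"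
  by (auto simp: is_supremum_def rel_eq_def UU_unit lower_star_def filtermap_principal kext_push assms)

text \<open>Preservation of the supremum \<open>S \<psi>\<close> compares
  \<open>tr (S \<psi>)\<close> with \<open>comp_v \<psi>\<close>, and at \<sigma> this comparison is
  cocontinuity of \<open>v\<close>. The embedding \<open>c\<close> puts the weight into the class,
  which the guard in the definition of a cocontinuous functor demands.\<close>

lemma J_cocontinuous_functor_iff:
  assumes c: "inj_on (c :: _ \<Rightarrow> 'u) B"
  shows "J_cocontinuous_functor J X tr JX \<longleftrightarrow> J_cocontinuous_dist J X S v"
proof
  assume cc: "J_cocontinuous_functor J X tr JX"
  show "J_cocontinuous_dist J X S v"
    unfolding J_cocontinuous_dist_iff
  proof (intro ballI)
    fix \<sigma> \<psi> assume \<sigma>: "\<sigma> \<in> UU A" and \<psi>: "\<psi> \<in> B"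
    have "is_supremum X \<psi> (S \<psi>)" by (simp add: is_supremum_iff \<psi> S_in)
    moreover have "is_supremum JX (push X tr JX \<psi>) (comp_v \<psi>)"
      by (simp add: is_supremum_push_iff \<psi> comp_v_in)
    ultimately have "is_supremum JX (push X tr JX \<psi>) (tr (S \<psi>))"
      using cc push_in[OF \<psi> c] \<psi> unfolding J_cocontinuous_functor_def by blast
    then have eq: "\<forall>\<zeta>\<in>B. Hom JX (principal {tr (S \<psi>)}) \<zeta> = Hom JX (principal {comp_v \<psi>}) \<zeta>"
      and t: "tr (S \<psi>) \<in> B" by (auto simp: is_supremum_push_iff \<psi>)
    \<comment> \<open>The order of \<open>JX\<close> is pointwise, so equivalent presheaves agree on
      ultrafilters of \<open>X\<close>.\<close>
    have "tr (S \<psi>) \<sigma> \<le> comp_v \<psi> \<sigma>"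
      using Hom_J_cat_le[OF _ t \<sigma>, of "comp_v \<psi>"] eq comp_v_in[OF \<psi>] Hom_refl[OF cat_JX comp_v_in[OF \<psi>]]
      by simp
    moreover have "comp_v \<psi> \<sigma> \<le> tr (S \<psi>) \<sigma>"
      using Hom_J_cat_le[OF _ comp_v_in[OF \<psi>] \<sigma>, of "tr (S \<psi>)"] eq t Hom_refl[OF cat_JX t]
      by simp
    ultimately have "tr (S \<psi>) \<sigma> = comp_v \<psi> \<sigma>" by (rule antisym)
    then show "v \<sigma> (S \<psi>) = kleisli A A eval_rel v \<sigma> \<psi>"
      unfolding comp_v_eval[OF \<sigma>] by (simp add: transpose_dist_eval \<sigma>)
  qed
next
  assume cc: "J_cocontinuous_dist J X S v"
  show "J_cocontinuous_functor J X tr JX"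
    unfolding J_cocontinuous_functor_def
  proof (intro conjI ballI impI allI tr_functor)
    fix \<psi> x assume \<psi>: "\<psi> \<in> B" and "is_supremum X \<psi> x"
    then have x: "x \<in> A" and eq: "\<And>z. z \<in> A \<Longrightarrow> Hom X (principal {x}) z = Hom X (principal {S \<psi>}) z"
      by (simp_all add: is_supremum_iff)
    \<comment> \<open>Both are restricted to \<open>UU A\<close>, so agreement there is equality of
      functions and not only an equivalence.\<close>
    have "tr x = comp_v \<psi>"
    proof
      fix \<sigma>
      show "tr x \<sigma> = comp_v \<psi> \<sigma>"
      proof (cases "\<sigma> \<in> UU A")
        case True
        have "v \<sigma> x = v \<sigma> (S \<psi>)" by (rule distributor_eq_of_Hom_eq[OF X v(1) True x S_in[OF \<psi>] eq])
        also have "\<dots> = comp_v \<psi> \<sigma>"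
          unfolding comp_v_eval[OF True] using cc True \<psi> by (simp add: J_cocontinuous_dist_iff)
        finally show ?thesis by (simp add: transpose_dist_eval True)
      qed (simp add: transpose_dist_def)
    qed
    then show "is_supremum JX (push X tr JX \<psi>) (tr x)"
      by (simp add: is_supremum_push_iff \<psi> comp_v_in)
  qed
qed

end

theorem theorem5p20:
  fixes J :: "('u, 'q::quantale) dist_class"
    and X :: "('a, 'q) ucat"
    and v :: "'a filter \<Rightarrow> 'a \<Rightarrow> 'q"
    and S :: "('a filter \<Rightarrow> 'q) \<Rightarrow> 'a"
  assumes xi_mult: "\<And>\<omega> :: ('q \<times> 'q) filter. \<omega> \<in> UU UNIV \<Longrightarrow>
        xi (filtermap (\<lambda>(a, b). a * b) \<omega>) = xi (filtermap fst \<omega>) * xi (filtermap snd \<omega>)"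
    and xi_one: "xi (principal {1::'q}) = 1"
    and xi_mono: "\<And>(A :: 'u set) (B :: 'u set) f (\<phi> :: 'u \<Rightarrow> 'q) (\<psi> :: 'u \<Rightarrow> 'q) \<sigma>.
        \<lbrakk>f ` A \<subseteq> B; \<forall>y\<in>B. \<psi> y \<le> (SUP x\<in>{x\<in>A. f x = y}. \<phi> x); \<sigma> \<in> UU B\<rbrakk> \<Longrightarrow>
        xi (filtermap \<psi> \<sigma>) \<le> (SUP \<nu>\<in>{\<nu>\<in>UU A. filtermap f \<nu> = \<sigma>}. xi (filtermap \<phi> \<nu>))"
    and universe: "\<exists>c :: ('a filter \<Rightarrow> 'q) \<Rightarrow> 'u. inj c"
    and J: "distributor_class J"
    and X: "uq_category X"
    and cocomplete: "J_cocomplete J X"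
    and S: "adjoint (J_cat J X) S X (yoneda X)"
    and v: "distributor X v X" "in_class J X v X"
  shows "let
      cond_i = uq_functor X (transpose_dist X v) (J_cat J X) \<and>
               adjoint X (transpose_dist X v) (J_cat J X) S;
      cond_ii = approximating J X v \<and> is_way_below J X S v;
      cond_iii = approximating J X v \<and> J_cocontinuous_dist J X S v;
      cond_iv = (\<forall>x\<in>Obj X. approximating_at J X v x) \<and> J_cocontinuous_dist J X S v;
      cond_v = (\<forall>x\<in>Obj X. approximating_at J X v x) \<and>
               J_cocontinuous_functor J X (transpose_dist X v) (J_cat J X);
      cond_vi = (\<forall>\<sigma>\<in>UU (Obj X). \<forall>\<psi>\<in>Obj (J_cat J X).
               Hom (hat X) (filtermap (transpose_dist X v) \<sigma>) \<psi> = Hom X \<sigma> (S \<psi>))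
    in (cond_i \<longleftrightarrow> cond_ii) \<and> (cond_ii \<longleftrightarrow> cond_iii) \<and> (cond_iii \<longleftrightarrow> cond_iv) \<and>
       (cond_iv \<longleftrightarrow> cond_v) \<and> (cond_v \<longleftrightarrow> cond_vi)"
proof -
  interpret J_cocomplete_dist "TYPE('q)" J X S v
    by unfold_locales (fact xi_mult J X S v)+
  obtain c :: "('a filter \<Rightarrow> 'q) \<Rightarrow> 'u" where "inj c" using universe by blast
  then have c: "inj_on c B" by (rule inj_on_subset) simp
  \<comment> \<open>Rewriting makes (i) and (vi) the same proposition and turns (iv) and (v) into
    (iii); what remains is a cycle through \<open>lower_star_eq_upper_star\<close>, (ii) and
    (iii).\<close>
  note cycle = approximating_of_lower_star_eq_upper_star is_way_below_of_lower_star_eq_upper_star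
    J_cocontinuous_dist_of_way_below lower_star_eq_upper_star_of_J_cocontinuous_dist
  show ?thesis
    unfolding Let_def J_cocontinuous_functor_iff[OF c] lower_star_eq_upper_star_iff_Hom_hat[symmetric]
      adjoint_iff approximating_iff_all_approximating_at[symmetric]
    using cycle by blast
qed

end
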